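(* Fix integers $N,M\ge1$ and $\lambda=(\lambda_1,\lambda_2,\lambda_3)\in\Bbbk^3$. If $L$ is an irreducible $H_\lambda$-module, then there exists $\chi\in\mathbb{G}_{2N}\times\mathbb{G}_{2M}$ such that $L$ is isomorphic to one of the following types: $L\simeq L_1^\chi$, $L\simeq L_{2,h}^\chi$, $L\simeq L_{2,v}^\chi$ or $L\simeq L_4^\chi$. More precisely, the simple $H_\lambda$-modules are, up to isomorphism, the following, where $(N,M)$ denotes the greatest common divisor. (1) If $\lambda_1=\lambda_2=\lambda_3=0$: $4MN$ modules $L_1^\chi$, $\chi\in\mathcal{O}$. (2) If $\lambda_1\ne0$ and $\lambda_2=\lambda_3=0$: $4M$ modules $L_1^\chi$, $\chi\in\{\pm1\}\times\mathbb{G}_{2M}$; and $2M(N-1)$ modules $L_{2,h}^\chi$, $\chi\in\mathbb{H}_N\times\mathbb{G}_{2M}$. (3) If $\lambda_2\neq0$ and $\lambda_1=\lambda_3=0$: $4N$ modules $L_1^\chi$, $\chi\in\mathbb{G}_{2N}\times\{\pm1\}$; and $2N(M-1)$ modules $L_{2,v}^\chi$, $\chi\in\mathbb{G}_{2N}\times\mathbb{H}_M$. (4) If $\lambda_3\ne0$ and $\lambda_1=\lambda_2=0$: $4(N,M)$ modules $L_1^\chi$, $\chi\in\mathbb{S}_{N,M}$; and $2NM-2(N,M)$ modules $L_4^\chi$, $\chi\notin\mathbb{S}_{N,M}$. (5) If $\lambda_2\lambda_3\ne0$ and $\lambda_1=0$: $4$ modules $L_1^\chi$, $\chi\in\{\pm1\}^{2}$;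 $2(N,M)-2$ modules $L_{2,v}^\chi$, $\chi=(\chi_1,\chi_2)\in\mathbb{S}_{N,M}$ with $\chi_2\in\mathbb{H}_M$; and $2NM-2(N,M)$ modules $L_4^\chi$, $\chi\in\overline{\mathcal{O}}_4$. (6) If $\lambda_1\lambda_3\neq0$ and $\lambda_2=0$: $4$ modules $L_1^\chi$, $\chi\in\{\pm1\}^{2}$; $2(N,M)-2$ modules $L_{2,h}^\chi$, $\chi=(\chi_1,\chi_2)\in\mathbb{S}_{N,M}$ with $\chi_1\in\mathbb{H}_N$; and $2NM-2(N,M)$ modules $L_4^\chi$, $\chi\in\overline{\mathcal{O}}_4$. (7) If $\lambda_1\lambda_2\ne0$ and $\lambda_3=0$: $4$ modules $L_1^\chi$, $\chi\in\{\pm1\}^2$; $2(M-1)$ modules $L_{2,v}^\chi$, $\chi\in\{\pm1\}\times\mathbb{H}_M$; and $2M(N-1)$ modules $L_4^\chi$, $\chi\in\overline{\mathcal{O}}_4$. (8) If $\lambda_1\lambda_2\lambda_3\ne0$: (a) if $\lambda_3\neq2\lambda_1\lambda_2$: $4$ modules $L_1^\chi$, $\chi\in\{\pm1\}^2$, and $2(NM-1)$ modules $L_4^\chi$, $\chi\in\overline{\mathcal{O}}_4$; (b) if $\lambda_3=2\lambda_1\lambda_2$: $4$ modules $L_1^\chi$, $\chi\in\{\pm1\}^2$, $2(N-1)$ modules $L_{2,h}^\chi$, $\chi\in\mathbb{H}_N\times\{\pm1\}$, and $2N(M-1)$ modules $L_4^\chi$, $\chi\in\overline{\mathcal{O}}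_4$.
   Context: $\Bbbk$ is an algebraically closed field of characteristic zero; $\mathbb{G}_n\subset\Bbbk$ is the group of $n$th roots of 1; $\zeta,\xi$ are primitive roots of 1 of orders $2N$, $2M$. $\Gamma=\langle g_1,g_2: g_1g_2=g_2g_1,\ g_1^{2N}=g_2^{2M}=1\rangle$. $H_\lambda$ is the algebra generated by $\Gamma$ and $a_1,a_2$ with relations $g_1a_1=-a_1g_1$, $g_1a_2=-a_2g_1$, $g_2a_1=a_1g_2$, $g_2a_2=-a_2g_2$, $a_1^2=\lambda_1(1-g_1^2)$, $a_2^2=\lambda_2(1-g_2^2)$, $a_1a_2a_1a_2+a_2a_1a_2a_1=\lambda_3(1-g_1^2g_2^2)-2\lambda_1\lambda_2(1+g_2^2)(1-g_1^2)$. $\mathcal{O}=\mathbb{G}_{2N}\times\mathbb{G}_{2M}$, $\mathbb{H}_N=\{\zeta^i:1\le i\le N-1\}$, $\mathbb{H}_M=\{\xi^j:1\le j\le M-1\}$, $\mathbb{S}_{N,M}=\{(\chi_1,\chi_2)\in\mathcal{O}:\chi_1^2\chi_2^2=1\}$. For $\chi=(\chi_1,\chi_2)\in\mathcal{O}$, a vector $v$ is of type $\chi$ if $g_iv=\chi_iv$, $i=1,2$. Put $\bar\chi=(-\chi_1,\chi_2)$, $-\chi=(-\chi_1,-\chi_2)$, $-\bar\chi=(\chi_1,-\chi_2)$, and $\alpha_1=\lambda_1(1-\chi_1^2)$, $\alpha_2=\lambda_2(1-\chi_2^2)$, $\alpha_3=\lambda_3(1-\chi_1^2\chi_2^2)-2\lambda_1\lambda_2(1+\chi_2^2)(1-\chi_1^2)$.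 $\mathcal{O}_1=\{\chi:\alpha_1=\alpha_2=\alpha_3=0\}$; $\mathcal{O}_2=\{\chi:\alpha_3=0$ and exactly one of $\alpha_1,\alpha_2$ is nonzero$\}$; $\mathcal{O}_4=\mathcal{O}\setminus(\mathcal{O}_1\sqcup\mathcal{O}_2)$; $\overline{\mathcal{O}}_4=\mathcal{O}_4/\!\sim$, where $\chi\sim\chi'$ iff $\chi'\in\{\chi,-\bar\chi\}$. Modules: $L_1^\chi=\Bbbk v$ ($\chi\in\mathcal{O}_1$), $v$ of type $\chi$, $a_1v=a_2v=0$. $L_{2,h}^\chi$ ($\chi\in\mathcal{O}_2$, $\alpha_1\ne0$): basis $v,w$ of types $\chi,\bar\chi$, $a_1v=w$, $a_1w=\alpha_1v$, $a_2v=a_2w=0$. $L_{2,v}^\chi$ ($\chi\in\mathcal{O}_2$, $\alpha_2\neq0$): basis $v,w$ of types $\chi,-\chi$, $a_2v=w$, $a_2w=\alpha_2v$, $a_1v=a_1w=0$. $L_4^\chi(d)$ ($\chi\in\mathcal{O}_4$, $d\in\Bbbk$ with $\alpha_1^2\alpha_2d^2-\alpha_3d+\alpha_2=0$, and $c=\alpha_3-\alpha_1^2\alpha_2d$): basis $v_1,\dots,v_4$ of types $\chi,\bar\chi,-\bar\chi,-\chi$, with $a_1v_1=v_2$, $a_1v_2=\alpha_1v_1$, $a_1v_3=v_4$, $a_1v_4=\alpha_1v_3$, $a_2v_1=dv_4$, $a_2v_4=cv_1$, $a_2v_2=v_3$, $a_2v_3=\alpha_2v_2$. The notation $L_4^\chi$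 abbreviates $L_4^\chi(d)$ with $d$ a solution of this quadratic equation.
   Formalization: In (8) the special value is λ3=4λ1λ2, not 2λ1λ2. In (8a) the count 2(NM-1) over Ō4 needs no χ in O4 with α1α2≠0, α3²=4α1²α2²; else χ~χ̄ is added for such χ and the count drops by a quarter of their number. L4^χ uses one d for equal (α1,α2,α3). *)

theory Defs
  imports
    "HOL-Library.Poly_Mapping"
    "HOL-Computational_Algebra.Polynomial"
    "HOL-Algebra.Module"
    "HOL-Algebra.QuotRing"
    "Jordan_Normal_Form.Matrix"
begin

section \<open>Left modules over a not necessarily commutative ring\<close>

text \<open>The locale \<open>module\<close> of the library asks for a commutative ring of scalars; this is the same
  list of axioms without commutativity. The library's \<open>submodule\<close> applies to any ring of scalars.\<close>

locale left_module = R?: ring + M?: abelian_group M for M (structure) +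
  assumes smult_closed:
      "\<lbrakk>a \<in> carrier R; x \<in> carrier M\<rbrakk> \<Longrightarrow> a \<odot>\<^bsub>M\<^esub> x \<in> carrier M"
    and smult_l_distr:
      "\<lbrakk>a \<in> carrier R; b \<in> carrier R; x \<in> carrier M\<rbrakk> \<Longrightarrow>
        (a \<oplus> b) \<odot>\<^bsub>M\<^esub> x = a \<odot>\<^bsub>M\<^esub> x \<oplus>\<^bsub>M\<^esub> b \<odot>\<^bsub>M\<^esub> x"
    and smult_r_distr:
      "\<lbrakk>a \<in> carrier R; x \<in> carrier M; y \<in> carrier M\<rbrakk> \<Longrightarrow>
        a \<odot>\<^bsub>M\<^esub> (x \<oplus>\<^bsub>M\<^esub> y) = a \<odot>\<^bsub>M\<^esub> x \<oplus>\<^bsub>M\<^esub> a \<odot>\<^bsub>M\<^esub> y"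
    and smult_assoc:
      "\<lbrakk>a \<in> carrier R; b \<in> carrier R; x \<in> carrier M\<rbrakk> \<Longrightarrow>
        (a \<otimes> b) \<odot>\<^bsub>M\<^esub> x = a \<odot>\<^bsub>M\<^esub> (b \<odot>\<^bsub>M\<^esub> x)"
    and smult_one:
      "x \<in> carrier M \<Longrightarrow> \<one> \<odot>\<^bsub>M\<^esub> x = x"

definition simple_module :: "('r, 'x) ring_scheme \<Rightarrow> ('r, 'v) module \<Rightarrow> bool" where
  "simple_module R L \<longleftrightarrow>
     left_module R L \<and> carrier L \<noteq> {\<zero>\<^bsub>L\<^esub>} \<and>
     (\<forall>W. submodule W R L \<longrightarrow> W = {\<zero>\<^bsub>L\<^esub>} \<or> W = carrier L)"

definition iso_modules :: "('r, 'x) ring_scheme \<Rightarrow> ('r, 'v) module \<Rightarrow> ('r, 'w) module \<Rightarrow> bool" where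
  "iso_modules R L L' \<longleftrightarrow>
     (\<exists>f. bij_betw f (carrier L) (carrier L') \<and>
          (\<forall>x\<in>carrier L. \<forall>y\<in>carrier L. f (x \<oplus>\<^bsub>L\<^esub> y) = f x \<oplus>\<^bsub>L'\<^esub> f y) \<and>
          (\<forall>a\<in>carrier R. \<forall>x\<in>carrier L. f (a \<odot>\<^bsub>L\<^esub> x) = a \<odot>\<^bsub>L'\<^esub> f x))"

text \<open>\<open>simples_up_to_iso R \<L> TYPE('b)\<close>: the set \<open>\<L>\<close> consists of pairwise non-isomorphic simple
  modules, and every simple module whose elements have type \<open>'b\<close> is isomorphic to a member of \<open>\<L>\<close>.\<close>

definition simples_up_to_iso ::
    "('r, 'x) ring_scheme \<Rightarrow> ('r, 'v) module set \<Rightarrow> 'b itself \<Rightarrow> bool" where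
  "simples_up_to_iso R \<L> ty \<longleftrightarrow>
     (\<forall>L\<in>\<L>. simple_module R L) \<and>
     (\<forall>L\<in>\<L>. \<forall>L'\<in>\<L>. iso_modules R L L' \<longrightarrow> L = L') \<and>
     (\<forall>L :: ('r, 'b) module. simple_module R L \<longrightarrow> (\<exists>L'\<in>\<L>. iso_modules R L L'))"


section \<open>The algebra\<close>

datatype gen = G1 | G2 | A1 | A2

text \<open>The free monoid on the four generators. A copy of the type of lists is needed because
  the monoid algebra structure of finitely supported functions is tied to a type class.\<close>

datatype word = Word (letters: "gen list")

instantiation word :: monoid_add
begin
definition zero_word :: word where "zero_word = Word []"
definition plus_word :: "word \<Rightarrow> word \<Rightarrow> word" where
  "plus_word u v = Word (letters u @ letters v)"
instance by standard (auto simp: zero_word_def plus_word_def)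
end

text \<open>Finitely supported functions on words, with the convolution product, form the free algebra.\<close>

type_synonym 'k free_alg = "word \<Rightarrow>\<^sub>0 'k"

definition free_algebra :: "'k::comm_ring_1 free_alg ring" where
  "free_algebra = \<lparr>carrier = UNIV, mult = (*), one = 1, zero = 0, add = (+)\<rparr>"

definition gen :: "gen \<Rightarrow> 'k::comm_ring_1 free_alg" where
  "gen x = Poly_Mapping.single (Word [x]) 1"

definition const :: "'k::comm_ring_1 \<Rightarrow> 'k free_alg" where
  "const c = Poly_Mapping.single 0 c"

text \<open>The differences of the two sides of the defining relations. The first three present the
  group \<open>\<Gamma>\<close>.\<close>

definition relators :: "nat \<Rightarrow> nat \<Rightarrow> 'k::comm_ring_1 \<Rightarrow> 'k \<Rightarrow> 'k \<Rightarrow> 'k free_alg set" where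
  "relators N M l1 l2 l3 =
    (let g1 = gen G1; g2 = gen G2; a1 = gen A1; a2 = gen A2 in
     {g1 * g2 - g2 * g1, g1 ^ (2 * N) - 1, g2 ^ (2 * M) - 1,
      g1 * a1 - (- (a1 * g1)), g1 * a2 - (- (a2 * g1)),
      g2 * a1 - a1 * g2, g2 * a2 - (- (a2 * g2)),
      a1\<^sup>2 - const l1 * (1 - g1\<^sup>2),
      a2\<^sup>2 - const l2 * (1 - g2\<^sup>2),
      (a1 * a2 * a1 * a2 + a2 * a1 * a2 * a1) -
        (const l3 * (1 - g1\<^sup>2 * g2\<^sup>2) - const (2 * l1 * l2) * (1 + g2\<^sup>2) * (1 - g1\<^sup>2))})"

definition H :: "nat \<Rightarrow> nat \<Rightarrow> 'k::comm_ring_1 \<Rightarrow> 'k \<Rightarrow> 'k \<Rightarrow> 'k free_alg set ring" where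
  "H N M l1 l2 l3 = free_algebra Quot (Idl\<^bsub>free_algebra\<^esub> (relators N M l1 l2 l3))"


section \<open>Types\<close>

definition primitive_root_of_unity :: "nat \<Rightarrow> 'k::comm_ring_1 \<Rightarrow> bool" where
  "primitive_root_of_unity n z \<longleftrightarrow> n > 0 \<and> z ^ n = 1 \<and> (\<forall>k. 0 < k \<and> k < n \<longrightarrow> z ^ k \<noteq> 1)"

definition roots_1 :: "nat \<Rightarrow> 'k::comm_ring_1 set" where
  "roots_1 n = {z. z ^ n = 1}"

text \<open>For a primitive root \<open>z\<close> of order \<open>2 n\<close>, this is \<open>\<bbbH>\<^sub>n\<close>: one representative of each pair
  \<open>{x, -x}\<close> in \<open>roots_1 (2 * n) - {1, -1}\<close>.\<close>

definition half_roots :: "nat \<Rightarrow> 'k::comm_ring_1 \<Rightarrow> 'k set" where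
  "half_roots n z = (\<lambda>i. z ^ i) ` {1..n - 1}"

definition O_all :: "nat \<Rightarrow> nat \<Rightarrow> ('k::comm_ring_1 \<times> 'k) set" where
  "O_all N M = roots_1 (2 * N) \<times> roots_1 (2 * M)"

definition S_set :: "nat \<Rightarrow> nat \<Rightarrow> ('k::comm_ring_1 \<times> 'k) set" where
  "S_set N M = {\<chi> \<in> O_all N M. (fst \<chi>)\<^sup>2 * (snd \<chi>)\<^sup>2 = 1}"

definition bar_type :: "'k::comm_ring_1 \<times> 'k \<Rightarrow> 'k \<times> 'k" where
  "bar_type \<chi> = (- fst \<chi>, snd \<chi>)"

definition neg_type :: "'k::comm_ring_1 \<times> 'k \<Rightarrow> 'k \<times> 'k" where
  "neg_type \<chi> = (- fst \<chi>, - snd \<chi>)"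

definition alpha1 :: "'k::comm_ring_1 \<Rightarrow> 'k \<times> 'k \<Rightarrow> 'k" where
  "alpha1 l1 \<chi> = l1 * (1 - (fst \<chi>)\<^sup>2)"

definition alpha2 :: "'k::comm_ring_1 \<Rightarrow> 'k \<times> 'k \<Rightarrow> 'k" where
  "alpha2 l2 \<chi> = l2 * (1 - (snd \<chi>)\<^sup>2)"

definition alpha3 :: "'k::comm_ring_1 \<Rightarrow> 'k \<Rightarrow> 'k \<Rightarrow> 'k \<times> 'k \<Rightarrow> 'k" where
  "alpha3 l1 l2 l3 \<chi> =
     l3 * (1 - (fst \<chi>)\<^sup>2 * (snd \<chi>)\<^sup>2) - 2 * l1 * l2 * (1 + (snd \<chi>)\<^sup>2) * (1 - (fst \<chi>)\<^sup>2)"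

text \<open>At \<open>\<chi>\<^sub>2 = 1\<close> or \<open>\<chi>\<^sub>2 = -1\<close> the factor \<open>1 + \<chi>\<^sub>2\<^sup>2\<close> is 2. So if \<open>\<lambda>\<^sub>1\<lambda>\<^sub>2\<lambda>\<^sub>3 \<noteq> 0\<close>, there are types
  with \<open>\<alpha>\<^sub>1 \<noteq> 0\<close> and \<open>\<alpha>\<^sub>2 = \<alpha>\<^sub>3 = 0\<close> only when \<open>\<lambda>\<^sub>3 = 4\<lambda>\<^sub>1\<lambda>\<^sub>2\<close>; in particular there are none when
  \<open>\<lambda>\<^sub>3 = 2\<lambda>\<^sub>1\<lambda>\<^sub>2\<close>.\<close>

lemma alpha3_snd_pm1:
  assumes "(snd \<chi>)\<^sup>2 = 1"
  shows "alpha3 l1 l2 l3 \<chi> = (l3 - 4 * l1 * l2) * (1 - (fst \<chi>)\<^sup>2)"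
  using assms by (simp add: alpha3_def algebra_simps)

definition O1 :: "nat \<Rightarrow> nat \<Rightarrow> 'k::comm_ring_1 \<Rightarrow> 'k \<Rightarrow> 'k \<Rightarrow> ('k \<times> 'k) set" where
  "O1 N M l1 l2 l3 =
     {\<chi> \<in> O_all N M. alpha1 l1 \<chi> = 0 \<and> alpha2 l2 \<chi> = 0 \<and> alpha3 l1 l2 l3 \<chi> = 0}"

definition O2 :: "nat \<Rightarrow> nat \<Rightarrow> 'k::comm_ring_1 \<Rightarrow> 'k \<Rightarrow> 'k \<Rightarrow> ('k \<times> 'k) set" where
  "O2 N M l1 l2 l3 =
     {\<chi> \<in> O_all N M. alpha3 l1 l2 l3 \<chi> = 0 \<and> (alpha1 l1 \<chi> \<noteq> 0) \<noteq> (alpha2 l2 \<chi> \<noteq> 0)}"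

definition O4 :: "nat \<Rightarrow> nat \<Rightarrow> 'k::comm_ring_1 \<Rightarrow> 'k \<Rightarrow> 'k \<Rightarrow> ('k \<times> 'k) set" where
  "O4 N M l1 l2 l3 = O_all N M - (O1 N M l1 l2 l3 \<union> O2 N M l1 l2 l3)"

definition type_sim :: "(('k::comm_ring_1 \<times> 'k) \<times> ('k \<times> 'k)) set" where
  "type_sim = {(\<chi>, \<chi>'). \<chi>' \<in> {\<chi>, neg_type (bar_type \<chi>)}}"

definition transversal :: "'a set \<Rightarrow> ('a \<times> 'a) set \<Rightarrow> 'a set \<Rightarrow> bool" where
  "transversal X E T \<longleftrightarrow> T \<subseteq> X \<and> (\<forall>C \<in> X // E. \<exists>!x. x \<in> C \<and> x \<in> T)"


section \<open>The modules\<close>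

text \<open>A representation of the free algebra on column vectors, given by the matrices \<open>\<rho>\<close> of the
  generators, and the structure it induces on cosets. The choice of a representative is immaterial
  (and the result is a module over \<open>H\<close>) exactly when \<open>\<rho>\<close> satisfies the defining relations.\<close>

definition word_mat :: "nat \<Rightarrow> (gen \<Rightarrow> 'k::comm_ring_1 mat) \<Rightarrow> word \<Rightarrow> 'k mat" where
  "word_mat n \<rho> w = foldr (\<lambda>x A. \<rho> x * A) (letters w) (1\<^sub>m n)"

definition alg_mat :: "nat \<Rightarrow> (gen \<Rightarrow> 'k::comm_ring_1 mat) \<Rightarrow> 'k free_alg \<Rightarrow> 'k mat" where
  "alg_mat n \<rho> p = mat n n (\<lambda>ij.
     \<Sum>w\<in>Poly_Mapping.keys p. Poly_Mapping.lookup p w * word_mat n \<rho> w $$ ij)"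

definition rep_module ::
    "nat \<Rightarrow> (gen \<Rightarrow> 'k::comm_ring_1 mat) \<Rightarrow> ('k free_alg set, 'k vec) module" where
  "rep_module n \<rho> = \<lparr>
     carrier = carrier_vec n,
     mult = undefined,
     one = undefined,
     zero = 0\<^sub>v n,
     add = (+),
     smult = (\<lambda>X v. alg_mat n \<rho> (SOME p. p \<in> X) *\<^sub>v v)\<rparr>"

text \<open>The \<open>j\<close>th column of a matrix below is the image of the \<open>j\<close>th vector of the given basis, which
  is the standard basis \<open>unit_vec n 0, unit_vec n 1, \<dots>\<close>.\<close>

fun L1_op :: "'k::comm_ring_1 \<times> 'k \<Rightarrow> gen \<Rightarrow> 'k mat" where
  "L1_op \<chi> G1 = mat_of_cols 1 [fst \<chi> \<cdot>\<^sub>v unit_vec 1 0]"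
| "L1_op \<chi> G2 = mat_of_cols 1 [snd \<chi> \<cdot>\<^sub>v unit_vec 1 0]"
| "L1_op \<chi> A1 = mat_of_cols 1 [0\<^sub>v 1]"
| "L1_op \<chi> A2 = mat_of_cols 1 [0\<^sub>v 1]"

definition L1 :: "'k::comm_ring_1 \<times> 'k \<Rightarrow> ('k free_alg set, 'k vec) module" where
  "L1 \<chi> = rep_module 1 (L1_op \<chi>)"

fun L2h_op :: "'k::comm_ring_1 \<Rightarrow> 'k \<times> 'k \<Rightarrow> gen \<Rightarrow> 'k mat" where
  "L2h_op l1 \<chi> G1 =
     mat_of_cols 2 [fst \<chi> \<cdot>\<^sub>v unit_vec 2 0, fst (bar_type \<chi>) \<cdot>\<^sub>v unit_vec 2 1]"
| "L2h_op l1 \<chi> G2 =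
     mat_of_cols 2 [snd \<chi> \<cdot>\<^sub>v unit_vec 2 0, snd (bar_type \<chi>) \<cdot>\<^sub>v unit_vec 2 1]"
| "L2h_op l1 \<chi> A1 = mat_of_cols 2 [unit_vec 2 1, alpha1 l1 \<chi> \<cdot>\<^sub>v unit_vec 2 0]"
| "L2h_op l1 \<chi> A2 = mat_of_cols 2 [0\<^sub>v 2, 0\<^sub>v 2]"

definition L2h :: "'k::comm_ring_1 \<Rightarrow> 'k \<times> 'k \<Rightarrow> ('k free_alg set, 'k vec) module" where
  "L2h l1 \<chi> = rep_module 2 (L2h_op l1 \<chi>)"

fun L2v_op :: "'k::comm_ring_1 \<Rightarrow> 'k \<times> 'k \<Rightarrow> gen \<Rightarrow> 'k mat" where
  "L2v_op l2 \<chi> G1 =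
     mat_of_cols 2 [fst \<chi> \<cdot>\<^sub>v unit_vec 2 0, fst (neg_type \<chi>) \<cdot>\<^sub>v unit_vec 2 1]"
| "L2v_op l2 \<chi> G2 =
     mat_of_cols 2 [snd \<chi> \<cdot>\<^sub>v unit_vec 2 0, snd (neg_type \<chi>) \<cdot>\<^sub>v unit_vec 2 1]"
| "L2v_op l2 \<chi> A1 = mat_of_cols 2 [0\<^sub>v 2, 0\<^sub>v 2]"
| "L2v_op l2 \<chi> A2 = mat_of_cols 2 [unit_vec 2 1, alpha2 l2 \<chi> \<cdot>\<^sub>v unit_vec 2 0]"

definition L2v :: "'k::comm_ring_1 \<Rightarrow> 'k \<times> 'k \<Rightarrow> ('k free_alg set, 'k vec) module" where
  "L2v l2 \<chi> = rep_module 2 (L2v_op l2 \<chi>)"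

definition L4_eq :: "'k::comm_ring_1 \<Rightarrow> 'k \<Rightarrow> 'k \<Rightarrow> 'k \<times> 'k \<Rightarrow> 'k \<Rightarrow> bool" where
  "L4_eq l1 l2 l3 \<chi> d \<longleftrightarrow>
     (alpha1 l1 \<chi>)\<^sup>2 * alpha2 l2 \<chi> * d\<^sup>2 - alpha3 l1 l2 l3 \<chi> * d + alpha2 l2 \<chi> = 0"

fun L4_op :: "'k::comm_ring_1 \<Rightarrow> 'k \<Rightarrow> 'k \<Rightarrow> 'k \<times> 'k \<Rightarrow> 'k \<Rightarrow> gen \<Rightarrow> 'k mat" where
  "L4_op l1 l2 l3 \<chi> d G1 = mat_of_cols 4
     [fst \<chi> \<cdot>\<^sub>v unit_vec 4 0,
      fst (bar_type \<chi>) \<cdot>\<^sub>v unit_vec 4 1,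
      fst (neg_type (bar_type \<chi>)) \<cdot>\<^sub>v unit_vec 4 2,
      fst (neg_type \<chi>) \<cdot>\<^sub>v unit_vec 4 3]"
| "L4_op l1 l2 l3 \<chi> d G2 = mat_of_cols 4
     [snd \<chi> \<cdot>\<^sub>v unit_vec 4 0,
      snd (bar_type \<chi>) \<cdot>\<^sub>v unit_vec 4 1,
      snd (neg_type (bar_type \<chi>)) \<cdot>\<^sub>v unit_vec 4 2,
      snd (neg_type \<chi>) \<cdot>\<^sub>v unit_vec 4 3]"
| "L4_op l1 l2 l3 \<chi> d A1 = mat_of_cols 4
     [unit_vec 4 1,
      alpha1 l1 \<chi> \<cdot>\<^sub>v unit_vec 4 0,
      unit_vec 4 3,
      alpha1 l1 \<chi> \<cdot>\<^sub>v unit_vec 4 2]"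
| "L4_op l1 l2 l3 \<chi> d A2 = mat_of_cols 4
     [d \<cdot>\<^sub>v unit_vec 4 3,
      unit_vec 4 2,
      alpha2 l2 \<chi> \<cdot>\<^sub>v unit_vec 4 1,
      (alpha3 l1 l2 l3 \<chi> - (alpha1 l1 \<chi>)\<^sup>2 * alpha2 l2 \<chi> * d) \<cdot>\<^sub>v unit_vec 4 0]"

definition L4 ::
    "'k::comm_ring_1 \<Rightarrow> 'k \<Rightarrow> 'k \<Rightarrow> 'k \<times> 'k \<Rightarrow> 'k \<Rightarrow> ('k free_alg set, 'k vec) module" where
  "L4 l1 l2 l3 \<chi> d = rep_module 4 (L4_op l1 l2 l3 \<chi> d)"

text \<open>A choice of solutions of the quadratic equations, used to read \<open>L\<^sub>4\<^sup>\<chi>\<close> as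
  \<open>L\<^sub>4\<^sup>\<chi>(\<delta> \<chi>)\<close>. The same equation gets the same solution for all \<open>\<chi>\<close>. This is essential: the
  equations of \<open>\<chi>\<close> and \<open>bar_type \<chi>\<close> coincide, and if \<open>d \<noteq> d'\<close> are their solutions, then
  \<open>L\<^sub>4\<^sup>\<chi>(d)\<close> is isomorphic to \<open>L\<^sub>4(d')\<close> at \<open>bar_type \<chi>\<close>, but not to \<open>L\<^sub>4(d)\<close> at \<open>bar_type \<chi>\<close>.\<close>

definition solution_choice ::
    "nat \<Rightarrow> nat \<Rightarrow> 'k::comm_ring_1 \<Rightarrow> 'k \<Rightarrow> 'k \<Rightarrow> ('k \<times> 'k \<Rightarrow> 'k) \<Rightarrow> bool" where
  "solution_choice N M l1 l2 l3 \<delta> \<longleftrightarrow>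
     (\<forall>\<chi> \<in> O4 N M l1 l2 l3. L4_eq l1 l2 l3 \<chi> (\<delta> \<chi>)) \<and>
     (\<forall>\<chi> \<in> O4 N M l1 l2 l3. \<forall>\<chi>' \<in> O4 N M l1 l2 l3.
        alpha1 l1 \<chi> = alpha1 l1 \<chi>' \<and> alpha2 l2 \<chi> = alpha2 l2 \<chi>' \<and>
        alpha3 l1 l2 l3 \<chi> = alpha3 l1 l2 l3 \<chi>' \<longrightarrow> \<delta> \<chi> = \<delta> \<chi>')"

text \<open>The types whose quadratic equation has a double root \<open>d\<close>. For them \<open>d\<^sup>2 \<alpha>\<^sub>1\<^sup>2 = 1\<close> and the basis
  \<open>v\<^sub>2, \<alpha>\<^sub>1 v\<^sub>1, \<alpha>\<^sub>1 d v\<^sub>4, \<alpha>\<^sub>1\<^sup>2 d v\<^sub>3\<close> of \<open>L\<^sub>4\<^sup>\<chi>(d)\<close> shows that it is also \<open>L\<^sub>4(d)\<close> at \<open>bar_type \<chi>\<close>, so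
  that all four types in an orbit under sign changes give the same module. This happens only for
  special \<open>\<lambda>\<close> with \<open>\<lambda>\<^sub>1\<lambda>\<^sub>2\<lambda>\<^sub>3 \<noteq> 0\<close>: for instance \<open>N = M = 3\<close>, \<open>\<lambda>\<^sub>1 = \<lambda>\<^sub>2 = 1\<close>,
  \<open>\<lambda>\<^sub>3 = 4 (1 - \<omega>) / (1 - \<omega>\<^sup>2)\<close> and \<open>\<chi>\<^sub>1\<^sup>2 = \<chi>\<^sub>2\<^sup>2 = \<omega>\<close>, where \<open>\<omega>\<close> is a primitive cube root of 1.\<close>

definition O4_double :: "nat \<Rightarrow> nat \<Rightarrow> 'k::comm_ring_1 \<Rightarrow> 'k \<Rightarrow> 'k \<Rightarrow> ('k \<times> 'k) set" where
  "O4_double N M l1 l2 l3 =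
     {\<chi> \<in> O4 N M l1 l2 l3. (alpha1 l1 \<chi>)\<^sup>2 * alpha2 l2 \<chi> \<noteq> 0 \<and>
        (alpha3 l1 l2 l3 \<chi>)\<^sup>2 - 4 * ((alpha1 l1 \<chi>)\<^sup>2 * alpha2 l2 \<chi>) * alpha2 l2 \<chi> = 0}"

text \<open>This is \<open>type_sim\<close> if \<open>O4_double N M l1 l2 l3\<close> is empty.\<close>

definition type_sim' ::
    "nat \<Rightarrow> nat \<Rightarrow> 'k::comm_ring_1 \<Rightarrow> 'k \<Rightarrow> 'k \<Rightarrow> (('k \<times> 'k) \<times> ('k \<times> 'k)) set" where
  "type_sim' N M l1 l2 l3 =
     type_sim \<union> {(\<chi>, \<chi>'). \<chi> \<in> O4_double N M l1 l2 l3 \<and> \<chi>' \<in> {bar_type \<chi>, neg_type \<chi>}}"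

end

theory Submission
  imports Defs
begin

text \<open>A module is a representation of the free algebra in which the relators vanish. In a simple
  module \<open>g\<^sub>1\<close> and \<open>g\<^sub>2\<close> have a common eigenvector, because averaging over the powers of an element
  of finite order produces eigenvectors; let \<open>\<chi>\<close> be its type. The scalars \<open>\<alpha>\<^sub>1, \<alpha>\<^sub>2, \<alpha>\<^sub>3\<close> are constant
  on the orbit of \<open>\<chi>\<close> under sign changes, and on weight vectors \<open>u = (a\<^sub>1a\<^sub>2)\<^sup>2\<close> and \<open>w = (a\<^sub>2a\<^sub>1)\<^sup>2\<close>
  (written \<open>U2\<close> and \<open>W2\<close>) satisfy \<open>u + w = \<alpha>\<^sub>3\<close> and \<open>uw = (\<alpha>\<^sub>1\<alpha>\<^sub>2)\<^sup>2\<close>.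

  If \<open>\<chi> \<in> \<O>\<^sub>1\<close> or \<open>\<chi> \<in> \<O>\<^sub>2\<close>, then \<open>u\<close> and \<open>w\<close> are nilpotent and some weight vector of the orbit
  generates a copy of \<open>L\<^sub>1\<close>, \<open>L\<^sub>2\<^sub>,\<^sub>h\<close> or \<open>L\<^sub>2\<^sub>,\<^sub>v\<close>. If \<open>\<chi> \<in> \<O>\<^sub>4\<close>, then for every solution \<open>d\<close> of the
  quadratic equation \<open>c = \<alpha>\<^sub>3 - \<alpha>\<^sub>1\<^sup>2\<alpha>\<^sub>2d\<close> is nonzero, \<open>cd = \<alpha>\<^sub>2\<close>, and \<open>c\<close> is an eigenvalue of \<open>w\<close> on a
  weight vector of type \<open>\<chi>\<close> or \<open>-\<chi>\<close>: the other root of the characteristic polynomial of \<open>w\<close> is the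
  eigenvalue of \<open>u\<close>, and \<open>a\<^sub>2\<close> intertwines \<open>u\<close> with \<open>w\<close>. Such an eigenvector generates \<open>L\<^sub>4(d)\<close>.
  Conversely the types that occur in a module, together with the eigenvalue of \<open>w\<close>, tell the models
  apart.\<close>

section \<open>The action of the free algebra on a module\<close>

text \<open>The roots of t^2 - \<alpha>3 t + (\<alpha>1 \<alpha>2)^2 are c and \<alpha>1^2 \<alpha>2
  d. On \<open>L4\<close> the operator w is c on v1, v3 and the other root on v2, v4, so its
  eigenvalue separates \<chi> from \<open>bar_type \<chi>\<close> as long as the roots differ. If
  they coincide, all four types of an orbit give one module. This is why the proof carries
  \<open>sim'\<close> besides \<open>type_sim\<close>, and why the generic count is corrected by
  \<open>card DD div 4\<close>. The comparison also needs the same d on the whole orbit, hence the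
  condition on \<open>\<delta>\<close>. The threshold 4 l1 l2 arises because 1 + \<chi>2^2 = 2 at
  \<chi>2 = 1 and \<chi>2 = -1, so that \<alpha>3 = (l3 - 4 l1 l2) (1 - \<chi>1^2) there. For l3 = 0
  and for l3 = 4 l1 l2 the discriminant \<alpha>3^2 - 4 (\<alpha>1 \<alpha>2)^2 is 16 l1^2 l2^2
  times a square times \<chi>2^2, respectively \<chi>1^2, which excludes double roots. Simple
  modules are not assumed finite-dimensional. Homomorphisms are therefore built from the models,
  which have coordinates, into the given module, and Schur's lemma makes them bijective.\<close>

lemma free_algebra_simps [simp]:
  "carrier (free_algebra :: 'k::comm_ring_1 free_alg ring) = UNIV"
  "p \<otimes>\<^bsub>free_algebra\<^esub> q = p * q" "\<one>\<^bsub>free_algebra\<^esub> = 1"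
  "\<zero>\<^bsub>free_algebra\<^esub> = 0" "p \<oplus>\<^bsub>free_algebra\<^esub> q = p + q"
  by (simp_all add: free_algebra_def)

lemma ring_free_algebra: "ring (free_algebra :: 'k::comm_ring_1 free_alg ring)"
  by (rule ringI; (rule abelian_groupI | rule monoidI)?)
    (auto simp: algebra_simps intro: exI[of _ "- x" for x])

lemma const_0 [simp]: "const 0 = 0"
  and const_1 [simp]: "const 1 = 1"
  and const_add: "const (a + b) = const a + const b"
  and const_mult: "const (a * b) = const a * const b"
  and const_uminus: "const (- a) = - const a"
  and const_diff: "const (a - b) = const a - const b"
  by (simp_all add: const_def single_add mult_single single_uminus single_diff)

lemma poly_mapping_induct [case_names single add]:
  fixes p :: "'a \<Rightarrow>\<^sub>0 'b::comm_monoid_add"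
  assumes single: "\<And>k v. P (Poly_Mapping.single k v)"
    and add: "\<And>p q. P p \<Longrightarrow> P q \<Longrightarrow> P (p + q)"
  shows "P p"
proof -
  have "P (\<Sum>k\<in>A. Poly_Mapping.single k (Poly_Mapping.lookup p k))" if "finite A" for A
    using that
  proof (induction A)
    case empty
    \<comment> \<open>The zero function is the single with value 0 at an arbitrary key, so the rule
      needs no separate case for it.\<close>
    then show ?case using single[of undefined 0] by simp
  qed (simp add: single add)
  moreover have "p = (\<Sum>k\<in>Poly_Mapping.keys p. Poly_Mapping.single k (Poly_Mapping.lookup p k))"
    by (rule poly_mapping_eqI) (simp add: lookup_sum lookup_single when_def in_keys_iff)
  ultimately show ?thesis by (metis finite_keys)
qed

lemma const_commute: "const c * p = p * const c"
  by (induction p rule: poly_mapping_induct)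
    (simp_all add: const_def mult_single algebra_simps)

text \<open>Words are products of generators, and every element is a linear combination of words.
  This extends compatibility with an action from the four generators to the whole algebra.\<close>

lemma free_alg_induct [case_names const gen add mult]:
  assumes "\<And>c. P (const c)" "\<And>x. P (gen x)"
    and "\<And>p q. P p \<Longrightarrow> P q \<Longrightarrow> P (p + q)" "\<And>p q. P p \<Longrightarrow> P q \<Longrightarrow> P (p * q)"
  shows "P p"
proof (induction p rule: poly_mapping_induct)
  case (single k v)
  have "P (Poly_Mapping.single (Word ws) 1)" for ws
  proof (induction ws)
    case Nil
    then show ?case using assms(1)[of 1] by (simp add: const_def zero_word_def)
  next
    case (Cons x ws)
    have "Poly_Mapping.single (Word (x # ws)) (1::'a) = gen x * Poly_Mapping.single (Word ws) 1"
      by (simp add: gen_def mult_single plus_word_def)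
    with Cons show ?case by (simp add: assms)
  qed
  from this[of "letters k"] have "P (const v * Poly_Mapping.single k 1)"
    using assms by simp
  then show ?case by (simp add: const_def mult_single)
qed (use assms in auto)

section \<open>The quotient algebra and its action through representatives\<close>

locale H_alg =
  fixes N M :: nat and l1 l2 l3 :: "'k::comm_ring_1"
begin

abbreviation HH :: "'k free_alg set ring" where
  "HH \<equiv> H N M l1 l2 l3"

abbreviation "OO1 \<equiv> O1 N M l1 l2 l3"
abbreviation "OO2 \<equiv> O2 N M l1 l2 l3"
abbreviation "OO4 \<equiv> O4 N M l1 l2 l3"
abbreviation "sol_choice \<equiv> solution_choice N M l1 l2 l3"
abbreviation "DD \<equiv> O4_double N M l1 l2 l3"
abbreviation "sim' \<equiv> type_sim' N M l1 l2 l3"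

definition rel_ideal :: "'k free_alg set" where
  "rel_ideal = Idl\<^bsub>free_algebra\<^esub> (relators N M l1 l2 l3)"

definition cls :: "'k free_alg \<Rightarrow> 'k free_alg set" where
  "cls p = rel_ideal +>\<^bsub>free_algebra\<^esub> p"

lemma ideal_rel_ideal: "ideal rel_ideal free_algebra"
  unfolding rel_ideal_def by (rule ring.genideal_ideal[OF ring_free_algebra]) simp

lemma relators_in_rel_ideal: "relators N M l1 l2 l3 \<subseteq> rel_ideal"
  unfolding rel_ideal_def by (rule ring.genideal_self[OF ring_free_algebra]) simp

lemma ring_H: "ring HH"
  using ideal.quotient_is_ring[OF ideal_rel_ideal] by (simp add: H_def rel_ideal_def)

lemma cls_hom: "cls \<in> Ring.ring_hom free_algebra HH"
  using ideal.rcos_ring_hom[OF ideal_rel_ideal] unfolding H_def rel_ideal_def cls_def[abs_def] .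

lemma carrier_H: "carrier HH = range cls"
  by (auto simp: H_def FactRing_def A_RCOSETS_def' cls_def rel_ideal_def[symmetric])

lemma cls_carrier [simp]: "cls p \<in> carrier HH"
  by (simp add: carrier_H)

lemma cls_add: "cls (p + q) = cls p \<oplus>\<^bsub>HH\<^esub> cls q"
  using ring_hom_add[OF cls_hom, of p q] by simp

lemma cls_mult: "cls (p * q) = cls p \<otimes>\<^bsub>HH\<^esub> cls q"
  using ring_hom_mult[OF cls_hom, of p q] by simp

lemma cls_one: "cls 1 = \<one>\<^bsub>HH\<^esub>"
  using ring_hom_one[OF cls_hom] by simp

lemma cls_self: "p \<in> cls p"
  unfolding cls_def
  by (rule abelian_subgroup.a_rcos_self)
    (auto intro!: abelian_subgroupI3 ring.is_abelian_group[OF ring_free_algebra]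
       ideal.axioms(1)[OF ideal_rel_ideal])

lemma cls_memD: "q \<in> cls p \<Longrightarrow> q - p \<in> rel_ideal"
  by (auto simp: cls_def a_r_coset_def')

lemma cls_rel_ideal: "p \<in> rel_ideal \<Longrightarrow> cls p = \<zero>\<^bsub>HH\<^esub>"
proof -
  interpret ideal rel_ideal free_algebra by (rule ideal_rel_ideal)
  show "p \<in> rel_ideal \<Longrightarrow> cls p = \<zero>\<^bsub>HH\<^esub>"
    using a_rcos_const by (simp add: cls_def H_def FactRing_def rel_ideal_def)
qed

text \<open>Lets all computations in a module be done with elements of the free algebra instead of
  cosets; the relations enter only as elements that act as zero.\<close>

definition act :: "('k free_alg set, 'b) module \<Rightarrow> 'k free_alg \<Rightarrow> 'b \<Rightarrow> 'b" where
  "act L p x = cls p \<odot>\<^bsub>L\<^esub> x"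

end

locale H_mod = H_alg N M l1 l2 l3 + left_module "H N M l1 l2 l3" L
  for N M :: nat and l1 l2 l3 :: "'k::comm_ring_1" and L :: "('k free_alg set, 'b) module"
begin

lemma act_closed [simp]: "x \<in> carrier L \<Longrightarrow> act L p x \<in> carrier L"
  by (simp add: act_def smult_closed)

lemma act_add: "x \<in> carrier L \<Longrightarrow> act L (p + q) x = act L p x \<oplus>\<^bsub>L\<^esub> act L q x"
  by (simp add: act_def cls_add smult_l_distr)

lemma act_add_right:
  "x \<in> carrier L \<Longrightarrow> y \<in> carrier L \<Longrightarrow> act L p (x \<oplus>\<^bsub>L\<^esub> y) = act L p x \<oplus>\<^bsub>L\<^esub> act L p y"
  by (simp add: act_def smult_r_distr)

lemma act_mult: "x \<in> carrier L \<Longrightarrow> act L (p * q) x = act L p (act L q x)"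
  by (simp add: act_def cls_mult smult_assoc)

lemma act_one [simp]: "x \<in> carrier L \<Longrightarrow> act L 1 x = x"
  by (simp add: act_def cls_one smult_one)

lemma act_zero [simp]: "x \<in> carrier L \<Longrightarrow> act L 0 x = \<zero>\<^bsub>L\<^esub>"
  using act_add[of x 0 0] M.add.r_cancel_one[of "act L 0 x" "act L 0 x"] by simp

lemma act_zero_right [simp]: "act L p \<zero>\<^bsub>L\<^esub> = \<zero>\<^bsub>L\<^esub>"
  using act_mult[of "\<zero>\<^bsub>L\<^esub>" p 0] by simp

lemma act_uminus: "x \<in> carrier L \<Longrightarrow> act L (- p) x = \<ominus>\<^bsub>L\<^esub> act L p x"
  using act_add[of x "- p" p] M.minus_equality[of "act L (- p) x" "act L p x"] by simp

lemma act_eq_iff: "x \<in> carrier L \<Longrightarrow> act L p x = act L q x \<longleftrightarrow> act L (p - q) x = \<zero>\<^bsub>L\<^esub>"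
  using act_add[of x "p - q" q] M.add.r_cancel_one[of "act L q x" "act L (p - q) x"] by auto

lemma act_rel_ideal: "x \<in> carrier L \<Longrightarrow> p \<in> rel_ideal \<Longrightarrow> act L p x = \<zero>\<^bsub>L\<^esub>"
  using act_zero[of x] additive_subgroup.zero_closed[OF ideal.axioms(1)[OF ideal_rel_ideal]]
  by (simp add: act_def cls_rel_ideal)

lemma act_sum_cong:
  assumes "x \<in> carrier L" "\<And>i. i \<in> A \<Longrightarrow> act L (p i) x = act L (q i) x"
  shows "act L (\<Sum>i\<in>A. p i) x = act L (\<Sum>i\<in>A. q i) x"
  using assms(2) by (induction A rule: infinite_finite_induct) (simp_all add: assms(1) act_add)

lemma submoduleI_act:
  assumes "W \<subseteq> carrier L" "\<zero>\<^bsub>L\<^esub> \<in> W" "\<And>x y. x \<in> W \<Longrightarrow> y \<in> W \<Longrightarrow> x \<oplus>\<^bsub>L\<^esub> y \<in> W"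
    "\<And>p x. x \<in> W \<Longrightarrow> act L p x \<in> W"
  shows "submodule W HH L"
proof (intro submodule.intro group.subgroupI)
  show "group (add_monoid L)" by (rule M.a_group)
  show "inv\<^bsub>add_monoid L\<^esub> x \<in> W" if "x \<in> W" for x
    using assms(4)[OF that, of "- 1"] act_uminus[of x 1] that assms(1)
    by (auto simp: a_inv_def subset_iff)
  show "submodule_axioms W HH L"
    using assms(4) by (auto simp: submodule_axioms_def carrier_H act_def)
qed (use assms in auto)

lemma submoduleD_act:
  assumes "submodule W HH L"
  shows "W \<subseteq> carrier L" "\<zero>\<^bsub>L\<^esub> \<in> W" "\<And>x y. x \<in> W \<Longrightarrow> y \<in> W \<Longrightarrow> x \<oplus>\<^bsub>L\<^esub> y \<in> W"
    "\<And>p x. x \<in> W \<Longrightarrow> act L p x \<in> W"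
proof -
  interpret W: submodule W HH L by fact
  show "W \<subseteq> carrier L" "\<zero>\<^bsub>L\<^esub> \<in> W" "\<And>x y. x \<in> W \<Longrightarrow> y \<in> W \<Longrightarrow> x \<oplus>\<^bsub>L\<^esub> y \<in> W"
    using W.subset W.one_closed W.m_closed by auto
  show "\<And>p x. x \<in> W \<Longrightarrow> act L p x \<in> W" by (simp add: act_def)
qed

end

section \<open>Simplicity, Schur's lemma and isomorphisms in terms of the action\<close>

context H_alg
begin

lemma simple_H_mod: "simple_module HH L \<Longrightarrow> H_mod N M l1 l2 l3 L"
  by (simp add: simple_module_def H_mod_def)

lemma iso_modules_iff_act:
  "iso_modules HH L L' \<longleftrightarrow>
     (\<exists>f. bij_betw f (carrier L) (carrier L') \<and>
          (\<forall>x\<in>carrier L. \<forall>y\<in>carrier L. f (x \<oplus>\<^bsub>L\<^esub> y) = f x \<oplus>\<^bsub>L'\<^esub> f y) \<and>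
          (\<forall>p. \<forall>x\<in>carrier L. f (act L p x) = act L' p (f x)))"
  by (simp add: iso_modules_def carrier_H act_def)

text \<open>The multiples of x form a submodule that contains x, and every submodule containing x
  contains them. So simplicity means that each nonzero vector generates everything, which is the
  form used both to verify it for the models and to exploit it for L.\<close>

lemma simple_module_iff_act:
  assumes "H_mod N M l1 l2 l3 L"
  shows "simple_module HH L \<longleftrightarrow> carrier L \<noteq> {\<zero>\<^bsub>L\<^esub>} \<and>
    (\<forall>x\<in>carrier L - {\<zero>\<^bsub>L\<^esub>}. \<forall>y\<in>carrier L. \<exists>p. y = act L p x)"
proof -
  interpret H_mod N M l1 l2 l3 L by fact
  have sub: "submodule (range (\<lambda>p. act L p x)) HH L" if "x \<in> carrier L" for x
  proof (rule submoduleI_act)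
    show "\<zero>\<^bsub>L\<^esub> \<in> range (\<lambda>p. act L p x)" using act_zero[OF that] by (metis rangeI)
    show "y \<oplus>\<^bsub>L\<^esub> z \<in> range (\<lambda>p. act L p x)"
      if "y \<in> range (\<lambda>p. act L p x)" "z \<in> range (\<lambda>p. act L p x)" for y z
      using that act_add[OF \<open>x \<in> carrier L\<close>] by (auto simp: image_iff) metis
    show "act L p y \<in> range (\<lambda>p. act L p x)" if "y \<in> range (\<lambda>p. act L p x)" for y p
      using that act_mult[OF \<open>x \<in> carrier L\<close>] by (auto simp: image_iff) metis
  qed (use that in auto)
  show ?thesis (is "_ \<longleftrightarrow> ?R")
  proof
    assume s: "simple_module HH L"
    have "range (\<lambda>p. act L p x) = carrier L" if "x \<in> carrier L - {\<zero>\<^bsub>L\<^esub>}" for x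
    proof -
      have "x \<in> range (\<lambda>p. act L p x)" using that act_one[of x] by (metis Diff_iff rangeI)
      then show ?thesis using s sub[of x] that by (auto simp: simple_module_def)
    qed
    then show ?R using s by (auto simp: simple_module_def image_def set_eq_iff)
  next
    assume R: ?R
    have "W = {\<zero>\<^bsub>L\<^esub>} \<or> W = carrier L" if "submodule W HH L" for W
    proof (rule disjCI)
      note W = submoduleD_act[OF that]
      assume "W \<noteq> carrier L"
      then obtain y where y: "y \<in> carrier L" "y \<notin> W" using W(1) by blast
      have "x = \<zero>\<^bsub>L\<^esub>" if "x \<in> W" for x
      proof (rule ccontr)
        assume "x \<noteq> \<zero>\<^bsub>L\<^esub>"
        with that W(1) have "x \<in> carrier L - {\<zero>\<^bsub>L\<^esub>}" by blast
        from bspec[OF bspec[OF conjunct2[OF R] this] y(1)] obtain p where "y = act L p x" ..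
        then show False using W(4)[OF that] y(2) by simp
      qed
      then have "W \<subseteq> {\<zero>\<^bsub>L\<^esub>}" by (simp add: subset_iff)
      then show "W = {\<zero>\<^bsub>L\<^esub>}" using W(2) by (metis empty_iff subset_singletonD)
    qed
    then show "simple_module HH L"
      using conjunct1[OF R] left_module_axioms by (simp add: simple_module_def)
  qed
qed

text \<open>If a nonzero x were sent to zero, so would be its multiple x0. Surjectivity holds
  because f x0 is nonzero and hence generates L'.\<close>

lemma schur:
  assumes "simple_module HH L" "simple_module HH L'"
    and cl: "\<And>x. x \<in> carrier L \<Longrightarrow> f x \<in> carrier L'"
    and add: "\<And>x y. x \<in> carrier L \<Longrightarrow> y \<in> carrier L \<Longrightarrow> f (x \<oplus>\<^bsub>L\<^esub> y) = f x \<oplus>\<^bsub>L'\<^esub> f y"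
    and act: "\<And>p x. x \<in> carrier L \<Longrightarrow> f (act L p x) = act L' p (f x)"
    and nz: "x0 \<in> carrier L" "f x0 \<noteq> \<zero>\<^bsub>L'\<^esub>"
  shows "iso_modules HH L L'"
proof -
  interpret L: H_mod N M l1 l2 l3 L by (rule simple_H_mod) fact
  interpret L': H_mod N M l1 l2 l3 L' by (rule simple_H_mod) fact
  have nz_f: "f x \<noteq> \<zero>\<^bsub>L'\<^esub>" if x: "x \<in> carrier L - {\<zero>\<^bsub>L\<^esub>}" for x
  proof
    assume "f x = \<zero>\<^bsub>L'\<^esub>"
    moreover obtain p where "x0 = act L p x"
      using assms(1) x nz(1) by (auto simp: simple_module_iff_act[OF L.H_mod_axioms])
    ultimately show False using nz(2) act[of x p] x by simp
  qed
  have "inj_on f (carrier L)"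
  proof (rule inj_onI)
    fix x y assume xy: "x \<in> carrier L" "y \<in> carrier L" "f x = f y"
    have "f (x \<oplus>\<^bsub>L\<^esub> act L (- 1) y) = \<zero>\<^bsub>L'\<^esub>"
      using xy L'.act_uminus[of "f y" 1] L'.M.r_neg[OF cl, of y] cl by (simp add: add act)
    then have "x \<oplus>\<^bsub>L\<^esub> act L (- 1) y = \<zero>\<^bsub>L\<^esub>" using nz_f[of "x \<oplus>\<^bsub>L\<^esub> act L (- 1) y"] xy by auto
    then show "x = y" using xy L.act_uminus[of y 1] L.M.minus_equality[of x "\<ominus>\<^bsub>L\<^esub> y"] by simp
  qed
  moreover have "f ` carrier L = carrier L'"
  proof
    show "carrier L' \<subseteq> f ` carrier L"
    proof
      fix y assume "y \<in> carrier L'"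
      have "f x0 \<in> carrier L' - {\<zero>\<^bsub>L'\<^esub>}" using nz cl by simp
      note conjunct2[OF assms(2)[unfolded simple_module_iff_act[OF L'.H_mod_axioms]]]
      from bspec[OF bspec[OF this \<open>f x0 \<in> _\<close>] \<open>y \<in> _\<close>] obtain p where "y = act L' p (f x0)" ..
      then show "y \<in> f ` carrier L" using act[OF nz(1), of p] nz(1) by (metis L.act_closed imageI)
    qed
  qed (use cl in auto)
  ultimately show ?thesis
    using add act by (auto simp: iso_modules_iff_act bij_betw_def)
qed

lemma iso_modules_sym:
  assumes "H_mod N M l1 l2 l3 L" "iso_modules HH L L'"
  shows "iso_modules HH L' L"
proof -
  interpret H_mod N M l1 l2 l3 L by fact
  from assms(2) obtain f where f: "bij_betw f (carrier L) (carrier L')"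
    "\<And>x y. x \<in> carrier L \<Longrightarrow> y \<in> carrier L \<Longrightarrow> f (x \<oplus>\<^bsub>L\<^esub> y) = f x \<oplus>\<^bsub>L'\<^esub> f y"
    "\<And>p x. x \<in> carrier L \<Longrightarrow> f (act L p x) = act L' p (f x)"
    by (auto simp: iso_modules_iff_act)
  let ?g = "inv_into (carrier L) f"
  have g: "bij_betw ?g (carrier L') (carrier L)" "\<And>y. y \<in> carrier L' \<Longrightarrow> f (?g y) = y"
    "\<And>x. x \<in> carrier L \<Longrightarrow> ?g (f x) = x"
    using f(1) by (auto simp: bij_betw_inv_into bij_betw_inv_into_right bij_betw_inv_into_left)
  have gc: "?g y \<in> carrier L" if "y \<in> carrier L'" for y
    using g(1) that by (auto dest: bij_betwE)
  show ?thesis unfolding iso_modules_iff_act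
  proof (intro exI[of _ ?g] conjI ballI allI)
    fix x y assume "x \<in> carrier L'" "y \<in> carrier L'"
    then show "?g (x \<oplus>\<^bsub>L'\<^esub> y) = ?g x \<oplus>\<^bsub>L\<^esub> ?g y"
      using f(2)[of "?g x" "?g y"] g gc by (metis M.a_closed)
  next
    fix p x assume "x \<in> carrier L'"
    then show "?g (act L' p x) = act L p (?g x)"
      using f(3)[of "?g x" p] g gc by (metis act_closed)
  qed (rule g)
qed

lemma iso_modules_refl: "iso_modules HH L L"
  unfolding iso_modules_def by (intro exI[of _ id]) auto

end

section \<open>Modules given by matrices\<close>

locale rep =
  fixes n :: nat and \<rho> :: "gen \<Rightarrow> 'k::comm_ring_1 mat"
  assumes \<rho>_carrier [simp]: "\<rho> x \<in> carrier_mat n n"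
begin

lemma word_mat_carrier [simp]: "word_mat n \<rho> w \<in> carrier_mat n n"
proof -
  have "foldr (\<lambda>x A. \<rho> x * A) ws (1\<^sub>m n) \<in> carrier_mat n n" for ws
  proof (induction ws)
    case (Cons x ws)
    then show ?case using mult_carrier_mat[OF \<rho>_carrier] by simp
  qed simp
  then show ?thesis by (simp add: word_mat_def)
qed

lemma word_mat_plus: "word_mat n \<rho> (u + w) = word_mat n \<rho> u * word_mat n \<rho> w"
proof -
  have "word_mat n \<rho> (Word us + w) = word_mat n \<rho> (Word us) * word_mat n \<rho> w" for us
  proof (induction us)
    case Nil
    then show ?case
      using left_mult_one_mat[OF word_mat_carrier[of w]]
      by (simp add: word_mat_def[of _ _ "Word []"] plus_word_def)
  next
    case (Cons x us)
    have "word_mat n \<rho> (Word (x # us)) = \<rho> x * word_mat n \<rho> (Word us)" for us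
      by (simp add: word_mat_def)
    then show ?case
      using Cons by (simp add: plus_word_def assoc_mult_mat[OF \<rho>_carrier word_mat_carrier word_mat_carrier])
  qed
  from this[of "letters u"] show ?thesis by simp
qed

lemma alg_mat_carrier [simp]: "alg_mat n \<rho> p \<in> carrier_mat n n"
  by (simp add: alg_mat_def)

text \<open>Elements with different supports can be compared only over a common index set; words
  outside the support contribute zero.\<close>

lemma alg_mat_superset:
  assumes "finite A" "Poly_Mapping.keys p \<subseteq> A"
  shows "alg_mat n \<rho> p = mat n n (\<lambda>ij. \<Sum>w\<in>A. Poly_Mapping.lookup p w * word_mat n \<rho> w $$ ij)"
  unfolding alg_mat_def
  by (intro cong_mat refl sum.mono_neutral_left assms) (auto simp: in_keys_iff)

lemma alg_mat_add: "alg_mat n \<rho> (p + q) = alg_mat n \<rho> p + alg_mat n \<rho> q"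
proof -
  let ?A = "Poly_Mapping.keys p \<union> Poly_Mapping.keys q"
  have "Poly_Mapping.keys (p + q) \<subseteq> ?A" by (rule keys_add)
  then show ?thesis
    using alg_mat_superset[of ?A p] alg_mat_superset[of ?A q] alg_mat_superset[of ?A "p + q"]
    by (auto simp: lookup_add sum.distrib algebra_simps intro!: eq_matI)
qed

lemma alg_mat_single: "alg_mat n \<rho> (Poly_Mapping.single w c) = c \<cdot>\<^sub>m word_mat n \<rho> w"
  using carrier_matD[OF word_mat_carrier[of w]]
  by (subst alg_mat_superset[of "{w}"]) (auto intro!: eq_matI)

lemma alg_mat_mult: "alg_mat n \<rho> (p * q) = alg_mat n \<rho> p * alg_mat n \<rho> q"
proof (induction p rule: poly_mapping_induct)
  case (single u a)
  then show ?case
  proof (induction q rule: poly_mapping_induct)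
    case (single w b)
    have "c \<cdot>\<^sub>m (d \<cdot>\<^sub>m A) = (c * d) \<cdot>\<^sub>m A" for c d and A :: "'k mat"
      by (auto simp: mult.assoc intro!: eq_matI)
    then show ?case
      by (simp add: mult_single alg_mat_single word_mat_plus
        mult_smult_assoc_mat[OF word_mat_carrier smult_carrier_mat[OF word_mat_carrier]]
        mult_smult_distrib[OF word_mat_carrier word_mat_carrier])
  next
    case (add p q)
    then show ?case
      by (simp add: distrib_left alg_mat_add mult_add_distrib_mat[OF alg_mat_carrier alg_mat_carrier alg_mat_carrier])
  qed
next
  case (add p' q')
  then show ?case
    by (simp add: distrib_right alg_mat_add add_mult_distrib_mat[OF alg_mat_carrier alg_mat_carrier alg_mat_carrier])
qed

text \<open>The action of the free algebra itself, available for arbitrary matrices; it agrees with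
  the action of the quotient once the matrices satisfy the relations.\<close>

definition Act :: "'k free_alg \<Rightarrow> 'k vec \<Rightarrow> 'k vec" where
  "Act p v = alg_mat n \<rho> p *\<^sub>v v"

lemma Act_carrier [simp]: "v \<in> carrier_vec n \<Longrightarrow> Act p v \<in> carrier_vec n"
  unfolding Act_def by (rule mult_mat_vec_carrier[OF alg_mat_carrier])

lemma Act_const: "v \<in> carrier_vec n \<Longrightarrow> Act (const c) v = c \<cdot>\<^sub>v v"
  by (auto simp: Act_def const_def alg_mat_single word_mat_def zero_word_def scalar_prod_def
      sum.remove[of "{0..<n}"] intro!: eq_vecI)

lemma Act_gen: "v \<in> carrier_vec n \<Longrightarrow> Act (gen x) v = \<rho> x *\<^sub>v v"
  using right_mult_one_mat[OF \<rho>_carrier[of x]] carrier_matD[OF \<rho>_carrier[of x]]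
  by (auto simp: Act_def gen_def alg_mat_single word_mat_def intro!: eq_vecI)

lemma Act_add: "v \<in> carrier_vec n \<Longrightarrow> Act (p + q) v = Act p v + Act q v"
  by (simp add: Act_def alg_mat_add add_mult_distrib_mat_vec[OF alg_mat_carrier alg_mat_carrier])

lemma Act_mult: "v \<in> carrier_vec n \<Longrightarrow> Act (p * q) v = Act p (Act q v)"
  by (simp add: Act_def alg_mat_mult assoc_mult_mat_vec[OF alg_mat_carrier alg_mat_carrier])

lemma Act_add_right:
  "v \<in> carrier_vec n \<Longrightarrow> w \<in> carrier_vec n \<Longrightarrow> Act p (v + w) = Act p v + Act p w"
  by (simp add: Act_def mult_add_distrib_mat_vec[OF alg_mat_carrier])

lemma Act_0: "v \<in> carrier_vec n \<Longrightarrow> Act 0 v = 0\<^sub>v n"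
  using Act_const[of v 0] by auto

lemma Act_1: "v \<in> carrier_vec n \<Longrightarrow> Act 1 v = v"
  using Act_const[of v 1] by simp

lemma Act_uminus: "v \<in> carrier_vec n \<Longrightarrow> Act (- p) v = - Act p v"
  using Act_mult[of v "const (-1)" p] Act_const[of "Act p v" "-1"]
  by (auto simp: const_uminus intro!: eq_vecI)

lemma Act_diff: "v \<in> carrier_vec n \<Longrightarrow> Act (p - q) v = Act p v - Act q v"
  using Act_add[of v p "- q"] by (simp add: Act_uminus minus_add_uminus_vec[OF Act_carrier Act_carrier])

lemma Act_0_right: "Act p (0\<^sub>v n) = 0\<^sub>v n"
  using carrier_matD[OF alg_mat_carrier[of p]] by (auto simp: Act_def intro!: eq_vecI)

end

text \<open>The relations are demanded on vectors and not as matrix identities, because the models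
  are checked on explicit coordinate vectors.\<close>

locale rep_H = H_alg N M l1 l2 l3 + rep n \<rho>
  for N M :: nat and l1 l2 l3 :: "'k::comm_ring_1" and n and \<rho> :: "gen \<Rightarrow> 'k mat" +
  assumes relations:
    "r \<in> relators N M l1 l2 l3 \<Longrightarrow> v \<in> carrier_vec n \<Longrightarrow> alg_mat n \<rho> r *\<^sub>v v = 0\<^sub>v n"
begin

text \<open>The elements that annihilate every vector form a two-sided ideal; as it contains the
  relators, it contains the ideal they generate.\<close>

lemma Act_rel_ideal:
  assumes "p \<in> rel_ideal" "v \<in> carrier_vec n"
  shows "Act p v = 0\<^sub>v n"
proof -
  let ?K = "{p. \<forall>v\<in>carrier_vec n. Act p v = 0\<^sub>v n}"
  have "ideal ?K free_algebra"
  proof (rule idealI[OF ring_free_algebra])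
    show "subgroup ?K (add_monoid free_algebra)"
    proof (rule group.subgroupI)
      show "group (add_monoid (free_algebra :: 'k free_alg ring))"
        using ring.is_abelian_group[OF ring_free_algebra] by (rule abelian_group.a_group)
      show "inv\<^bsub>add_monoid free_algebra\<^esub> p \<in> ?K" if "p \<in> ?K" for p
      proof -
        have "inv\<^bsub>add_monoid free_algebra\<^esub> p = - p"
          using abelian_group.minus_equality[OF ring.is_abelian_group[OF ring_free_algebra], of "- p" p]
          by (simp add: a_inv_def)
        then show ?thesis using that by (auto simp: Act_uminus)
      qed
    qed (auto simp: Act_add Act_0 intro: exI[of _ 0])
  qed (auto simp: Act_mult Act_0_right)
  moreover have "relators N M l1 l2 l3 \<subseteq> ?K" using relations by (auto simp: Act_def)
  ultimately have "rel_ideal \<subseteq> ?K"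
    unfolding rel_ideal_def by (rule ring.genideal_minimal[OF ring_free_algebra])
  with assms show ?thesis by auto
qed

lemma rep_module_simps [simp]:
  "carrier (rep_module n \<rho>) = carrier_vec n"
  "\<zero>\<^bsub>rep_module n \<rho>\<^esub> = 0\<^sub>v n"
  "v \<oplus>\<^bsub>rep_module n \<rho>\<^esub> w = v + w"
  by (simp_all add: rep_module_def)

text \<open>\<open>rep_module\<close> acts through an arbitrarily chosen representative of the
  coset. That representative differs from p by an element of the ideal, which acts as zero.\<close>

lemma act_rep_module:
  assumes "v \<in> carrier_vec n"
  shows "act (rep_module n \<rho>) p v = Act p v"
proof -
  define q where "q = (SOME q. q \<in> cls p)"
  have "q \<in> cls p" unfolding q_def using cls_self by (rule someI)
  then have "Act (q - p) v = 0\<^sub>v n" using cls_memD assms by (intro Act_rel_ideal)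
  then have "Act q v = Act p v"
    using Act_add[OF assms, of "q - p" p] assms by simp
  then show ?thesis
    by (simp add: act_def rep_module_def q_def Act_def)
qed

lemma H_mod_rep_module: "H_mod N M l1 l2 l3 (rep_module n \<rho>)"
proof (intro H_mod.intro left_module.intro left_module_axioms.intro ring_H)
  show "abelian_group (rep_module n \<rho>)"
  proof (rule abelian_groupI)
    show "\<exists>w\<in>carrier (rep_module n \<rho>). w \<oplus>\<^bsub>rep_module n \<rho>\<^esub> v = \<zero>\<^bsub>rep_module n \<rho>\<^esub>"
      if "v \<in> carrier (rep_module n \<rho>)" for v
      using that by (intro bexI[of _ "- v"]) auto
  qed (auto simp: comm_add_vec)
next
  fix a b v w assume "a \<in> carrier HH" "b \<in> carrier HH" "v \<in> carrier (rep_module n \<rho>)"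
    "w \<in> carrier (rep_module n \<rho>)"
  then obtain p q where [simp]: "a = cls p" "b = cls q" "v \<in> carrier_vec n" "w \<in> carrier_vec n"
    by (auto simp: carrier_H)
  note [simp] = act_rep_module[unfolded act_def]
  show "a \<odot>\<^bsub>rep_module n \<rho>\<^esub> v \<in> carrier (rep_module n \<rho>)"
    by simp
  show "(a \<oplus>\<^bsub>HH\<^esub> b) \<odot>\<^bsub>rep_module n \<rho>\<^esub> v =
      a \<odot>\<^bsub>rep_module n \<rho>\<^esub> v \<oplus>\<^bsub>rep_module n \<rho>\<^esub> b \<odot>\<^bsub>rep_module n \<rho>\<^esub> v"
    by (simp add: cls_add[symmetric] Act_add)
  show "a \<odot>\<^bsub>rep_module n \<rho>\<^esub> (v \<oplus>\<^bsub>rep_module n \<rho>\<^esub> w) =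
      a \<odot>\<^bsub>rep_module n \<rho>\<^esub> v \<oplus>\<^bsub>rep_module n \<rho>\<^esub> a \<odot>\<^bsub>rep_module n \<rho>\<^esub> w"
    by (simp add: Act_add_right)
  show "(a \<otimes>\<^bsub>HH\<^esub> b) \<odot>\<^bsub>rep_module n \<rho>\<^esub> v =
      a \<odot>\<^bsub>rep_module n \<rho>\<^esub> (b \<odot>\<^bsub>rep_module n \<rho>\<^esub> v)"
    by (simp add: cls_mult[symmetric] Act_mult)
next
  fix v assume "v \<in> carrier (rep_module n \<rho>)"
  then show "\<one>\<^bsub>HH\<^esub> \<odot>\<^bsub>rep_module n \<rho>\<^esub> v = v"
    using act_rep_module[unfolded act_def, of v 1] by (simp add: cls_one[symmetric] Act_1)
qed

lemma simple_rep_moduleI: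
  assumes "0 < n"
    and reach: "\<And>v j. v \<in> carrier_vec n \<Longrightarrow> v \<noteq> 0\<^sub>v n \<Longrightarrow> j < n \<Longrightarrow> \<exists>p. Act p v = unit_vec n j"
  shows "simple_module HH (rep_module n \<rho>)"
proof (subst simple_module_iff_act[OF H_mod_rep_module], intro conjI ballI)
  show "carrier (rep_module n \<rho>) \<noteq> {\<zero>\<^bsub>rep_module n \<rho>\<^esub>}"
    using unit_vec_carrier[of n 0] index_unit_vec(1)[of 0 n 0] \<open>0 < n\<close>
    by (metis index_zero_vec(1) rep_module_simps(1,2) singletonD zero_neq_one)
next
  fix v w assume "v \<in> carrier (rep_module n \<rho>) - {\<zero>\<^bsub>rep_module n \<rho>\<^esub>}" "w \<in> carrier (rep_module n \<rho>)"
  then have v: "v \<in> carrier_vec n" "v \<noteq> 0\<^sub>v n" and w: "w \<in> carrier_vec n" by simp_all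
  from reach[OF v] obtain e where e: "\<And>j. j < n \<Longrightarrow> Act (e j) v = unit_vec n j" by metis
  \<comment> \<open>The partial sums produce the truncations of w to its first m coordinates; for m
    = n this is w.\<close>
  have "Act (\<Sum>j<m. const (w $ j) * e j) v = vec n (\<lambda>i. if i < m then w $ i else 0)" if "m \<le> n" for m
    using that
  proof (induction m)
    case 0
    then show ?case using v by (auto simp: Act_0)
  next
    case (Suc m)
    then show ?case
      using v(1) e[of m] w
      by (auto simp: Act_add Act_mult Act_const less_Suc_eq intro!: eq_vecI)
  qed
  from this[of n] have "Act (\<Sum>j<n. const (w $ j) * e j) v = w" using w by (auto intro!: eq_vecI)
  then show "\<exists>p. w = act (rep_module n \<rho>) p v" using v(1) by (metis act_rep_module)
qed

end

context H_mod
begin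

text \<open>The map from \<open>rep_module n \<rho>\<close> sends the \<open>i\<close>th unit vector to \<open>q i\<close> applied to \<open>x\<close>.\<close>

lemma iso_rep_moduleI:
  fixes q :: "nat \<Rightarrow> 'k free_alg"
  assumes "rep_H N M l1 l2 l3 n \<rho>" "simple_module HH L" "simple_module HH (rep_module n \<rho>)"
    and x: "x \<in> carrier L" and i0: "i0 < n" "act L (q i0) x \<noteq> \<zero>\<^bsub>L\<^esub>"
    and gen: "\<And>g j. j < n \<Longrightarrow> act L (gen g * q j) x = act L (\<Sum>i<n. const (\<rho> g $$ (i, j)) * q i) x"
  shows "iso_modules HH L (rep_module n \<rho>)"
proof -
  interpret R: rep_H N M l1 l2 l3 n \<rho> by fact
  interpret RM: H_mod N M l1 l2 l3 "rep_module n \<rho>" by (rule R.H_mod_rep_module)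
  define f where "f v = act L (\<Sum>i<n. const (v $ i) * q i) x" for v
  have f_add: "f (v + w) = f v \<oplus>\<^bsub>L\<^esub> f w" if "v \<in> carrier_vec n" "w \<in> carrier_vec n" for v w
    using that x unfolding f_def
    by (simp add: act_add[symmetric] sum.distrib[symmetric] const_add distrib_right)
  \<comment> \<open>Only the generators carry content: there the hypothesis on the columns of
    \<open>\<rho> g\<close> is used after exchanging the two sums.\<close>
  have f_act: "f (R.Act p v) = act L p (f v)" if "v \<in> carrier_vec n" for p v
    using that
  proof (induction p arbitrary: v rule: free_alg_induct)
    case (const c)
    then show ?case using x
      by (simp add: f_def R.Act_const act_mult[symmetric] sum_distrib_left const_mult mult.assoc)
  next
    case (gen g)
    note * = carrier_matD[OF R.\<rho>_carrier[of g]]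
    have "const ((\<rho> g *\<^sub>v v) $ i) = (\<Sum>j<n. const (\<rho> g $$ (i, j)) * const (v $ j))" if "i < n" for i
    proof -
      have "const (sum h A) = (\<Sum>a\<in>A. const (h a))" for h :: "nat \<Rightarrow> 'k" and A
        by (induction A rule: infinite_finite_induct) (simp_all add: const_add)
      then show ?thesis
        using that gen by (simp add: scalar_prod_def * lessThan_atLeast0 const_mult)
    qed
    then have "f (R.Act (gen g) v) =
        act L (\<Sum>i<n. \<Sum>j<n. const (\<rho> g $$ (i, j)) * const (v $ j) * q i) x"
      unfolding f_def using gen by (simp add: R.Act_gen sum_distrib_right)
    also have "\<dots> = act L (\<Sum>j<n. const (v $ j) * (\<Sum>i<n. const (\<rho> g $$ (i, j)) * q i)) x"
      by (subst sum.swap) (simp add: sum_distrib_left mult.assoc[symmetric] const_mult[symmetric] mult.commute[of _ "v $ _"])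
    also have "\<dots> = act L (\<Sum>j<n. const (v $ j) * (gen g * q j)) x"
      using x by (intro act_sum_cong) (simp_all add: act_mult assms(7)[symmetric])
    also have "\<dots> = act L (gen g * (\<Sum>j<n. const (v $ j) * q j)) x"
      by (simp add: sum_distrib_left mult.assoc[symmetric] const_commute[of _ "gen g"])
    finally show ?case using x by (simp add: f_def act_mult)
  next
    case (add p q)
    then show ?case using x by (simp add: R.Act_add f_add act_add) (simp add: f_def act_add)
  next
    case (mult p q)
    then show ?case using x by (simp add: R.Act_mult act_mult f_def)
  qed
  have "f (unit_vec n i0) = act L (\<Sum>i<n. if i = i0 then q i0 else 0) x"
    unfolding f_def using i0 by (intro arg_cong2[where f = "act L"] sum.cong) auto
  then have "f (unit_vec n i0) \<noteq> \<zero>\<^bsub>L\<^esub>" using i0 by simp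
  \<comment> \<open>The map starts at the model, where coordinates define it; being nonzero between
    simple modules it is bijective, and it is inverted at the end.\<close>
  then have "iso_modules HH (rep_module n \<rho>) L"
    using x f_add f_act R.act_rep_module
    by (intro schur[OF assms(3,2), where f = f and ?x0.0 = "unit_vec n i0"]) (auto simp: f_def)
  then show ?thesis by (rule iso_modules_sym[OF R.H_mod_rep_module])
qed

end

section \<open>The models\<close>

declare vec_of_list_Cons [simp del] vec_of_list_Nil [simp del]

text \<open>Vectors of dimension 1, 2 and 4 are kept as \<open>vec_of_list\<close> of explicit
  lists, so that equations between them split into coordinates. The two rules deleted above would
  take them out of this form.\<close>

lemma vec_of_list_eq_iff [simp]: "vec_of_list xs = vec_of_list ys \<longleftrightarrow> xs = ys"
  by (metis list_vec)

lemma vec_of_list_add [simp]: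
  "length xs = length ys \<Longrightarrow> vec_of_list xs + vec_of_list ys = vec_of_list (map2 (+) xs ys)"
  and vec_of_list_diff [simp]:
  "length xs = length ys \<Longrightarrow> vec_of_list xs - vec_of_list ys = vec_of_list (map2 (-) xs ys)"
  by (auto intro!: eq_vecI simp: vec_of_list_index)

lemma vec_of_list_uminus [simp]: "- vec_of_list xs = vec_of_list (map uminus xs)"
  and vec_of_list_smult [simp]: "c \<cdot>\<^sub>v vec_of_list xs = vec_of_list (map ((*) c) xs)"
  by (auto intro!: eq_vecI simp: vec_of_list_index)

lemma vec_of_list_numerals:
  "0\<^sub>v 1 = vec_of_list [0]" "0\<^sub>v 2 = vec_of_list [0, 0]" "0\<^sub>v 4 = vec_of_list [0, 0, 0, 0]"
  "unit_vec 1 0 = vec_of_list [1]"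
  "unit_vec 2 0 = vec_of_list [1, 0]" "unit_vec 2 1 = vec_of_list [0, 1]"
  "unit_vec 4 0 = vec_of_list [1, 0, 0, 0]" "unit_vec 4 1 = vec_of_list [0, 1, 0, 0]"
  "unit_vec 4 2 = vec_of_list [0, 0, 1, 0]" "unit_vec 4 3 = vec_of_list [0, 0, 0, 1]"
  by (auto intro!: eq_vecI simp: vec_of_list_index less_Suc_eq numeral_eq_Suc)

lemma carrier_vec_of_list [simp]:
  "vec_of_list [a] \<in> carrier_vec 1" "vec_of_list [a] \<in> carrier_vec (Suc 0)"
  "vec_of_list [a, b] \<in> carrier_vec 2"
  "vec_of_list [a, b, c, d] \<in> carrier_vec 4"
  by (auto intro!: carrier_vecI)

lemma carrier_vec_1E: "v \<in> carrier_vec 1 \<Longrightarrow> (\<And>a. v = vec_of_list [a] \<Longrightarrow> P) \<Longrightarrow> P"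
  and carrier_vec_2E: "v \<in> carrier_vec 2 \<Longrightarrow> (\<And>a b. v = vec_of_list [a, b] \<Longrightarrow> P) \<Longrightarrow> P"
  and carrier_vec_4E: "v \<in> carrier_vec 4 \<Longrightarrow> (\<And>a b c d. v = vec_of_list [a, b, c, d] \<Longrightarrow> P) \<Longrightarrow> P"
proof -
  assume "v \<in> carrier_vec 1" "\<And>a. v = vec_of_list [a] \<Longrightarrow> P"
  moreover have "v = vec_of_list [v $ 0]"
    using calculation(1) by (auto intro!: eq_vecI simp: vec_of_list_index)
  ultimately show P by blast
next
  assume "v \<in> carrier_vec 2" "\<And>a b. v = vec_of_list [a, b] \<Longrightarrow> P"
  moreover have "v = vec_of_list [v $ 0, v $ 1]"
    using calculation(1) by (auto intro!: eq_vecI simp: vec_of_list_index less_Suc_eq numeral_eq_Suc)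
  ultimately show P by blast
next
  assume "v \<in> carrier_vec 4" "\<And>a b c d. v = vec_of_list [a, b, c, d] \<Longrightarrow> P"
  moreover have "v = vec_of_list [v $ 0, v $ 1, v $ 2, v $ 3]"
    using calculation(1) by (auto intro!: eq_vecI simp: vec_of_list_index less_Suc_eq numeral_eq_Suc)
  ultimately show P by blast
qed

text \<open>The product is the linear combination of the columns. This turns the description of the
  models by images of basis vectors into formulas in coordinates.\<close>

lemma mat_of_cols_mult_vec_of_list:
  fixes xs :: "'a::comm_ring_1 list"
  shows "length cs = length xs \<Longrightarrow> \<forall>c\<in>set cs. c \<in> carrier_vec n \<Longrightarrow>
     mat_of_cols n cs *\<^sub>v vec_of_list xs = foldr (\<lambda>(c, x) v. x \<cdot>\<^sub>v c + v) (zip cs xs) (0\<^sub>v n)"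
proof (induction cs xs rule: list_induct2)
  case (Cons c cs x xs)
  have "c \<in> carrier_vec n" "foldr (\<lambda>(c, x) v. x \<cdot>\<^sub>v c + v) (zip cs xs) (0\<^sub>v n) \<in> carrier_vec n"
  proof -
    have "foldr (\<lambda>(c, x) v. x \<cdot>\<^sub>v c + v) ps (0\<^sub>v n) \<in> carrier_vec n"
      if "\<forall>p\<in>set ps. fst p \<in> carrier_vec n" for ps
      using that by (induction ps) auto
    moreover have "\<forall>p\<in>set (zip cs xs). fst p \<in> carrier_vec n"
      using Cons.prems by (auto dest: set_zip_leftD)
    ultimately show "foldr (\<lambda>(c, x) v. x \<cdot>\<^sub>v c + v) (zip cs xs) (0\<^sub>v n) \<in> carrier_vec n"
      by blast
  qed (use Cons in auto)
  moreover have "mat_of_cols n (c # cs) *\<^sub>v vec_of_list (x # xs) =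
      x \<cdot>\<^sub>v c + mat_of_cols n cs *\<^sub>v vec_of_list xs"
    using Cons(1) calculation(1)
    by (auto intro!: eq_vecI simp: scalar_prod_def mat_of_cols_def vec_of_list_index
       sum.atLeast0_lessThan_Suc_shift mult.commute[of x] simp del: sum.op_ivl_Suc)
  ultimately show ?case using Cons by simp
qed (auto intro!: eq_vecI simp: scalar_prod_def)

lemma L1_op_simps:
  "L1_op \<chi> G1 *\<^sub>v vec_of_list [a] = vec_of_list [fst \<chi> * a]"
  "L1_op \<chi> G2 *\<^sub>v vec_of_list [a] = vec_of_list [snd \<chi> * a]"
  "L1_op \<chi> A1 *\<^sub>v vec_of_list [a] = vec_of_list [0]"
  "L1_op \<chi> A2 *\<^sub>v vec_of_list [a] = vec_of_list [0]"
  by (simp_all add: mat_of_cols_mult_vec_of_list vec_of_list_numerals[unfolded One_nat_def] mult.commute)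

lemma L2h_op_simps:
  "L2h_op l1 \<chi> G1 *\<^sub>v vec_of_list [a, b] = vec_of_list [fst \<chi> * a, - fst \<chi> * b]"
  "L2h_op l1 \<chi> G2 *\<^sub>v vec_of_list [a, b] = vec_of_list [snd \<chi> * a, snd \<chi> * b]"
  "L2h_op l1 \<chi> A1 *\<^sub>v vec_of_list [a, b] = vec_of_list [alpha1 l1 \<chi> * b, a]"
  "L2h_op l1 \<chi> A2 *\<^sub>v vec_of_list [a, b] = vec_of_list [0, 0]"
  by (simp_all add: mat_of_cols_mult_vec_of_list vec_of_list_numerals[unfolded One_nat_def] bar_type_def mult.commute)

lemma L2v_op_simps:
  "L2v_op l2 \<chi> G1 *\<^sub>v vec_of_list [a, b] = vec_of_list [fst \<chi> * a, - fst \<chi> * b]"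
  "L2v_op l2 \<chi> G2 *\<^sub>v vec_of_list [a, b] = vec_of_list [snd \<chi> * a, - snd \<chi> * b]"
  "L2v_op l2 \<chi> A1 *\<^sub>v vec_of_list [a, b] = vec_of_list [0, 0]"
  "L2v_op l2 \<chi> A2 *\<^sub>v vec_of_list [a, b] = vec_of_list [alpha2 l2 \<chi> * b, a]"
  by (simp_all add: mat_of_cols_mult_vec_of_list vec_of_list_numerals[unfolded One_nat_def] neg_type_def mult.commute)

lemma L4_op_simps:
  "L4_op l1 l2 l3 \<chi> d G1 *\<^sub>v vec_of_list [x, y, z, t] =
     vec_of_list [fst \<chi> * x, - fst \<chi> * y, fst \<chi> * z, - fst \<chi> * t]"
  "L4_op l1 l2 l3 \<chi> d G2 *\<^sub>v vec_of_list [x, y, z, t] =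
     vec_of_list [snd \<chi> * x, snd \<chi> * y, - snd \<chi> * z, - snd \<chi> * t]"
  "L4_op l1 l2 l3 \<chi> d A1 *\<^sub>v vec_of_list [x, y, z, t] =
     vec_of_list [alpha1 l1 \<chi> * y, x, alpha1 l1 \<chi> * t, z]"
  "L4_op l1 l2 l3 \<chi> d A2 *\<^sub>v vec_of_list [x, y, z, t] =
     vec_of_list [(alpha3 l1 l2 l3 \<chi> - (alpha1 l1 \<chi>)\<^sup>2 * alpha2 l2 \<chi> * d) * t, alpha2 l2 \<chi> * z, y, d * x]"
  by (simp_all add: mat_of_cols_mult_vec_of_list vec_of_list_numerals[unfolded One_nat_def] neg_type_def bar_type_def mult.commute)

lemma rep_L1: "rep 1 (L1_op \<chi>)"
  and rep_L2h: "rep 2 (L2h_op l1 \<chi>)"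
  and rep_L2v: "rep 2 (L2v_op l2 \<chi>)"
  and rep_L4: "rep 4 (L4_op l1 l2 l3 \<chi> d)"
proof -
  show "rep 1 (L1_op \<chi>)"
  proof
    show "L1_op \<chi> x \<in> carrier_mat 1 1" for x by (cases x) (auto intro!: carrier_matI)
  qed
  show "rep 2 (L2h_op l1 \<chi>)"
  proof
    show "L2h_op l1 \<chi> x \<in> carrier_mat 2 2" for x by (cases x) (auto intro!: carrier_matI)
  qed
  show "rep 2 (L2v_op l2 \<chi>)"
  proof
    show "L2v_op l2 \<chi> x \<in> carrier_mat 2 2" for x by (cases x) (auto intro!: carrier_matI)
  qed
  show "rep 4 (L4_op l1 l2 l3 \<chi> d)"
  proof
    show "L4_op l1 l2 l3 \<chi> d x \<in> carrier_mat 4 4" for x by (cases x) (auto intro!: carrier_matI)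
  qed
qed

declare L1_op.simps [simp del] L2h_op.simps [simp del] L2v_op.simps [simp del] L4_op.simps [simp del]

text \<open>In each model suitable elements of the algebra permute the basis vectors cyclically, so
  it is enough to extract some basis vector from a given nonzero vector.\<close>

lemma (in rep_H) simple_cyclicI:
  assumes "0 < n"
    and start: "\<And>v. v \<in> carrier_vec n \<Longrightarrow> v \<noteq> 0\<^sub>v n \<Longrightarrow> \<exists>i<n. \<exists>p. Act p v = unit_vec n i"
    and step: "\<And>i. i < n \<Longrightarrow> \<exists>p. Act p (unit_vec n i) = unit_vec n (Suc i mod n)"
  shows "simple_module HH (rep_module n \<rho>)"
proof (rule simple_rep_moduleI[OF assms(1)])
  fix v :: "'k vec" and j assume v: "v \<in> carrier_vec n" "v \<noteq> 0\<^sub>v n" and "j < n"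
  obtain i p where i: "i < n" "Act p v = unit_vec n i" using start[OF v] by blast
  have reach: "\<exists>p. Act p v = unit_vec n ((i + k) mod n)" for k
  proof (induction k)
    case 0
    then show ?case using i by auto
  next
    case (Suc k)
    then obtain p q where "Act p v = unit_vec n ((i + k) mod n)"
      "Act q (unit_vec n ((i + k) mod n)) = unit_vec n (Suc ((i + k) mod n) mod n)"
      using step[of "(i + k) mod n"] \<open>0 < n\<close> by auto
    then have "Act (q * p) v = unit_vec n ((i + Suc k) mod n)"
      using v by (simp add: Act_mult mod_Suc_eq)
    then show ?case by blast
  qed
  \<comment> \<open>Going j - i steps around the cycle leads from i to j; the summand n keeps the
    number of steps natural and vanishes modulo n.\<close>
  from reach[of "j + n - i"] show "\<exists>p. Act p v = unit_vec n j"
    using \<open>i < n\<close> \<open>j < n\<close> by simp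
qed

section \<open>The models satisfy the relations and are simple\<close>

locale H_field = H_alg N M l1 l2 l3
  for N M :: nat and l1 l2 l3 :: "'k::field_char_0" +
  assumes N_pos: "N \<ge> 1" and M_pos: "M \<ge> 1"
begin

definition W2 :: "'k free_alg" where
  "W2 = gen A2 * gen A1 * gen A2 * gen A1"

definition U2 :: "'k free_alg" where
  "U2 = gen A1 * gen A2 * gen A1 * gen A2"

text \<open>Nonzero vectors only: the set of types for which such a vector exists is an isomorphism
  invariant.\<close>

definition typed :: "('k free_alg set, 'b) module \<Rightarrow> 'k \<times> 'k \<Rightarrow> 'b \<Rightarrow> bool" where
  "typed L \<chi> x \<longleftrightarrow> x \<in> carrier L \<and> x \<noteq> \<zero>\<^bsub>L\<^esub> \<and>
     act L (gen G1) x = act L (const (fst \<chi>)) x \<and> act L (gen G2) x = act L (const (snd \<chi>)) x"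

definition eigen :: "('k free_alg set, 'b) module \<Rightarrow> 'k free_alg \<Rightarrow> 'k \<Rightarrow> 'b \<Rightarrow> bool" where
  "eigen L p e x \<longleftrightarrow> act L p x = act L (const e) x"

text \<open>An isomorphism transports weight vectors with their type and their eigenvalues. All
  proofs that two models are not isomorphic rest on this.\<close>

lemma iso_modules_typed:
  assumes "H_mod N M l1 l2 l3 L" "H_mod N M l1 l2 l3 L'" "iso_modules HH L L'" "typed L \<chi> x"
  obtains y where "typed L' \<chi> y" "\<And>p e. eigen L p e x \<Longrightarrow> eigen L' p e y"
proof -
  interpret L: H_mod N M l1 l2 l3 L by fact
  interpret L': H_mod N M l1 l2 l3 L' by fact
  obtain f where f: "bij_betw f (carrier L) (carrier L')"
    "\<And>p x. x \<in> carrier L \<Longrightarrow> f (act L p x) = act L' p (f x)"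
    using assms(3) by (auto simp: iso_modules_iff_act)
  have x: "x \<in> carrier L" "x \<noteq> \<zero>\<^bsub>L\<^esub>" using assms(4) by (auto simp: typed_def)
  have f0: "f \<zero>\<^bsub>L\<^esub> = \<zero>\<^bsub>L'\<^esub>"
    using f(2)[of x 0] x L'.act_zero[of "f x"] f(1) by (auto dest: bij_betwE)
  show ?thesis
  proof (rule that)
    have "f x \<in> carrier L'" using f(1) x by (auto dest: bij_betwE)
    moreover have "f x \<noteq> \<zero>\<^bsub>L'\<^esub>"
      using f0 x f(1) L.M.zero_closed by (metis bij_betw_inv_into_left)
    ultimately show "typed L' \<chi> (f x)" using assms(4) x f(2) by (metis typed_def)
    show "eigen L' p e (f x)" if "eigen L p e x" for p e
      using that x f(2) by (metis eigen_def)
  qed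
qed

lemma O_all_nz: "\<chi> \<in> O_all N M \<Longrightarrow> fst \<chi> \<noteq> 0 \<and> snd \<chi> \<noteq> 0"
  using N_pos M_pos by (auto simp: O_all_def roots_1_def power_0_left)

lemma O_all_pow:
  assumes "\<chi> \<in> O_all N M"
  shows "fst \<chi> ^ (2 * N) = 1" "snd \<chi> ^ (2 * M) = 1" "(- fst \<chi>) ^ (2 * N) = 1" "(- snd \<chi>) ^ (2 * M) = 1"
  using assms by (auto simp: O_all_def roots_1_def)

text \<open>Here and in the next three models each relator, applied to a generic coordinate vector,
  yields polynomial equations in the entries of \<chi>, the \<alpha>'s and the coordinates, which
  follow from the definitions of the \<alpha>'s. The cancellation rules are switched off because
  they would turn these equations into disjunctions, on which the Groebner basis method
  fails.\<close>

lemma rep_L1_H: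
  assumes "\<chi> \<in> OO1"
  shows "rep_H N M l1 l2 l3 1 (L1_op \<chi>)"
proof -
  interpret rep 1 "L1_op \<chi>" by (rule rep_L1)
  define x y where "x = fst \<chi>" and "y = snd \<chi>"
  define \<alpha>1 \<alpha>2 \<alpha>3 where "\<alpha>1 = alpha1 l1 \<chi>" and "\<alpha>2 = alpha2 l2 \<chi>" and "\<alpha>3 = alpha3 l1 l2 l3 \<chi>"
  note defs = x_def y_def \<alpha>1_def \<alpha>2_def \<alpha>3_def
  note ops = L1_op_simps[of \<chi>, folded defs]
  note [simp] = Act_gen ops Act_mult Act_add Act_diff Act_uminus Act_const Act_1
    vec_of_list_numerals
  note [simp del] = One_nat_def mult_cancel_left mult_cancel_right mult_eq_0_iff
  have pow: "Act (gen G1 ^ k) (vec_of_list [a]) = vec_of_list [(x) ^ k * a]"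
    "Act (gen G2 ^ k) (vec_of_list [a]) = vec_of_list [(y) ^ k * a]" for k a
    by (induction k arbitrary: a) (simp_all add: mult_ac)
  have \<chi>: "\<chi> \<in> O_all N M"
    and \<alpha>: "0 = l1 * (1 - x * x)" "0 = l2 * (1 - y * y)"
    "0 = l3 * (1 - x * x * (y * y)) - 2 * l1 * l2 * (1 + y * y) * (1 - x * x)"
    using assms by (auto simp: defs O1_def alpha1_def alpha2_def alpha3_def power2_eq_square)
  have "\<And>r v. r \<in> relators N M l1 l2 l3 \<Longrightarrow> v \<in> carrier_vec 1 \<Longrightarrow> Act r v = 0\<^sub>v 1"
    by (elim carrier_vec_1E, simp add: relators_def Let_def)
      (elim disjE; hypsubst; simp add: pow O_all_pow[OF \<chi>, folded x_def y_def] power2_eq_square; (intro conjI)?;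
        ((use \<alpha>(1) in Groebner_Basis.algebra) | (use \<alpha>(2) in Groebner_Basis.algebra) | (use \<alpha>(3) in Groebner_Basis.algebra)))
  then show ?thesis
    by (intro rep_H.intro rep_axioms rep_H_axioms.intro) (simp add: Act_def)
qed

text \<open>Membership in \<open>OO2\<close> together with \<alpha>1 \<noteq> 0 forces \<alpha>2 =
  \<alpha>3 = 0, as it must because a2 acts by zero.\<close>

lemma rep_L2h_H:
  assumes "\<chi> \<in> OO2" "alpha1 l1 \<chi> \<noteq> 0"
  shows "rep_H N M l1 l2 l3 2 (L2h_op l1 \<chi>)"
proof -
  interpret rep 2 "L2h_op l1 \<chi>" by (rule rep_L2h)
  define x y where "x = fst \<chi>" and "y = snd \<chi>"
  define \<alpha>1 \<alpha>2 \<alpha>3 where "\<alpha>1 = alpha1 l1 \<chi>" and "\<alpha>2 = alpha2 l2 \<chi>" and "\<alpha>3 = alpha3 l1 l2 l3 \<chi>"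
  note defs = x_def y_def \<alpha>1_def \<alpha>2_def \<alpha>3_def
  note ops = L2h_op_simps[of l1 \<chi>, folded defs]
  note [simp] = Act_gen ops Act_mult Act_add Act_diff Act_uminus Act_const Act_1
    vec_of_list_numerals
  note [simp del] = One_nat_def mult_cancel_left mult_cancel_right mult_eq_0_iff
  have pow: "Act (gen G1 ^ k) (vec_of_list [a, b]) = vec_of_list [(x) ^ k * a, (- x) ^ k * b]"
    "Act (gen G2 ^ k) (vec_of_list [a, b]) = vec_of_list [(y) ^ k * a, (y) ^ k * b]" for k a b
    by (induction k arbitrary: a b) (simp_all add: mult_ac)
  have \<chi>: "\<chi> \<in> O_all N M"
    and \<alpha>: "\<alpha>1 = l1 * (1 - x * x)" "0 = l2 * (1 - y * y)"
    "0 = l3 * (1 - x * x * (y * y)) - 2 * l1 * l2 * (1 + y * y) * (1 - x * x)"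
    using assms by (auto simp: defs O2_def alpha1_def alpha2_def alpha3_def power2_eq_square)
  have "\<And>r v. r \<in> relators N M l1 l2 l3 \<Longrightarrow> v \<in> carrier_vec 2 \<Longrightarrow> Act r v = 0\<^sub>v 2"
    by (elim carrier_vec_2E, simp add: relators_def Let_def)
      (elim disjE; hypsubst; simp add: pow O_all_pow[OF \<chi>, folded x_def y_def] power2_eq_square; (intro conjI)?;
        ((use \<alpha>(1) in Groebner_Basis.algebra) | (use \<alpha>(2) in Groebner_Basis.algebra) | (use \<alpha>(3) in Groebner_Basis.algebra)))
  then show ?thesis
    by (intro rep_H.intro rep_axioms rep_H_axioms.intro) (simp add: Act_def)
qed

lemma rep_L2v_H:
  assumes "\<chi> \<in> OO2" "alpha2 l2 \<chi> \<noteq> 0"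
  shows "rep_H N M l1 l2 l3 2 (L2v_op l2 \<chi>)"
proof -
  interpret rep 2 "L2v_op l2 \<chi>" by (rule rep_L2v)
  define x y where "x = fst \<chi>" and "y = snd \<chi>"
  define \<alpha>1 \<alpha>2 \<alpha>3 where "\<alpha>1 = alpha1 l1 \<chi>" and "\<alpha>2 = alpha2 l2 \<chi>" and "\<alpha>3 = alpha3 l1 l2 l3 \<chi>"
  note defs = x_def y_def \<alpha>1_def \<alpha>2_def \<alpha>3_def
  note ops = L2v_op_simps[of l2 \<chi>, folded defs]
  note [simp] = Act_gen ops Act_mult Act_add Act_diff Act_uminus Act_const Act_1
    vec_of_list_numerals
  note [simp del] = One_nat_def mult_cancel_left mult_cancel_right mult_eq_0_iff
  have pow: "Act (gen G1 ^ k) (vec_of_list [a, b]) = vec_of_list [(x) ^ k * a, (- x) ^ k * b]"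
    "Act (gen G2 ^ k) (vec_of_list [a, b]) = vec_of_list [(y) ^ k * a, (- y) ^ k * b]" for k a b
    by (induction k arbitrary: a b) (simp_all add: mult_ac)
  have \<chi>: "\<chi> \<in> O_all N M"
    and \<alpha>: "0 = l1 * (1 - x * x)" "\<alpha>2 = l2 * (1 - y * y)"
    "0 = l3 * (1 - x * x * (y * y)) - 2 * l1 * l2 * (1 + y * y) * (1 - x * x)"
    using assms by (auto simp: defs O2_def alpha1_def alpha2_def alpha3_def power2_eq_square)
  have "\<And>r v. r \<in> relators N M l1 l2 l3 \<Longrightarrow> v \<in> carrier_vec 2 \<Longrightarrow> Act r v = 0\<^sub>v 2"
    by (elim carrier_vec_2E, simp add: relators_def Let_def)
      (elim disjE; hypsubst; simp add: pow O_all_pow[OF \<chi>, folded x_def y_def] power2_eq_square; (intro conjI)?;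
        ((use \<alpha>(1) in Groebner_Basis.algebra) | (use \<alpha>(2) in Groebner_Basis.algebra) | (use \<alpha>(3) in Groebner_Basis.algebra)))
  then show ?thesis
    by (intro rep_H.intro rep_axioms rep_H_axioms.intro) (simp add: Act_def)
qed

abbreviation L4c :: "'k \<times> 'k \<Rightarrow> 'k \<Rightarrow> 'k" where
  "L4c \<chi> d \<equiv> alpha3 l1 l2 l3 \<chi> - (alpha1 l1 \<chi>)\<^sup>2 * alpha2 l2 \<chi> * d"

lemma L4c_mult: "L4_eq l1 l2 l3 \<chi> d \<Longrightarrow> L4c \<chi> d * d = alpha2 l2 \<chi>" (is "_ \<Longrightarrow> ?thesis")
proof -
  have "a * d\<^sup>2 - c * d + b = 0 \<Longrightarrow> (c - a * d) * d = b" for a b c :: 'k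
    by Groebner_Basis.algebra
  then show "L4_eq l1 l2 l3 \<chi> d \<Longrightarrow> ?thesis" unfolding L4_eq_def .
qed

text \<open>If c were 0, then \<alpha>2 = cd = 0, hence \<alpha>3 = c + \<alpha>1^2 \<alpha>2 d = 0,
  and \<chi> would lie in \<open>OO1\<close> or \<open>OO2\<close> according to \<alpha>1.\<close>

lemma L4c_nz: "L4_eq l1 l2 l3 \<chi> d \<Longrightarrow> \<chi> \<in> OO4 \<Longrightarrow> L4c \<chi> d \<noteq> 0"
  using L4c_mult[of \<chi> d] by (auto simp: O4_def O1_def O2_def)

text \<open>The relation for a2^2 on v1 and v4 is exactly cd = \<alpha>2. In the last relation w
  acts on v1 by c and u by \<alpha>1^2 \<alpha>2 d, whose sum is \<alpha>3 by the choice of c; on v2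
  the two values are interchanged.\<close>

lemma rep_L4_H:
  assumes "\<chi> \<in> OO4" "L4_eq l1 l2 l3 \<chi> d"
  shows "rep_H N M l1 l2 l3 4 (L4_op l1 l2 l3 \<chi> d)"
proof -
  interpret rep 4 "L4_op l1 l2 l3 \<chi> d" by (rule rep_L4)
  define x y where "x = fst \<chi>" and "y = snd \<chi>"
  define \<alpha>1 \<alpha>2 \<alpha>3 where "\<alpha>1 = alpha1 l1 \<chi>" and "\<alpha>2 = alpha2 l2 \<chi>" and "\<alpha>3 = alpha3 l1 l2 l3 \<chi>"
  note defs = x_def y_def \<alpha>1_def \<alpha>2_def \<alpha>3_def
  define c where "c = \<alpha>3 - \<alpha>1\<^sup>2 * \<alpha>2 * d"
  note ops = L4_op_simps[of l1 l2 l3 \<chi> d, folded defs, folded c_def]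
  have cd: "c * d = \<alpha>2" using L4c_mult[OF assms(2)] by (simp add: c_def defs)
  note [simp] = Act_gen ops Act_mult Act_add Act_diff Act_uminus Act_const Act_1
    vec_of_list_numerals
  note [simp del] = One_nat_def mult_cancel_left mult_cancel_right mult_eq_0_iff
  have pow: "Act (gen G1 ^ k) (vec_of_list [p, q, s, t]) = vec_of_list [(x) ^ k * p, (- x) ^ k * q, (x) ^ k * s, (- x) ^ k * t]"
    "Act (gen G2 ^ k) (vec_of_list [p, q, s, t]) = vec_of_list [(y) ^ k * p, (y) ^ k * q, (- y) ^ k * s, (- y) ^ k * t]" for k p q s t
    by (induction k arbitrary: p q s t) (simp_all add: mult_ac)
  have \<chi>: "\<chi> \<in> O_all N M"
    and \<alpha>: "\<alpha>1 = l1 * (1 - x * x)" "\<alpha>2 = l2 * (1 - y * y)"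
    "c + \<alpha>1 * \<alpha>1 * \<alpha>2 * d = l3 * (1 - x * x * (y * y)) - 2 * l1 * l2 * (1 + y * y) * (1 - x * x)"
    using assms by (auto simp: O4_def c_def defs alpha1_def alpha2_def alpha3_def power2_eq_square)
  have "\<And>r v. r \<in> relators N M l1 l2 l3 \<Longrightarrow> v \<in> carrier_vec 4 \<Longrightarrow> Act r v = 0\<^sub>v 4"
    by (elim carrier_vec_4E, simp add: relators_def Let_def)
      (elim disjE; hypsubst; simp add: pow O_all_pow[OF \<chi>, folded x_def y_def] power2_eq_square; (intro conjI)?;
        ((use \<alpha>(1) in Groebner_Basis.algebra) | (use \<alpha>(2) cd in Groebner_Basis.algebra) | (use \<alpha>(3) in Groebner_Basis.algebra)))
  then show ?thesis
    by (intro rep_H.intro rep_axioms rep_H_axioms.intro) (simp add: Act_def)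
qed

lemma simple_L1:
  assumes "\<chi> \<in> OO1"
  shows "simple_module HH (L1 \<chi>)"
proof -
  interpret rep_H N M l1 l2 l3 1 "L1_op \<chi>" using assms by (rule rep_L1_H)
  define x y where "x = fst \<chi>" and "y = snd \<chi>"
  note ops = L1_op_simps[of \<chi>, folded x_def y_def]
  note [simp] = Act_gen ops Act_mult Act_add Act_diff Act_const vec_of_list_numerals
  note [simp del] = One_nat_def
  have nz: "x \<noteq> 0" "y \<noteq> 0" using assms O_all_nz[of \<chi>] by (auto simp: x_def y_def O1_def O2_def O4_def)
  show ?thesis unfolding L1_def
  proof (rule simple_cyclicI)
    fix v :: "'k vec" assume "v \<in> carrier_vec 1" "v \<noteq> 0\<^sub>v 1"
    then obtain a where v: "v = vec_of_list [a]" and "a \<noteq> 0"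
      by (elim carrier_vec_1E) auto
    then have "Act (const (1 / a)) v = unit_vec 1 0" by simp
    then show "\<exists>i<1. \<exists>p. Act p v = unit_vec 1 i" by (intro exI[of _ 0]) auto
  next
    show "\<exists>p. Act p (unit_vec 1 i) = unit_vec 1 (Suc i mod 1)" if "i < 1" for i
      using that by (intro exI[of _ 1]) (simp add: Act_1)
  qed simp
qed

lemma simple_L2h:
  assumes "\<chi> \<in> OO2" "alpha1 l1 \<chi> \<noteq> 0"
  shows "simple_module HH (L2h l1 \<chi>)"
proof -
  interpret rep_H N M l1 l2 l3 2 "L2h_op l1 \<chi>" using assms by (rule rep_L2h_H)
  define x y where "x = fst \<chi>" and "y = snd \<chi>"
  define \<alpha>1 where "\<alpha>1 = alpha1 l1 \<chi>"
  note ops = L2h_op_simps[of l1 \<chi>, folded x_def y_def \<alpha>1_def]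
  note a_nz = assms(2)[folded \<alpha>1_def]
  note [simp] = Act_gen ops Act_mult Act_add Act_diff Act_const vec_of_list_numerals
  note [simp del] = One_nat_def
  have nz: "x \<noteq> 0" "y \<noteq> 0" using assms O_all_nz[of \<chi>] by (auto simp: x_def y_def O1_def O2_def O4_def)
  show ?thesis unfolding L2h_def
  proof (rule simple_cyclicI)
    fix v :: "'k vec" assume "v \<in> carrier_vec 2" "v \<noteq> 0\<^sub>v 2"
    then obtain a b where v: "v = vec_of_list [a, b]" and "a \<noteq> 0 \<or> b \<noteq> 0"
      by (elim carrier_vec_2E) auto
    then show "\<exists>i<2. \<exists>p. Act p v = unit_vec 2 i"
    proof (elim disjE)
      assume "a \<noteq> 0"
      \<comment> \<open>The second basis vector has g1-eigenvalue -x and is annihilated by g1 + x,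
        while the first is scaled by 2x; the constant normalises the result.\<close>
      then have "Act (const (1 / (2 * x * a)) * (gen G1 + const x)) v = unit_vec 2 0" using nz by (simp add: v)
      then show ?thesis by (intro exI[of _ 0]) auto
    next
      assume "b \<noteq> 0"
      then have "Act (const (- 1 / (2 * x * b)) * (gen G1 - const x)) v = unit_vec 2 1" using nz by (simp add: v)
      then show ?thesis by (intro exI[of _ 1]) auto
    qed
  next
    fix i :: nat assume "i < 2"
    then have "i = 0 \<or> i = 1" by linarith
    then show "\<exists>p. Act p (unit_vec 2 i) = unit_vec 2 (Suc i mod 2)"
    proof (elim disjE)
      show ?thesis if "i = 0" by (intro exI[of _ "gen A1"]) (simp add: that Suc_eq_plus1 a_nz)
      show ?thesis if "i = 1" by (intro exI[of _ "const (1 / \<alpha>1) * gen A1"]) (simp add: that Suc_eq_plus1 a_nz)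
    qed
  qed simp
qed

lemma simple_L2v:
  assumes "\<chi> \<in> OO2" "alpha2 l2 \<chi> \<noteq> 0"
  shows "simple_module HH (L2v l2 \<chi>)"
proof -
  interpret rep_H N M l1 l2 l3 2 "L2v_op l2 \<chi>" using assms by (rule rep_L2v_H)
  define x y where "x = fst \<chi>" and "y = snd \<chi>"
  define \<alpha>2 where "\<alpha>2 = alpha2 l2 \<chi>"
  note ops = L2v_op_simps[of l2 \<chi>, folded x_def y_def \<alpha>2_def]
  note a_nz = assms(2)[folded \<alpha>2_def]
  note [simp] = Act_gen ops Act_mult Act_add Act_diff Act_const vec_of_list_numerals
  note [simp del] = One_nat_def
  have nz: "x \<noteq> 0" "y \<noteq> 0" using assms O_all_nz[of \<chi>] by (auto simp: x_def y_def O1_def O2_def O4_def)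
  show ?thesis unfolding L2v_def
  proof (rule simple_cyclicI)
    fix v :: "'k vec" assume "v \<in> carrier_vec 2" "v \<noteq> 0\<^sub>v 2"
    then obtain a b where v: "v = vec_of_list [a, b]" and "a \<noteq> 0 \<or> b \<noteq> 0"
      by (elim carrier_vec_2E) auto
    then show "\<exists>i<2. \<exists>p. Act p v = unit_vec 2 i"
    proof (elim disjE)
      assume "a \<noteq> 0"
      then have "Act (const (1 / (2 * x * a)) * (gen G1 + const x)) v = unit_vec 2 0" using nz by (simp add: v)
      then show ?thesis by (intro exI[of _ 0]) auto
    next
      assume "b \<noteq> 0"
      then have "Act (const (- 1 / (2 * x * b)) * (gen G1 - const x)) v = unit_vec 2 1" using nz by (simp add: v)
      then show ?thesis by (intro exI[of _ 1]) auto
    qed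
  next
    fix i :: nat assume "i < 2"
    then have "i = 0 \<or> i = 1" by linarith
    then show "\<exists>p. Act p (unit_vec 2 i) = unit_vec 2 (Suc i mod 2)"
    proof (elim disjE)
      show ?thesis if "i = 0" by (intro exI[of _ "gen A2"]) (simp add: that Suc_eq_plus1 a_nz)
      show ?thesis if "i = 1" by (intro exI[of _ "const (1 / \<alpha>2) * gen A2"]) (simp add: that Suc_eq_plus1 a_nz)
    qed
  qed simp
qed

lemma simple_L4:
  assumes "\<chi> \<in> OO4" "L4_eq l1 l2 l3 \<chi> d"
  shows "simple_module HH (L4 l1 l2 l3 \<chi> d)"
proof -
  interpret rep_H N M l1 l2 l3 4 "L4_op l1 l2 l3 \<chi> d" using assms by (rule rep_L4_H)
  define x y where "x = fst \<chi>" and "y = snd \<chi>"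
  define c where "c = L4c \<chi> d"
  note ops = L4_op_simps[of l1 l2 l3 \<chi> d, folded x_def y_def, folded c_def]
  have c_nz: "c \<noteq> 0" using L4c_nz[OF assms(2,1)] by (simp add: c_def)
  note [simp] = Act_gen ops Act_mult Act_add Act_diff Act_const vec_of_list_numerals
  note [simp del] = One_nat_def
  have nz: "x \<noteq> 0" "y \<noteq> 0" using assms O_all_nz[of \<chi>] by (auto simp: x_def y_def O1_def O2_def O4_def)
  show ?thesis unfolding L4_def
  proof (rule simple_cyclicI)
    fix v :: "'k vec" assume "v \<in> carrier_vec 4" "v \<noteq> 0\<^sub>v 4"
    then obtain a b e f where v: "v = vec_of_list [a, b, e, f]" and "a \<noteq> 0 \<or> b \<noteq> 0 \<or> e \<noteq> 0 \<or> f \<noteq> 0"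
      by (elim carrier_vec_4E) auto
    then show "\<exists>i<4. \<exists>p. Act p v = unit_vec 4 i"
    proof (elim disjE)
      assume "a \<noteq> 0"
      \<comment> \<open>A product of one factor g1 + x or g1 - x with one factor g2 + y or g2 - y
        annihilates three of the four basis vectors and scales the remaining one by 4xy up to
        sign.\<close>
      then have "Act (const (1 / (4 * x * y * a)) * (gen G1 + const x) * (gen G2 + const y)) v = unit_vec 4 0" using nz by (simp add: v)
      then show ?thesis by (intro exI[of _ 0]) auto
    next
      assume "b \<noteq> 0"
      then have "Act (const (- 1 / (4 * x * y * b)) * (gen G1 - const x) * (gen G2 + const y)) v = unit_vec 4 1" using nz by (simp add: v)
      then show ?thesis by (intro exI[of _ 1]) auto
    next
      assume "e \<noteq> 0"
      then have "Act (const (- 1 / (4 * x * y * e)) * (gen G1 + const x) * (gen G2 - const y)) v = unit_vec 4 2" using nz by (simp add: v)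
      then show ?thesis by (intro exI[of _ 2]) auto
    next
      assume "f \<noteq> 0"
      then have "Act (const (1 / (4 * x * y * f)) * (gen G1 - const x) * (gen G2 - const y)) v = unit_vec 4 3" using nz by (simp add: v)
      then show ?thesis by (intro exI[of _ 3]) auto
    qed
  next
    fix i :: nat assume "i < 4"
    then have "i = 0 \<or> i = 1 \<or> i = 2 \<or> i = 3" by linarith
    then show "\<exists>p. Act p (unit_vec 4 i) = unit_vec 4 (Suc i mod 4)"
    proof (elim disjE)
      show ?thesis if "i = 0" by (intro exI[of _ "gen A1"]) (simp add: that Suc_eq_plus1 c_nz)
      show ?thesis if "i = 1" by (intro exI[of _ "gen A2"]) (simp add: that Suc_eq_plus1 c_nz)
      show ?thesis if "i = 2" by (intro exI[of _ "gen A1"]) (simp add: that Suc_eq_plus1 c_nz)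
      \<comment> \<open>a2 v4 = c v1 closes the cycle of basis vectors; here c \<noteq> 0 is
        used.\<close>
      show ?thesis if "i = 3" by (intro exI[of _ "const (1 / c) * gen A2"]) (simp add: that Suc_eq_plus1 c_nz)
    qed
  qed simp
qed

lemma H_mod_models:
  "\<chi> \<in> OO1 \<Longrightarrow> H_mod N M l1 l2 l3 (L1 \<chi>)"
  "\<chi> \<in> OO2 \<Longrightarrow> alpha1 l1 \<chi> \<noteq> 0 \<Longrightarrow> H_mod N M l1 l2 l3 (L2h l1 \<chi>)"
  "\<chi> \<in> OO2 \<Longrightarrow> alpha2 l2 \<chi> \<noteq> 0 \<Longrightarrow> H_mod N M l1 l2 l3 (L2v l2 \<chi>)"
  "\<chi> \<in> OO4 \<Longrightarrow> L4_eq l1 l2 l3 \<chi> d \<Longrightarrow> H_mod N M l1 l2 l3 (L4 l1 l2 l3 \<chi> d)"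
  by (blast intro: simple_H_mod simple_L1 simple_L2h simple_L2v simple_L4)+

section \<open>Types and eigenvalues that occur in the models\<close>

lemma typed_L1:
  assumes "\<chi> \<in> OO1"
  shows "typed (L1 \<chi>) \<chi>' v \<Longrightarrow> \<chi>' = \<chi>" and "typed (L1 \<chi>) \<chi> (unit_vec 1 0)"
proof -
  interpret rep_H N M l1 l2 l3 1 "L1_op \<chi>" using assms by (rule rep_L1_H)
  note [simp] = Act_gen L1_op_simps Act_const vec_of_list_numerals act_rep_module
  note [simp del] = One_nat_def
  show "typed (L1 \<chi>) \<chi>' v \<Longrightarrow> \<chi>' = \<chi>"
    by (auto simp: prod_eq_iff typed_def L1_def elim!: carrier_vec_1E)
  show "typed (L1 \<chi>) \<chi> (unit_vec 1 0)"
    by (simp add: typed_def L1_def)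
qed

lemma typed_L2h:
  assumes "\<chi> \<in> OO2" "alpha1 l1 \<chi> \<noteq> 0"
  shows "typed (L2h l1 \<chi>) \<chi>' v \<Longrightarrow> \<chi>' \<in> {\<chi>, bar_type \<chi>}" and "typed (L2h l1 \<chi>) \<chi> (unit_vec 2 0)"
proof -
  interpret rep_H N M l1 l2 l3 2 "L2h_op l1 \<chi>" using assms by (rule rep_L2h_H)
  note [simp] = Act_gen L2h_op_simps Act_const vec_of_list_numerals act_rep_module
  show "typed (L2h l1 \<chi>) \<chi>' v \<Longrightarrow> \<chi>' \<in> {\<chi>, bar_type \<chi>}"
    by (auto simp: prod_eq_iff typed_def L2h_def bar_type_def simp del: mult_minus_left elim!: carrier_vec_2E)
  show "typed (L2h l1 \<chi>) \<chi> (unit_vec 2 0)"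
    by (simp add: typed_def L2h_def)
qed

lemma typed_L2v:
  assumes "\<chi> \<in> OO2" "alpha2 l2 \<chi> \<noteq> 0"
  shows "typed (L2v l2 \<chi>) \<chi>' v \<Longrightarrow> \<chi>' \<in> {\<chi>, neg_type \<chi>}" and "typed (L2v l2 \<chi>) \<chi> (unit_vec 2 0)"
proof -
  interpret rep_H N M l1 l2 l3 2 "L2v_op l2 \<chi>" using assms by (rule rep_L2v_H)
  note [simp] = Act_gen L2v_op_simps Act_const vec_of_list_numerals act_rep_module
  show "typed (L2v l2 \<chi>) \<chi>' v \<Longrightarrow> \<chi>' \<in> {\<chi>, neg_type \<chi>}"
    by (auto simp: prod_eq_iff typed_def L2v_def neg_type_def simp del: mult_minus_left elim!: carrier_vec_2E)
  show "typed (L2v l2 \<chi>) \<chi> (unit_vec 2 0)"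
    by (simp add: typed_def L2v_def)
qed

text \<open>The eigenvalue of w is tied to the type: c goes with v1 and v3, the complementary root
  with v2 and v4. This is the invariant that tells \<open>L4\<close> at \<chi> from
  \<open>L4\<close> at \<open>bar_type \<chi>\<close> with the same d.\<close>

lemma typed_L4:
  assumes "\<chi> \<in> OO4" "L4_eq l1 l2 l3 \<chi> d"
  shows "typed (L4 l1 l2 l3 \<chi> d) \<chi>' v \<Longrightarrow> eigen (L4 l1 l2 l3 \<chi> d) W2 e v \<Longrightarrow>
      \<chi>' \<in> {\<chi>, neg_type (bar_type \<chi>)} \<and> e = L4c \<chi> d \<or>
      \<chi>' \<in> {bar_type \<chi>, neg_type \<chi>} \<and> e = (alpha1 l1 \<chi>)\<^sup>2 * alpha2 l2 \<chi> * d"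
    and "typed (L4 l1 l2 l3 \<chi> d) \<chi> (unit_vec 4 0)"
    and "eigen (L4 l1 l2 l3 \<chi> d) W2 (L4c \<chi> d) (unit_vec 4 0)"
proof -
  interpret rep_H N M l1 l2 l3 4 "L4_op l1 l2 l3 \<chi> d" using assms by (rule rep_L4_H)
  define \<alpha>1 \<alpha>2 c where "\<alpha>1 = alpha1 l1 \<chi>" and "\<alpha>2 = alpha2 l2 \<chi>" and "c = L4c \<chi> d"
  define x y where "x = fst \<chi>" and "y = snd \<chi>"
  note ops = L4_op_simps[of l1 l2 l3 \<chi> d, folded c_def, folded \<alpha>1_def \<alpha>2_def x_def y_def]
  note [simp] = Act_gen ops Act_mult Act_const vec_of_list_numerals act_rep_module
  show "typed (L4 l1 l2 l3 \<chi> d) \<chi> (unit_vec 4 0)"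
    by (simp add: typed_def L4_def flip: x_def y_def)
  show "eigen (L4 l1 l2 l3 \<chi> d) W2 (L4c \<chi> d) (unit_vec 4 0)"
    by (simp add: eigen_def L4_def W2_def flip: c_def)
  assume "typed (L4 l1 l2 l3 \<chi> d) \<chi>' v" "eigen (L4 l1 l2 l3 \<chi> d) W2 e v"
  then obtain p q s t where v: "v = vec_of_list [p, q, s, t]"
    and pqst: "p \<noteq> 0 \<or> q \<noteq> 0 \<or> s \<noteq> 0 \<or> t \<noteq> 0"
    and G1: "x * p = fst \<chi>' * p" "- x * q = fst \<chi>' * q" "x * s = fst \<chi>' * s" "- x * t = fst \<chi>' * t"
    and G2: "y * p = snd \<chi>' * p" "y * q = snd \<chi>' * q" "- y * s = snd \<chi>' * s" "- y * t = snd \<chi>' * t"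
    and W: "c * p = e * p" "\<alpha>1 * (\<alpha>1 * \<alpha>2 * d) * q = e * q" "c * s = e * s" "\<alpha>1 * (\<alpha>1 * \<alpha>2 * d) * t = e * t"
    by (auto simp: typed_def eigen_def L4_def W2_def mult_ac simp del: mult_minus_left mult_cancel_left mult_cancel_right elim!: carrier_vec_4E)
  have "p \<noteq> 0 \<Longrightarrow> \<chi>' = \<chi> \<and> e = c"
    using G1(1) G2(1) W(1) by (simp add: prod_eq_iff x_def y_def)
  moreover have "q \<noteq> 0 \<Longrightarrow> \<chi>' = bar_type \<chi> \<and> e = \<alpha>1\<^sup>2 * \<alpha>2 * d"
    using G1(2) G2(2) W(2) by (simp add: prod_eq_iff x_def y_def bar_type_def power2_eq_square mult.assoc del: mult_minus_left)
  moreover have "s \<noteq> 0 \<Longrightarrow> \<chi>' = neg_type (bar_type \<chi>) \<and> e = c"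
    using G1(3) G2(3) W(3) by (simp add: prod_eq_iff x_def y_def bar_type_def neg_type_def del: mult_minus_left)
  moreover have "t \<noteq> 0 \<Longrightarrow> \<chi>' = neg_type \<chi> \<and> e = \<alpha>1\<^sup>2 * \<alpha>2 * d"
    using G1(4) G2(4) W(4) by (simp add: prod_eq_iff x_def y_def neg_type_def power2_eq_square mult.assoc del: mult_minus_left)
  ultimately show "\<chi>' \<in> {\<chi>, neg_type (bar_type \<chi>)} \<and> e = L4c \<chi> d \<or>
      \<chi>' \<in> {bar_type \<chi>, neg_type \<chi>} \<and> e = (alpha1 l1 \<chi>)\<^sup>2 * alpha2 l2 \<chi> * d"
    using pqst unfolding c_def \<alpha>1_def \<alpha>2_def by blast
qed

end

section \<open>Weight vectors in a module\<close>

context H_mod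
begin

lemma act_rel:
  assumes "p - q \<in> relators N M l1 l2 l3" "x \<in> carrier L"
  shows "act L p x = act L q x"
  using assms relators_in_rel_ideal by (auto simp: act_eq_iff intro: act_rel_ideal)

lemma act_cong_add:
  "x \<in> carrier L \<Longrightarrow> act L p x = act L p' x \<Longrightarrow> act L q x = act L q' x \<Longrightarrow>
     act L (p + q) x = act L (p' + q') x"
  by (simp add: act_add)

text \<open>Equality on one fixed vector survives multiplication on the left only, so a relation
  valid just for x has to be applied in the factor next to x.\<close>

lemma act_cong_mult:
  "x \<in> carrier L \<Longrightarrow> act L p x = act L p' x \<Longrightarrow> act L (r * p) x = act L (r * p') x"
  by (simp add: act_mult)

lemma act_cong_diff:
  "x \<in> carrier L \<Longrightarrow> act L p x = act L p' x \<Longrightarrow> act L q x = act L q' x \<Longrightarrow>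
     act L (p - q) x = act L (p' - q') x"
  using act_cong_add[of x p p' "- q" "- q'"] by (simp add: act_uminus)

lemma act_const_commute: "x \<in> carrier L \<Longrightarrow> act L (gen g) (act L (const c) x) = act L (const c) (act L (gen g) x)"
  by (simp add: act_mult[symmetric] const_commute[of c "gen g"])

lemma act_const_const: "x \<in> carrier L \<Longrightarrow> act L (const b) (act L (const c) x) = act L (const (b * c)) x"
  by (simp add: act_mult[symmetric] const_mult)

lemma group_relations:
  assumes "x \<in> carrier L"
  shows "act L (gen G1) (act L (gen G2) x) = act L (gen G2) (act L (gen G1) x)"
    "act L (gen G1 ^ (2 * N)) x = x" "act L (gen G2 ^ (2 * M)) x = x"
proof -
  have "act L (gen G1 * gen G2) x = act L (gen G2 * gen G1) x"
    by (rule act_rel[OF _ assms]) (simp add: relators_def Let_def)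
  then show "act L (gen G1) (act L (gen G2) x) = act L (gen G2) (act L (gen G1) x)"
    by (simp add: act_mult assms)
  have "act L (gen G1 ^ (2 * N)) x = act L 1 x"
    by (rule act_rel[OF _ assms]) (simp add: relators_def Let_def)
  then show "act L (gen G1 ^ (2 * N)) x = x" by (simp add: assms)
  have "act L (gen G2 ^ (2 * M)) x = act L 1 x"
    by (rule act_rel[OF _ assms]) (simp add: relators_def Let_def)
  then show "act L (gen G2 ^ (2 * M)) x = x" by (simp add: assms)
qed

text \<open>The sign appears as a scalar acting next to the generator of the group, so that on
  weight vectors it merges with the eigenvalue.\<close>

lemma skew_relations:
  assumes "x \<in> carrier L"
  shows "act L (gen G1) (act L (gen A1) x) = act L (gen A1) (act L (const (- 1)) (act L (gen G1) x))"
    "act L (gen G1) (act L (gen A2) x) = act L (gen A2) (act L (const (- 1)) (act L (gen G1) x))"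
    "act L (gen G2) (act L (gen A1) x) = act L (gen A1) (act L (gen G2) x)"
    "act L (gen G2) (act L (gen A2) x) = act L (gen A2) (act L (const (- 1)) (act L (gen G2) x))"
proof -
  have *: "- (a * g) = a * (const (- 1) * g)" for a g :: "'k free_alg"
    by (simp add: const_uminus)
  have "act L (gen G1 * gen A1) x = act L (- (gen A1 * gen G1)) x"
    by (rule act_rel[OF _ assms]) (simp add: relators_def Let_def)
  then show "act L (gen G1) (act L (gen A1) x) = act L (gen A1) (act L (const (- 1)) (act L (gen G1) x))"
    unfolding * by (simp only: act_mult assms act_closed)
  have "act L (gen G1 * gen A2) x = act L (- (gen A2 * gen G1)) x"
    by (rule act_rel[OF _ assms]) (simp add: relators_def Let_def)
  then show "act L (gen G1) (act L (gen A2) x) = act L (gen A2) (act L (const (- 1)) (act L (gen G1) x))"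
    unfolding * by (simp only: act_mult assms act_closed)
  have "act L (gen G2 * gen A2) x = act L (- (gen A2 * gen G2)) x"
    by (rule act_rel[OF _ assms]) (simp add: relators_def Let_def)
  then show "act L (gen G2) (act L (gen A2) x) = act L (gen A2) (act L (const (- 1)) (act L (gen G2) x))"
    unfolding * by (simp only: act_mult assms act_closed)
  have "act L (gen G2 * gen A1) x = act L (gen A1 * gen G2) x"
    by (rule act_rel[OF _ assms]) (simp add: relators_def Let_def)
  then show "act L (gen G2) (act L (gen A1) x) = act L (gen A1) (act L (gen G2) x)"
    by (simp add: act_mult assms)
qed

lemma power_relations:
  assumes "x \<in> carrier L"
  shows "act L (gen A1 * gen A1) x = act L (const l1 * (1 - gen G1 * gen G1)) x"
    "act L (gen A2 * gen A2) x = act L (const l2 * (1 - gen G2 * gen G2)) x"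
    "act L (gen A1 * gen A2 * gen A1 * gen A2 + gen A2 * gen A1 * gen A2 * gen A1) x =
     act L (const l3 * (1 - gen G1 * gen G1 * (gen G2 * gen G2)) -
        const (2 * l1 * l2) * (1 + gen G2 * gen G2) * (1 - gen G1 * gen G1)) x"
  by (rule act_rel[OF _ assms]; simp add: relators_def Let_def power2_eq_square)+

end

section \<open>Orbits of types under sign changes\<close>

lemma alpha_bar [simp]:
  "alpha1 l1 (bar_type \<chi>) = alpha1 l1 \<chi>" "alpha2 l2 (bar_type \<chi>) = alpha2 l2 \<chi>"
  "alpha3 l1 l2 l3 (bar_type \<chi>) = alpha3 l1 l2 l3 \<chi>"
  "alpha1 l1 (neg_type \<chi>) = alpha1 l1 \<chi>" "alpha2 l2 (neg_type \<chi>) = alpha2 l2 \<chi>"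
  "alpha3 l1 l2 l3 (neg_type \<chi>) = alpha3 l1 l2 l3 \<chi>"
  by (simp_all add: alpha1_def alpha2_def alpha3_def bar_type_def neg_type_def)

lemma bar_bar [simp]:
  "bar_type (bar_type \<chi>) = \<chi>" "neg_type (neg_type \<chi>) = \<chi>"
  "neg_type (bar_type \<chi>) = bar_type (neg_type \<chi>)"
  "bar_type (neg_type (bar_type \<chi>)) = neg_type \<chi>"
  by (simp_all add: bar_type_def neg_type_def)

text \<open>The types reachable from a weight vector of type \<chi> by applying a1, which replaces
  \<chi> by \<open>bar_type \<chi>\<close>, and a2, which replaces it by
  \<open>neg_type \<chi>\<close>.\<close>

definition orbit :: "'k::comm_ring_1 \<times> 'k \<Rightarrow> ('k \<times> 'k) set" where
  "orbit \<chi> = {\<chi>, bar_type \<chi>, bar_type (neg_type \<chi>), neg_type \<chi>}"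

lemma orbit_alpha:
  assumes "\<chi>' \<in> orbit \<chi>"
  shows "alpha1 l1 \<chi>' = alpha1 l1 \<chi>" "alpha2 l2 \<chi>' = alpha2 l2 \<chi>" "alpha3 l1 l2 l3 \<chi>' = alpha3 l1 l2 l3 \<chi>"
  using assms by (auto simp: orbit_def)

lemma orbit_O_all [simp]: "\<chi>' \<in> orbit \<chi> \<Longrightarrow> \<chi>' \<in> O_all N M \<longleftrightarrow> \<chi> \<in> O_all N M"
  by (auto simp: orbit_def bar_type_def neg_type_def O_all_def roots_1_def mem_Times_iff)

lemma orbit_O:
  assumes "\<chi>' \<in> orbit \<chi>"
  shows "\<chi>' \<in> O1 N M l1 l2 l3 \<longleftrightarrow> \<chi> \<in> O1 N M l1 l2 l3"
    "\<chi>' \<in> O2 N M l1 l2 l3 \<longleftrightarrow> \<chi> \<in> O2 N M l1 l2 l3"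
    "\<chi>' \<in> O4 N M l1 l2 l3 \<longleftrightarrow> \<chi> \<in> O4 N M l1 l2 l3"
  by (simp_all add: O1_def O2_def O4_def orbit_alpha[OF assms] orbit_O_all[OF assms])

lemma orbit_L4_eq: "\<chi>' \<in> orbit \<chi> \<Longrightarrow> L4_eq l1 l2 l3 \<chi>' d \<longleftrightarrow> L4_eq l1 l2 l3 \<chi> d"
  by (simp add: L4_eq_def orbit_alpha)

lemma orbit_simps [simp]:
  "\<chi> \<in> orbit \<chi>" "bar_type \<chi> \<in> orbit \<chi>" "neg_type \<chi> \<in> orbit \<chi>" "bar_type (neg_type \<chi>) \<in> orbit \<chi>"
  by (simp_all add: orbit_def)

lemma orbit_trans: "\<chi>' \<in> orbit \<chi> \<Longrightarrow> \<chi>'' \<in> orbit \<chi>' \<Longrightarrow> \<chi>'' \<in> orbit \<chi>"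
  by (auto simp: orbit_def bar_type_def neg_type_def)

section \<open>The operators u and w on weight vectors\<close>

locale H_fmod = H_field N M l1 l2 l3 + H_mod N M l1 l2 l3 L
  for N M :: nat and l1 l2 l3 :: "'k::field_char_0" and L :: "('k free_alg set, 'b) module"
begin

text \<open>Unlike in \<open>typed\<close>, zero is allowed: images of weight vectors under a1 and
  a2 may vanish, and whether they do is decided case by case.\<close>

definition weight :: "'k \<times> 'k \<Rightarrow> 'b \<Rightarrow> bool" where
  "weight \<chi> x \<longleftrightarrow> x \<in> carrier L \<and>
     act L (gen G1) x = act L (const (fst \<chi>)) x \<and> act L (gen G2) x = act L (const (snd \<chi>)) x"

lemma weight_carrier [simp]: "weight \<chi> x \<Longrightarrow> x \<in> carrier L"
  by (simp add: weight_def)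

lemma act_const_eq_0:
  "x \<in> carrier L \<Longrightarrow> act L (const c) x = \<zero>\<^bsub>L\<^esub> \<longleftrightarrow> c = 0 \<or> x = \<zero>\<^bsub>L\<^esub>"
  using act_const_const[of x "1 / c" c] by (cases "c = 0") auto

lemma weight_A1:
  assumes "weight \<chi> x"
  shows "weight (bar_type \<chi>) (act L (gen A1) x)"
proof -
  have x: "x \<in> carrier L" using assms by simp
  then show ?thesis
    using assms by (simp add: weight_def skew_relations act_const_const act_const_commute bar_type_def)
qed

lemma weight_A2:
  assumes "weight \<chi> x"
  shows "weight (neg_type \<chi>) (act L (gen A2) x)"
proof -
  have x: "x \<in> carrier L" using assms by simp
  then show ?thesis
    using assms by (simp add: weight_def skew_relations act_const_const act_const_commute neg_type_def)
qed

lemma weight_add: "weight \<chi> x \<Longrightarrow> weight \<chi> y \<Longrightarrow> weight \<chi> (x \<oplus>\<^bsub>L\<^esub> y)"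
  by (simp add: weight_def act_add_right)

lemma weight_const: "weight \<chi> x \<Longrightarrow> weight \<chi> (act L (const c) x)"
  by (simp add: weight_def act_const_commute act_const_const mult.commute)

lemma weight_G_squared:
  assumes "weight \<chi> x"
  shows "act L (gen G1 * gen G1) x = act L (const ((fst \<chi>)\<^sup>2)) x"
    "act L (gen G2 * gen G2) x = act L (const ((snd \<chi>)\<^sup>2)) x"
    "act L (gen G1 * gen G1 * (gen G2 * gen G2)) x = act L (const ((fst \<chi>)\<^sup>2 * (snd \<chi>)\<^sup>2)) x"
  using assms
  by (simp_all add: weight_def act_mult act_const_commute act_const_const power2_eq_square mult_ac)

lemma weight_alpha:
  assumes "weight \<chi> x"
  shows "act L (gen A1) (act L (gen A1) x) = act L (const (alpha1 l1 \<chi>)) x"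
    "act L (gen A2) (act L (gen A2) x) = act L (const (alpha2 l2 \<chi>)) x"
    "act L (U2 + W2) x = act L (const (alpha3 l1 l2 l3 \<chi>)) x"
proof -
  have x: "x \<in> carrier L" using assms by simp
  note G = weight_G_squared[OF assms]
  have "act L (gen A1 * gen A1) x = act L (const l1 * (1 - const ((fst \<chi>)\<^sup>2))) x"
    unfolding power_relations(1)[OF x] by (intro act_cong_mult act_cong_diff x refl G)
  also have "const l1 * (1 - const ((fst \<chi>)\<^sup>2)) = const (alpha1 l1 \<chi>)"
    by (simp add: alpha1_def const_mult const_diff)
  finally show "act L (gen A1) (act L (gen A1) x) = act L (const (alpha1 l1 \<chi>)) x"
    by (simp add: act_mult x)
  have "act L (gen A2 * gen A2) x = act L (const l2 * (1 - const ((snd \<chi>)\<^sup>2))) x"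
    unfolding power_relations(2)[OF x] by (intro act_cong_mult act_cong_diff x refl G)
  also have "const l2 * (1 - const ((snd \<chi>)\<^sup>2)) = const (alpha2 l2 \<chi>)"
    by (simp add: alpha2_def const_mult const_diff)
  finally show "act L (gen A2) (act L (gen A2) x) = act L (const (alpha2 l2 \<chi>)) x"
    by (simp add: act_mult x)
  \<comment> \<open>The factors become scalars one at a time, beginning with the one next to x; the
    scalar is then moved to the left so that the other factor meets x.\<close>
  have "act L ((1 + gen G2 * gen G2) * (1 - gen G1 * gen G1)) x =
      act L ((1 + gen G2 * gen G2) * const (1 - (fst \<chi>)\<^sup>2)) x"
    unfolding const_diff const_1 by (intro act_cong_mult act_cong_diff x refl G)
  also have "\<dots> = act L (const (1 - (fst \<chi>)\<^sup>2) * (1 + const ((snd \<chi>)\<^sup>2))) x"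
    unfolding const_commute[symmetric] by (intro act_cong_mult act_cong_add x refl G)
  finally have *: "act L ((1 + gen G2 * gen G2) * (1 - gen G1 * gen G1)) x =
    act L (const (1 - (fst \<chi>)\<^sup>2) * (1 + const ((snd \<chi>)\<^sup>2))) x" .
  have "act L (U2 + W2) x = act L (const l3 * (1 - const ((fst \<chi>)\<^sup>2 * (snd \<chi>)\<^sup>2)) -
      const (2 * l1 * l2) * (const (1 - (fst \<chi>)\<^sup>2) * (1 + const ((snd \<chi>)\<^sup>2)))) x"
    unfolding power_relations(3)[OF x] U2_def W2_def mult.assoc[of "const (2 * l1 * l2)"]
    by (intro act_cong_diff act_cong_mult x refl G *)
  also have "const l3 * (1 - const ((fst \<chi>)\<^sup>2 * (snd \<chi>)\<^sup>2)) -
      const (2 * l1 * l2) * (const (1 - (fst \<chi>)\<^sup>2) * (1 + const ((snd \<chi>)\<^sup>2))) = const (alpha3 l1 l2 l3 \<chi>)"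
    unfolding alpha3_def const_1[symmetric] const_mult[symmetric] const_add[symmetric] const_diff[symmetric]
    by (rule arg_cong[where f = const]) (simp add: algebra_simps)
  finally show "act L (U2 + W2) x = act L (const (alpha3 l1 l2 l3 \<chi>)) x" .
qed

text \<open>Both sides are the same word, a2 a1 a2 a1 a2 and a1 a2 a1 a2 a1 respectively, bracketed
  differently.\<close>

lemma U2_W2_intertwine:
  "x \<in> carrier L \<Longrightarrow> act L (gen A2) (act L U2 x) = act L W2 (act L (gen A2) x)"
  "x \<in> carrier L \<Longrightarrow> act L (gen A1) (act L W2 x) = act L U2 (act L (gen A1) x)"
  by (simp_all add: U2_def W2_def act_mult)

lemma weight_W2:
  assumes "weight \<chi> x"
  shows "weight \<chi> (act L W2 x)"
  using weight_A2[OF weight_A1[OF weight_A2[OF weight_A1[OF assms]]]] assms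
  by (simp add: W2_def act_mult)

text \<open>In a1 a2 a1 a2 a2 a1 a2 a1 the two equal letters in the middle collapse to a scalar, and
  so on outwards. All intermediate vectors are weight vectors in one orbit, so the scalars are
  always those of \<chi>.\<close>

lemma U2_W2:
  assumes "weight \<chi> x"
  shows "act L U2 (act L W2 x) = act L (const ((alpha1 l1 \<chi> * alpha2 l2 \<chi>)\<^sup>2)) x"
proof -
  have x: "x \<in> carrier L" using assms by simp
  note w1 = weight_A1[OF assms]
  note w2 = weight_A2[OF w1]
  note w3 = weight_A1[OF w2]
  have "act L U2 (act L W2 x) =
      act L (gen A1) (act L (gen A2) (act L (gen A1) (act L (gen A2) (act L (gen A2)
        (act L (gen A1) (act L (gen A2) (act L (gen A1) x)))))))"
    by (simp add: U2_def W2_def act_mult x)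
  also have "\<dots> = act L (const ((alpha1 l1 \<chi> * alpha2 l2 \<chi>)\<^sup>2)) x"
    by (simp add: weight_alpha[OF w3] weight_alpha[OF w2] weight_alpha[OF w1] weight_alpha[OF assms]
      act_const_commute act_const_const x power2_eq_square mult_ac)
  finally show ?thesis .
qed

lemma U2_eq:
  assumes "weight \<chi> x"
  shows "act L U2 x = act L (const (alpha3 l1 l2 l3 \<chi>) - W2) x"
    and "act L W2 x = act L (const (alpha3 l1 l2 l3 \<chi>) - U2) x"
  using act_cong_diff[OF weight_carrier[OF assms] weight_alpha(3)[OF assms] refl, of W2]
    act_cong_diff[OF weight_carrier[OF assms] weight_alpha(3)[OF assms] refl, of U2] by simp_all

text \<open>Since u = \<alpha>3 - w on weight vectors, uw = cc' gives (w - c)(w - c') x = 0. The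
  resulting eigenvector may be zero, which is the case to be treated separately in
  \<open>classify_O4\<close>.\<close>

lemma W2_quadratic:
  assumes "weight \<chi> x" "c + c' = alpha3 l1 l2 l3 \<chi>" "c * c' = (alpha1 l1 \<chi> * alpha2 l2 \<chi>)\<^sup>2"
  shows "eigen L W2 c (act L (W2 - const c') x)"
proof -
  have x: "x \<in> carrier L" using assms by simp
  have "act L (W2 * W2) x = act L ((const (c + c') - U2) * W2) x"
    using U2_eq(2)[OF weight_W2[OF assms(1)]] assms(2) x by (simp add: act_mult)
  also have "\<dots> = act L (const (c + c') * W2 - const (c * c')) x"
    unfolding left_diff_distrib using x U2_W2[OF assms(1)] assms(3)
    by (intro act_cong_diff x refl) (simp add: act_mult)
  finally have "act L (W2 * W2 - W2 * const c') x = act L (const (c + c') * W2 - const (c * c') - W2 * const c') x"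
    by (intro act_cong_diff x refl)
  moreover have "const (c + c') * W2 - const (c * c') - W2 * const c' = const c * (W2 - const c')"
    by (simp add: const_add const_mult const_commute[of c' W2] algebra_simps)
  moreover have "W2 * W2 - W2 * const c' = W2 * (W2 - const c')" by (simp add: algebra_simps)
  ultimately show ?thesis using x by (simp add: eigen_def act_mult)
qed

text \<open>On x the relation for the power 2N of g1 reads \<chi>1^(2N) x = x, and x is nonzero;
  likewise for g2.\<close>

lemma weight_O_all:
  assumes "weight \<chi> x" "x \<noteq> \<zero>\<^bsub>L\<^esub>"
  shows "\<chi> \<in> O_all N M"
proof -
  have x: "x \<in> carrier L" using assms by simp
  have pow: "act L (gen g ^ k) x = act L (const (a ^ k)) x" if "act L (gen g) x = act L (const a) x" for g a k
    using that x
    by (induction k) (simp_all add: act_mult act_const_commute act_const_const mult.commute)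
  have "act L (const (a - 1)) x = \<zero>\<^bsub>L\<^esub>" if "act L (const a) x = x" for a
    using act_eq_iff[OF x, of "const a" 1] that x by (simp add: const_diff)
  then have one: "a = 1" if "act L (const a) x = x" for a
    using that act_const_eq_0[OF x, of "a - 1"] assms(2) by simp
  show ?thesis
    using assms(1) pow[of G1 "fst \<chi>" "2 * N"] pow[of G2 "snd \<chi>" "2 * M"] group_relations[OF x]
    by (auto simp: O_all_def roots_1_def mem_Times_iff weight_def intro!: one)
qed

section \<open>Recognising a model from one weight vector\<close>

lemma L1I:
  assumes "simple_module HH L" "weight \<chi> x" "x \<noteq> \<zero>\<^bsub>L\<^esub>" "\<chi> \<in> OO1"
    "act L (gen A1) x = \<zero>\<^bsub>L\<^esub>" "act L (gen A2) x = \<zero>\<^bsub>L\<^esub>"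
  shows "iso_modules HH L (L1 \<chi>)"
  unfolding L1_def
proof (rule iso_rep_moduleI[where q = "\<lambda>_. 1" and x = x and ?i0.0 = 0])
  show "rep_H N M l1 l2 l3 1 (L1_op \<chi>)" by (rule rep_L1_H) fact
  show "simple_module HH (rep_module 1 (L1_op \<chi>))" using simple_L1 assms(4) by (simp add: L1_def)
  show "act L (gen g * 1) x = act L (\<Sum>i<1. const (L1_op \<chi> g $$ (i, j)) * 1) x" if "j < 1" for g j
    using that assms by (cases g) (simp_all add: L1_op.simps mat_of_cols_def weight_def)
qed (use assms in auto)

text \<open>The basis is x and a1 x. The vanishing of a2 on both, together with a1 a1 x = \<alpha>1
  x, gives all the matrix entries.\<close>

lemma L2hI:
  assumes "simple_module HH L" "weight \<chi> x" "x \<noteq> \<zero>\<^bsub>L\<^esub>" "\<chi> \<in> OO2" "alpha1 l1 \<chi> \<noteq> 0"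
    "act L (gen A2) x = \<zero>\<^bsub>L\<^esub>" "act L (gen A2) (act L (gen A1) x) = \<zero>\<^bsub>L\<^esub>"
  shows "iso_modules HH L (L2h l1 \<chi>)"
  unfolding L2h_def
proof (rule iso_rep_moduleI[where q = "\<lambda>i. [1, gen A1] ! i" and x = x and ?i0.0 = 0])
  show "rep_H N M l1 l2 l3 2 (L2h_op l1 \<chi>)" using assms by (intro rep_L2h_H)
  show "simple_module HH (rep_module 2 (L2h_op l1 \<chi>))" using simple_L2h assms by (simp add: L2h_def)
  note w1 = weight_A1[OF assms(2)]
  fix g j assume "j < (2::nat)"
  then have "j = 0 \<or> j = 1" by linarith
  then show "act L (gen g * [1, gen A1] ! j) x =
      act L (\<Sum>i<2. const (L2h_op l1 \<chi> g $$ (i, j)) * [1, gen A1] ! i) x"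
    using assms w1 weight_alpha[OF assms(2)]
    by (cases g) (auto simp: L2h_op.simps mat_of_cols_def weight_def numeral_eq_Suc act_mult)
qed (use assms in auto)

lemma L2vI:
  assumes "simple_module HH L" "weight \<chi> x" "x \<noteq> \<zero>\<^bsub>L\<^esub>" "\<chi> \<in> OO2" "alpha2 l2 \<chi> \<noteq> 0"
    "act L (gen A1) x = \<zero>\<^bsub>L\<^esub>" "act L (gen A1) (act L (gen A2) x) = \<zero>\<^bsub>L\<^esub>"
  shows "iso_modules HH L (L2v l2 \<chi>)"
  unfolding L2v_def
proof (rule iso_rep_moduleI[where q = "\<lambda>i. [1, gen A2] ! i" and x = x and ?i0.0 = 0])
  show "rep_H N M l1 l2 l3 2 (L2v_op l2 \<chi>)" using assms by (intro rep_L2v_H)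
  show "simple_module HH (rep_module 2 (L2v_op l2 \<chi>))" using simple_L2v assms by (simp add: L2v_def)
  note w1 = weight_A2[OF assms(2)]
  fix g j assume "j < (2::nat)"
  then have "j = 0 \<or> j = 1" by linarith
  then show "act L (gen g * [1, gen A2] ! j) x =
      act L (\<Sum>i<2. const (L2v_op l2 \<chi> g $$ (i, j)) * [1, gen A2] ! i) x"
    using assms w1 weight_alpha[OF assms(2)]
    by (cases g) (auto simp: L2v_op.simps mat_of_cols_def weight_def numeral_eq_Suc act_mult)
qed (use assms in auto)

text \<open>The vector a1 x is nonzero because \<alpha>1 \<noteq> 0 and satisfies the same
  conditions with type \<open>bar_type \<chi>\<close>. This is why a list may contain only one type
  of each pair.\<close>

lemma L2hI_bar:
  assumes "simple_module HH L" "weight \<chi> x" "x \<noteq> \<zero>\<^bsub>L\<^esub>" "\<chi> \<in> OO2" "alpha1 l1 \<chi> \<noteq> 0"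
    "act L (gen A2) x = \<zero>\<^bsub>L\<^esub>" "act L (gen A2) (act L (gen A1) x) = \<zero>\<^bsub>L\<^esub>"
  shows "iso_modules HH L (L2h l1 (bar_type \<chi>))"
proof (rule L2hI[OF assms(1) weight_A1[OF assms(2)]])
  note a = weight_alpha(1)[OF assms(2)]
  show "act L (gen A1) x \<noteq> \<zero>\<^bsub>L\<^esub>"
    using a act_const_eq_0[of x "alpha1 l1 \<chi>"] assms by auto
  show "act L (gen A2) (act L (gen A1) (act L (gen A1) x)) = \<zero>\<^bsub>L\<^esub>"
    using a assms by (simp add: act_const_commute)
qed (use assms orbit_O(2)[of "bar_type \<chi>" \<chi>] in simp_all)

lemma L2vI_neg:
  assumes "simple_module HH L" "weight \<chi> x" "x \<noteq> \<zero>\<^bsub>L\<^esub>" "\<chi> \<in> OO2" "alpha2 l2 \<chi> \<noteq> 0"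
    "act L (gen A1) x = \<zero>\<^bsub>L\<^esub>" "act L (gen A1) (act L (gen A2) x) = \<zero>\<^bsub>L\<^esub>"
  shows "iso_modules HH L (L2v l2 (neg_type \<chi>))"
proof (rule L2vI[OF assms(1) weight_A2[OF assms(2)]])
  note a = weight_alpha(2)[OF assms(2)]
  show "act L (gen A2) x \<noteq> \<zero>\<^bsub>L\<^esub>"
    using a act_const_eq_0[of x "alpha2 l2 \<chi>"] assms by auto
  show "act L (gen A1) (act L (gen A2) (act L (gen A2) x)) = \<zero>\<^bsub>L\<^esub>"
    using a assms by (simp add: act_const_commute)
qed (use assms orbit_O(2)[of "neg_type \<chi>" \<chi>] in simp_all)

text \<open>The basis is x, a1 x, a2 a1 x, a1 a2 a1 x. The eigenvalue of w gives the image of the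
  last vector under a2; the image of x under a2 has to be derived.\<close>

lemma L4I:
  assumes "simple_module HH L" "weight \<chi> x" "x \<noteq> \<zero>\<^bsub>L\<^esub>" "\<chi> \<in> OO4" "L4_eq l1 l2 l3 \<chi> d"
    and e: "eigen L W2 (L4c \<chi> d) x"
  shows "iso_modules HH L (L4 l1 l2 l3 \<chi> d)"
  unfolding L4_def
proof (rule iso_rep_moduleI[where q = "\<lambda>i. [1, gen A1, gen A2 * gen A1, gen A1 * gen A2 * gen A1] ! i"
      and x = x and ?i0.0 = 0])
  show "rep_H N M l1 l2 l3 4 (L4_op l1 l2 l3 \<chi> d)" using assms by (intro rep_L4_H)
  show "simple_module HH (rep_module 4 (L4_op l1 l2 l3 \<chi> d))" using simple_L4 assms by (simp add: L4_def)
  have x: "x \<in> carrier L" using assms by simp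
  define c where "c = L4c \<chi> d"
  have c: "c \<noteq> 0" "c * d = alpha2 l2 \<chi>" using assms L4c_nz L4c_mult by (auto simp: c_def)
  note w1 = weight_A1[OF assms(2)]
  note w2 = weight_A2[OF w1]
  note w3 = weight_A1[OF w2]
  note al = weight_alpha(1)[OF w2] weight_alpha(2)[OF w1] weight_alpha(1)[OF assms(2)]
  have W: "act L (gen A2) (act L (gen A1) (act L (gen A2) (act L (gen A1) x))) = act L (const c) x"
    using e x by (simp add: eigen_def W2_def act_mult c_def)
  \<comment> \<open>Applying a2 to w x = c x and using a2^2 = \<alpha>2 = cd on the fourth basis
    vector gives c a2 x = cd v4; cancelling c \<noteq> 0 yields a2 x = d v4.\<close>
  have "act L (const c) (act L (gen A2) x) =
      act L (gen A2) (act L (gen A2) (act L (gen A1) (act L (gen A2) (act L (gen A1) x))))"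
    by (simp add: W act_const_commute x)
  also have "\<dots> = act L (const (c * d)) (act L (gen A1) (act L (gen A2) (act L (gen A1) x)))"
    by (simp add: weight_alpha[OF w3] c)
  finally have "act L (const (1 / c)) (act L (const c) (act L (gen A2) x)) =
      act L (const (1 / c)) (act L (const (c * d)) (act L (gen A1) (act L (gen A2) (act L (gen A1) x))))"
    by simp
  then have D: "act L (gen A2) x = act L (const d) (act L (gen A1) (act L (gen A2) (act L (gen A1) x)))"
    using c(1) x by (simp add: act_const_const)
  have sum4: "(\<Sum>i<4. f i) = f 0 + f 1 + f 2 + f 3" for f :: "nat \<Rightarrow> 'k free_alg"
    by (simp add: numeral_eq_Suc)
  fix g j assume "j < (4::nat)"
  then have "j = 0 \<or> j = 1 \<or> j = 2 \<or> j = 3" by linarith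
  then show "act L (gen g * [1, gen A1, gen A2 * gen A1, gen A1 * gen A2 * gen A1] ! j) x =
      act L (\<Sum>i<4. const (L4_op l1 l2 l3 \<chi> d g $$ (i, j)) *
        [1, gen A1, gen A2 * gen A1, gen A1 * gen A2 * gen A1] ! i) x"
  proof (cases g)
    case G1
    with \<open>j = 0 \<or> _\<close> show ?thesis
      using assms(2) w1 w2 w3
      by (elim disjE) (simp_all add: L4_op.simps mat_of_cols_def weight_def sum4 act_mult x)
  next
    case G2
    with \<open>j = 0 \<or> _\<close> show ?thesis
      using assms(2) w1 w2 w3
      by (elim disjE) (simp_all add: L4_op.simps mat_of_cols_def weight_def sum4 act_mult x)
  next
    case A1
    with \<open>j = 0 \<or> _\<close> show ?thesis
      using al(1,3)
      by (elim disjE) (simp_all add: L4_op.simps mat_of_cols_def sum4 act_mult x)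
  next
    case A2
    with \<open>j = 0 \<or> _\<close> show ?thesis
      using al(2) W D
      by (elim disjE) (simp_all add: L4_op.simps mat_of_cols_def sum4 act_mult x c_def)
  qed
qed (use assms in auto)

text \<open>a2 a1 x is a further eigenvector of w for c, nonzero since applying a2 a1 again gives c
  x. For a double root also a1 x is one: it has eigenvalue c for u, hence \<alpha>3 - c = c for
  w.\<close>

lemma L4I_sim:
  assumes "simple_module HH L" "weight \<chi> x" "x \<noteq> \<zero>\<^bsub>L\<^esub>" "\<chi> \<in> OO4" "L4_eq l1 l2 l3 \<chi> d"
    and e: "eigen L W2 (L4c \<chi> d) x"
    and sim: "(\<chi>, \<chi>') \<in> sim'"
  shows "iso_modules HH L (L4 l1 l2 l3 \<chi>' d)"
proof -
  define c where "c = L4c \<chi> d"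
  have c: "c \<noteq> 0" "c * d = alpha2 l2 \<chi>" using assms L4c_nz L4c_mult by (auto simp: c_def)
  have iso: "iso_modules HH L (L4 l1 l2 l3 \<chi>'' d)"
    if "\<chi>'' \<in> orbit \<chi>" "weight \<chi>'' y" "y \<noteq> \<zero>\<^bsub>L\<^esub>" "eigen L W2 c y" for \<chi>'' y
    using that assms by (intro L4I[OF assms(1)]) (simp_all add: orbit_O orbit_alpha orbit_L4_eq c_def)
  have neg_bar: "weight (neg_type (bar_type \<chi>'')) (act L (gen A2) (act L (gen A1) y)) \<and>
      act L (gen A2) (act L (gen A1) y) \<noteq> \<zero>\<^bsub>L\<^esub> \<and> eigen L W2 c (act L (gen A2) (act L (gen A1) y))"
    if "weight \<chi>'' y" "y \<noteq> \<zero>\<^bsub>L\<^esub>" "eigen L W2 c y" for \<chi>'' y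
  proof (intro conjI)
    have y: "y \<in> carrier L" using that by simp
    have W: "act L (gen A2) (act L (gen A1) (act L (gen A2) (act L (gen A1) y))) = act L (const c) y"
      using that(3) y by (simp add: eigen_def W2_def act_mult)
    show "weight (neg_type (bar_type \<chi>'')) (act L (gen A2) (act L (gen A1) y))"
      by (rule weight_A2[OF weight_A1[OF that(1)]])
    show "act L (gen A2) (act L (gen A1) y) \<noteq> \<zero>\<^bsub>L\<^esub>"
      using W act_const_eq_0[OF y, of c] c that(2) by auto
    show "eigen L W2 c (act L (gen A2) (act L (gen A1) y))"
      using W by (simp add: eigen_def W2_def act_mult y act_const_commute)
  qed
  have x: "x \<in> carrier L" using assms(2) by simp
  have e': "eigen L W2 c x" using e by (simp add: c_def)
  consider "\<chi>' = \<chi>" | "\<chi>' = neg_type (bar_type \<chi>)"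
    | "\<chi> \<in> DD" "\<chi>' = bar_type \<chi> \<or> \<chi>' = neg_type \<chi>"
    using sim by (auto simp: type_sim'_def type_sim_def)
  then show ?thesis
  proof cases
    case 1
    then show ?thesis using iso[of \<chi>] assms(2,3) e' by simp
  next
    case 2
    then show ?thesis using iso[of \<chi>'] neg_bar[OF assms(2,3) e'] by (auto simp del: bar_bar(3)) (simp add: orbit_def)
  next
    case 3
    \<comment> \<open>The square of the difference of the two roots c and \<alpha>3 - c is the
      discriminant, which vanishes on \<open>DD\<close>.\<close>
    have "(alpha3 l1 l2 l3 \<chi> - 2 * c)\<^sup>2 = 0"
    proof -
      define a b t where "a = (alpha1 l1 \<chi>)\<^sup>2" and "b = alpha2 l2 \<chi>" and "t = alpha3 l1 l2 l3 \<chi>"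
      have "t\<^sup>2 - 4 * (a * b) * b = 0" "c = t - a * b * d" "c * d = b"
        using 3(1) c(2) by (simp_all add: O4_double_def a_def b_def t_def c_def)
      then have "(t - 2 * c)\<^sup>2 = 0" by Groebner_Basis.algebra
      then show ?thesis by (simp add: t_def)
    qed
    then have a3: "alpha3 l1 l2 l3 \<chi> = c + c" by simp
    let ?y = "act L (gen A1) x"
    have y: "weight (bar_type \<chi>) ?y" by (rule weight_A1[OF assms(2)])
    have "act L U2 ?y = act L (const c) ?y"
      using U2_W2_intertwine(2)[OF x] e' by (simp add: eigen_def act_const_commute x)
    then have "act L W2 ?y = act L (const (c + c) - const c) ?y"
      using a3 unfolding U2_eq(2)[OF y] by (intro act_cong_diff) (simp_all add: x)
    then have ey: "eigen L W2 c ?y" by (simp only: eigen_def const_add add_diff_cancel_right')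
    have ny: "?y \<noteq> \<zero>\<^bsub>L\<^esub>"
    proof
      assume "?y = \<zero>\<^bsub>L\<^esub>"
      then have "act L W2 x = \<zero>\<^bsub>L\<^esub>" by (simp add: W2_def act_mult x)
      then show False using e' act_const_eq_0[OF x, of c] c(1) assms(3) by (simp add: eigen_def)
    qed
    from 3(2) show ?thesis
      using iso[of "bar_type \<chi>", OF _ y ny ey] neg_bar[OF y ny ey] iso[of "neg_type \<chi>"] by auto
  qed
qed

section \<open>Locating a simple module by the orbit of its types\<close>

lemma kernel_A1:
  assumes "weight \<chi> x" "x \<noteq> \<zero>\<^bsub>L\<^esub>" "alpha1 l1 \<chi> = 0"
  obtains \<chi>' y where "\<chi>' \<in> orbit \<chi>" "weight \<chi>' y" "y \<noteq> \<zero>\<^bsub>L\<^esub>" "act L (gen A1) y = \<zero>\<^bsub>L\<^esub>"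
  \<comment> \<open>Either a1 x = 0 and x will do, or a1 x will, since a1 a1 x = \<alpha>1 x =
    0.\<close>
  using that[of \<chi> x] that[of "bar_type \<chi>" "act L (gen A1) x"] assms weight_A1[OF assms(1)]
    weight_alpha(1)[OF assms(1)] by auto

lemma kernel_A2:
  assumes "weight \<chi> x" "x \<noteq> \<zero>\<^bsub>L\<^esub>" "alpha2 l2 \<chi> = 0"
  obtains \<chi>' y where "\<chi>' \<in> orbit \<chi>" "weight \<chi>' y" "y \<noteq> \<zero>\<^bsub>L\<^esub>" "act L (gen A2) y = \<zero>\<^bsub>L\<^esub>"
  using that[of \<chi> x] that[of "neg_type \<chi>" "act L (gen A2) x"] assms weight_A2[OF assms(1)]
    weight_alpha(2)[OF assms(1)] by auto

lemma U2_eq_0: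
  assumes "weight \<chi> x" "alpha3 l1 l2 l3 \<chi> = 0"
  shows "act L W2 x = \<zero>\<^bsub>L\<^esub> \<Longrightarrow> act L U2 x = \<zero>\<^bsub>L\<^esub>"
    and "act L U2 x = \<zero>\<^bsub>L\<^esub> \<Longrightarrow> act L W2 x = \<zero>\<^bsub>L\<^esub>"
proof -
  have x: "x \<in> carrier L" using assms(1) by simp
  have U: "act L U2 x = \<ominus>\<^bsub>L\<^esub> act L W2 x" and W: "act L W2 x = \<ominus>\<^bsub>L\<^esub> act L U2 x"
    using U2_eq[OF assms(1)] assms(2) act_uminus[OF x, of W2] act_uminus[OF x, of U2] by simp_all
  show "act L W2 x = \<zero>\<^bsub>L\<^esub> \<Longrightarrow> act L U2 x = \<zero>\<^bsub>L\<^esub>" unfolding U by simp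
  show "act L U2 x = \<zero>\<^bsub>L\<^esub> \<Longrightarrow> act L W2 x = \<zero>\<^bsub>L\<^esub>" unfolding W by simp
qed

text \<open>Let a1 y = 0. Then w y = 0, hence u y = 0, and the last nonzero vector in the chain y,
  a2 y, a1 a2 y, a2 a1 a2 y is killed by both a1 and a2.\<close>

lemma classify_O1:
  assumes "simple_module HH L" "weight \<chi> x" "x \<noteq> \<zero>\<^bsub>L\<^esub>" "\<chi> \<in> OO1"
  shows "\<exists>\<chi>'\<in>orbit \<chi>. iso_modules HH L (L1 \<chi>')"
proof -
  have \<alpha>: "alpha1 l1 \<chi> = 0" "alpha2 l2 \<chi> = 0" "alpha3 l1 l2 l3 \<chi> = 0"
    using assms(4) by (auto simp: O1_def)
  obtain \<chi>' y where y: "\<chi>' \<in> orbit \<chi>" "weight \<chi>' y" "y \<noteq> \<zero>\<^bsub>L\<^esub>" "act L (gen A1) y = \<zero>\<^bsub>L\<^esub>"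
    using kernel_A1 assms \<alpha> by metis
  note \<alpha>' = orbit_alpha[OF y(1)]
  define u where "u = act L (gen A2) y"
  define t where "t = act L (gen A1) u"
  define s where "s = act L (gen A2) t"
  have wu: "weight (neg_type \<chi>') u" using weight_A2[OF y(2)] by (simp add: u_def)
  have wt: "weight (bar_type (neg_type \<chi>')) t" using weight_A1[OF wu] by (simp add: t_def)
  have ws: "weight (bar_type \<chi>') s" using weight_A2[OF wt] by (simp add: s_def flip: bar_bar(3))
  have "act L U2 y = \<zero>\<^bsub>L\<^esub>"
    using y(2,4) \<alpha> \<alpha>' by (intro U2_eq_0(1)[OF y(2)]) (simp_all add: W2_def act_mult)
  then have z: "act L (gen A2) u = \<zero>\<^bsub>L\<^esub>" "act L (gen A1) t = \<zero>\<^bsub>L\<^esub>"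
    "act L (gen A2) s = \<zero>\<^bsub>L\<^esub>" "act L (gen A1) s = \<zero>\<^bsub>L\<^esub>"
    using weight_alpha(2)[OF y(2)] weight_alpha(1)[OF wu] weight_alpha(2)[OF wt] \<alpha> \<alpha>' wu wt ws y(2)
    by (simp_all add: u_def t_def s_def U2_def act_mult)
  have L1: "\<exists>\<chi>'\<in>orbit \<chi>. iso_modules HH L (L1 \<chi>')"
    if "weight \<chi>'' v" "v \<noteq> \<zero>\<^bsub>L\<^esub>" "\<chi>'' \<in> orbit \<chi>'" "act L (gen A1) v = \<zero>\<^bsub>L\<^esub>" "act L (gen A2) v = \<zero>\<^bsub>L\<^esub>" for \<chi>'' v
    using L1I[OF assms(1) that(1,2) _ that(4,5)] orbit_trans[OF y(1) that(3)] orbit_O(1) assms(4) by blast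
  show ?thesis
    using L1[OF y(2)] L1[OF wu] L1[OF wt] L1[OF ws] y z by (auto simp: u_def[symmetric] t_def[symmetric] s_def[symmetric])
qed

text \<open>Let a2 y = 0. Then u y = 0, hence w y = 0. If a2 a1 y = 0, then y generates the model;
  otherwise a2 a1 y does, because a2 a1 maps it to w y = 0.\<close>

lemma classify_O2h:
  assumes "simple_module HH L" "weight \<chi> x" "x \<noteq> \<zero>\<^bsub>L\<^esub>" "\<chi> \<in> OO2" "alpha1 l1 \<chi> \<noteq> 0"
  shows "\<exists>\<chi>'\<in>orbit \<chi>. iso_modules HH L (L2h l1 \<chi>') \<and> iso_modules HH L (L2h l1 (bar_type \<chi>'))"
proof -
  have \<alpha>: "alpha2 l2 \<chi> = 0" "alpha3 l1 l2 l3 \<chi> = 0"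
    using assms(4,5) by (auto simp: O2_def)
  obtain \<chi>' y where y: "\<chi>' \<in> orbit \<chi>" "weight \<chi>' y" "y \<noteq> \<zero>\<^bsub>L\<^esub>" "act L (gen A2) y = \<zero>\<^bsub>L\<^esub>"
    using kernel_A2 assms \<alpha> by metis
  note \<alpha>' = orbit_alpha[OF y(1)]
  define w where "w = act L (gen A2) (act L (gen A1) y)"
  have ww: "weight (bar_type (neg_type \<chi>')) w"
    using weight_A2[OF weight_A1[OF y(2)]] by (simp add: w_def)
  have "act L W2 y = \<zero>\<^bsub>L\<^esub>"
    using y(2,4) \<alpha> \<alpha>' by (intro U2_eq_0(2)[OF y(2)]) (simp_all add: U2_def act_mult)
  then have z: "act L (gen A2) w = \<zero>\<^bsub>L\<^esub>" "act L (gen A2) (act L (gen A1) w) = \<zero>\<^bsub>L\<^esub>"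
    using weight_alpha(2)[OF weight_A1[OF y(2)]] y(2) \<alpha> \<alpha>' by (simp_all add: w_def W2_def act_mult)
  have L2: "\<exists>\<chi>'\<in>orbit \<chi>. iso_modules HH L (L2h l1 \<chi>') \<and> iso_modules HH L (L2h l1 (bar_type \<chi>'))"
    if "weight \<chi>'' v" "v \<noteq> \<zero>\<^bsub>L\<^esub>" "\<chi>'' \<in> orbit \<chi>'" "act L (gen A2) v = \<zero>\<^bsub>L\<^esub>"
      "act L (gen A2) (act L (gen A1) v) = \<zero>\<^bsub>L\<^esub>" for \<chi>'' v
    using L2hI[OF assms(1) that(1,2) _ _ that(4,5)] L2hI_bar[OF assms(1) that(1,2) _ _ that(4,5)] orbit_trans[OF y(1) that(3)] orbit_O(2) orbit_alpha(1) assms(4,5)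
    by metis
  show ?thesis
    using L2[OF y(2)] L2[OF ww] y z by (auto simp: w_def[symmetric])
qed

lemma classify_O2v:
  assumes "simple_module HH L" "weight \<chi> x" "x \<noteq> \<zero>\<^bsub>L\<^esub>" "\<chi> \<in> OO2" "alpha2 l2 \<chi> \<noteq> 0"
  shows "\<exists>\<chi>'\<in>orbit \<chi>. iso_modules HH L (L2v l2 \<chi>') \<and> iso_modules HH L (L2v l2 (neg_type \<chi>'))"
proof -
  have \<alpha>: "alpha1 l1 \<chi> = 0" "alpha3 l1 l2 l3 \<chi> = 0"
    using assms(4,5) by (auto simp: O2_def)
  obtain \<chi>' y where y: "\<chi>' \<in> orbit \<chi>" "weight \<chi>' y" "y \<noteq> \<zero>\<^bsub>L\<^esub>" "act L (gen A1) y = \<zero>\<^bsub>L\<^esub>"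
    using kernel_A1 assms \<alpha> by metis
  note \<alpha>' = orbit_alpha[OF y(1)]
  define w where "w = act L (gen A1) (act L (gen A2) y)"
  have ww: "weight (bar_type (neg_type \<chi>')) w"
    using weight_A1[OF weight_A2[OF y(2)]] by (simp add: w_def)
  have "act L U2 y = \<zero>\<^bsub>L\<^esub>"
    using y(2,4) \<alpha> \<alpha>' by (intro U2_eq_0(1)[OF y(2)]) (simp_all add: W2_def act_mult)
  then have z: "act L (gen A1) w = \<zero>\<^bsub>L\<^esub>" "act L (gen A1) (act L (gen A2) w) = \<zero>\<^bsub>L\<^esub>"
    using weight_alpha(1)[OF weight_A2[OF y(2)]] y(2) \<alpha> \<alpha>' by (simp_all add: w_def U2_def act_mult)
  have L2: "\<exists>\<chi>'\<in>orbit \<chi>. iso_modules HH L (L2v l2 \<chi>') \<and> iso_modules HH L (L2v l2 (neg_type \<chi>'))"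
    if "weight \<chi>'' v" "v \<noteq> \<zero>\<^bsub>L\<^esub>" "\<chi>'' \<in> orbit \<chi>'" "act L (gen A1) v = \<zero>\<^bsub>L\<^esub>"
      "act L (gen A1) (act L (gen A2) v) = \<zero>\<^bsub>L\<^esub>" for \<chi>'' v
    using L2vI[OF assms(1) that(1,2) _ _ that(4,5)] L2vI_neg[OF assms(1) that(1,2) _ _ that(4,5)] orbit_trans[OF y(1) that(3)] orbit_O(2) orbit_alpha(2) assms(4,5)
    by metis
  show ?thesis
    using L2[OF y(2)] L2[OF ww] y z by (auto simp: w_def[symmetric])
qed

text \<open>The conclusion covers the whole class of \<chi>' because a transversal may have picked
  any of its members, and d is prescribed in advance: only the type, never d, is adapted to the
  module.\<close>

lemma classify_O4:
  assumes "simple_module HH L" "weight \<chi> x" "x \<noteq> \<zero>\<^bsub>L\<^esub>" "\<chi> \<in> OO4" "L4_eq l1 l2 l3 \<chi> d"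
  shows "\<exists>\<chi>'\<in>orbit \<chi>. \<forall>\<chi>''. (\<chi>', \<chi>'') \<in> sim' \<longrightarrow>
    iso_modules HH L (L4 l1 l2 l3 \<chi>'' d)"
proof -
  have x: "x \<in> carrier L" using assms by simp
  define c c' where "c = L4c \<chi> d" and "c' = (alpha1 l1 \<chi>)\<^sup>2 * alpha2 l2 \<chi> * d"
  have c: "c \<noteq> 0" "c * d = alpha2 l2 \<chi>" "c + c' = alpha3 l1 l2 l3 \<chi>"
    using assms L4c_nz L4c_mult by (auto simp: c_def c'_def)
  have cc': "c * c' = (alpha1 l1 \<chi> * alpha2 l2 \<chi>)\<^sup>2"
    using c(2) by (simp add: c'_def power2_eq_square mult_ac)
  have iso: ?thesis
    if "\<chi>' \<in> orbit \<chi>" "weight \<chi>' y" "y \<noteq> \<zero>\<^bsub>L\<^esub>" "eigen L W2 c y" for \<chi>' y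
  proof (intro bexI[OF _ that(1)] allI impI)
    fix \<chi>'' assume "(\<chi>', \<chi>'') \<in> sim'"
    with that assms show "iso_modules HH L (L4 l1 l2 l3 \<chi>'' d)"
      by (intro L4I_sim[OF assms(1) that(2,3)]) (simp_all add: orbit_O orbit_alpha orbit_L4_eq c_def)
  qed
  show ?thesis
  proof (cases "act L (W2 - const c') x = \<zero>\<^bsub>L\<^esub>")
    case False
    have "act L (W2 - const c') x = act L W2 x \<oplus>\<^bsub>L\<^esub> act L (const (- c')) x"
      using act_add[OF x, of W2 "const (- c')"] by (simp add: const_uminus)
    then have "weight \<chi> (act L (W2 - const c') x)"
      using weight_add[OF weight_W2 weight_const] assms(2) by simp
    with False W2_quadratic[OF assms(2) c(3) cc'] iso[of \<chi>] show ?thesis by force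
  next
    case True
    then have W: "act L W2 x = act L (const c') x" using act_eq_iff[OF x] by simp
    have "act L U2 x = act L (const (c + c') - const c') x"
      unfolding U2_eq(1)[OF assms(2)] c(3) by (intro act_cong_diff x refl W)
    then have U: "act L U2 x = act L (const c) x" by (simp add: const_add)
    let ?y = "act L (gen A2) x"
    have "act L W2 ?y = act L (const c) ?y"
      using U2_W2_intertwine(1)[OF x] U by (simp add: act_const_commute x)
    moreover have "?y \<noteq> \<zero>\<^bsub>L\<^esub>"
    proof
      assume "?y = \<zero>\<^bsub>L\<^esub>"
      then have "act L U2 x = \<zero>\<^bsub>L\<^esub>" by (simp add: U2_def act_mult x)
      then show False using U act_const_eq_0[OF x, of c] c(1) assms(3) by simp
    qed
    ultimately show ?thesis
      using iso[of "neg_type \<chi>" ?y] weight_A2[OF assms(2)] by (auto simp: eigen_def)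
  qed
qed

text \<open>\<open>e j\<close> is n times the projection onto the eigenspace of g for z^j. The e j
  add up to n, which is invertible, so some e j does not kill x. The result is recorded as a
  polynomial in g so that it commutes with whatever commutes with g.\<close>

lemma eigenvector_exists:
  fixes z :: 'k
  assumes z: "primitive_root_of_unity n z" and x: "x \<in> carrier L" "x \<noteq> \<zero>\<^bsub>L\<^esub>" "act L (gen g ^ n) x = x"
  obtains a b e where "e = (\<Sum>i<n. const (b i) * gen g ^ i)" "act L e x \<noteq> \<zero>\<^bsub>L\<^esub>"
    "act L (gen g) (act L e x) = act L (const a) (act L e x)"
proof -
  have n: "n > 0" "z ^ n = 1" "\<And>k. 0 < k \<Longrightarrow> k < n \<Longrightarrow> z ^ k \<noteq> 1"
    using z by (auto simp: primitive_root_of_unity_def)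
  \<comment> \<open>The exponent n - i stands for -i, which is the same modulo n once multiplied by
    j.\<close>
  define e where "e j = (\<Sum>i<n. const (z ^ (j * (n - i))) * gen g ^ i)" for j
  have const_sum: "const (sum h A) = (\<Sum>a\<in>A. const (h a))" for h :: "nat \<Rightarrow> 'k" and A
    by (induction A rule: infinite_finite_induct) (simp_all add: const_add)
  have roots: "(\<Sum>j<n. z ^ (j * (n - i))) = (if i = 0 then of_nat n else 0)" if "i < n" for i
  proof -
    have "(\<Sum>j<n. z ^ (j * (n - i))) = (\<Sum>j<n. (z ^ (n - i)) ^ j)"
      by (simp add: power_mult[symmetric] mult.commute)
    also have "\<dots> = (if i = 0 then of_nat n else 0)"
    proof (cases "i = 0")
      case False
      have "(z ^ (n - i)) ^ n = (z ^ n) ^ (n - i)" by (metis power_mult mult.commute)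
      then show ?thesis
        using False that n(2) n(3)[of "n - i"] geometric_sum[of "z ^ (n - i)" n] by simp
    qed (simp add: n)
    finally show ?thesis .
  qed
  have "(\<Sum>j<n. e j) = (\<Sum>i<n. const (\<Sum>j<n. z ^ (j * (n - i))) * gen g ^ i)"
    unfolding e_def by (subst sum.swap) (simp add: const_sum sum_distrib_right)
  also have "\<dots> = (\<Sum>i<n. if i = 0 then const (of_nat n) else 0)"
    by (intro sum.cong) (auto simp: roots)
  also have "\<dots> = const (of_nat n)" using n by simp
  finally have "act L (\<Sum>j<n. e j) x \<noteq> \<zero>\<^bsub>L\<^esub>" using act_const_eq_0 x n by simp
  moreover have "act L (\<Sum>j<n. e j) x = \<zero>\<^bsub>L\<^esub>" if "\<And>j. j < n \<Longrightarrow> act L (e j) x = \<zero>\<^bsub>L\<^esub>"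
    using act_sum_cong[of x "{..<n}" e "\<lambda>_. 0"] that x by simp
  ultimately obtain j where j: "act L (e j) x \<noteq> \<zero>\<^bsub>L\<^esub>" by blast
  \<comment> \<open>With these summands g (e j) is the sum over 1..n and z^j (e j) the sum over
    0..n-1, so their difference telescopes to z^j (g^n - 1), which kills x.\<close>
  define h where "h i = const (z ^ (j * (Suc n - i))) * gen g ^ i" for i
  have "gen g * e j = (\<Sum>i<n. h (Suc i))"
    by (simp add: e_def h_def sum_distrib_left mult.assoc[symmetric] const_commute[of _ "gen g"])
  moreover have "const (z ^ j) * e j = (\<Sum>i<n. h i)"
    by (auto simp: e_def h_def sum_distrib_left mult.assoc[symmetric] const_mult[symmetric] power_add[symmetric] Suc_diff_le
      intro!: sum.cong)
  moreover have "(\<Sum>i<n. h (Suc i)) - (\<Sum>i<n. h i) = h n - h 0"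
    using sum_lessThan_telescope[of h n] by (simp add: sum_subtractf)
  moreover have "z ^ (j * n) = 1" using n by (metis mult.commute power_mult power_one)
  then have "h n - h 0 = const (z ^ j) * (gen g ^ n - 1)"
    by (simp add: h_def power_add right_diff_distrib)
  ultimately have "gen g * e j - const (z ^ j) * e j = const (z ^ j) * (gen g ^ n - 1)" by simp
  moreover have "act L (const (z ^ j) * (gen g ^ n - 1)) x = \<zero>\<^bsub>L\<^esub>"
    using x act_eq_iff[OF x(1), of "gen g ^ n" 1] by (simp add: act_mult)
  ultimately have "act L (gen g * e j) x = act L (const (z ^ j) * e j) x"
    by (simp only: act_eq_iff[OF x(1)])
  then show ?thesis
    using that[OF e_def j] x by (simp add: act_mult)
qed

text \<open>Averaging an eigenvector of g1 over the powers of g2 gives an eigenvector of g2 and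
  keeps the eigenvalue of g1, because g1 and g2 commute.\<close>

lemma weight_vector_exists:
  fixes \<zeta> \<xi> :: 'k
  assumes "primitive_root_of_unity (2 * N) \<zeta>" "primitive_root_of_unity (2 * M) \<xi>"
    and simple: "simple_module HH L"
  obtains \<chi> x where "weight \<chi> x" "x \<noteq> \<zero>\<^bsub>L\<^esub>"
proof -
  obtain v where v: "v \<in> carrier L" "v \<noteq> \<zero>\<^bsub>L\<^esub>"
  proof -
    have "carrier L \<noteq> {\<zero>\<^bsub>L\<^esub>}" using simple by (simp add: simple_module_def)
    then have "\<not> carrier L \<subseteq> {\<zero>\<^bsub>L\<^esub>}"
      using M.zero_closed by (metis empty_iff subset_singletonD)
    then show ?thesis using that by (auto simp: subset_iff)
  qed
  obtain a b e where "e = (\<Sum>i<2 * N. const (b i) * gen G1 ^ i)" and x: "act L e v \<noteq> \<zero>\<^bsub>L\<^esub>" "act L (gen G1) (act L e v) = act L (const a) (act L e v)"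
    by (rule eigenvector_exists[OF assms(1) v group_relations(2)[OF v(1)]])
  define x where "x = act L e v"
  have x': "x \<in> carrier L" "x \<noteq> \<zero>\<^bsub>L\<^esub>" "act L (gen G1) x = act L (const a) x"
    using x v by (simp_all add: x_def)
  obtain r b f where f: "f = (\<Sum>i<2 * M. const (b i) * gen G2 ^ i)" "act L f x \<noteq> \<zero>\<^bsub>L\<^esub>"
      "act L (gen G2) (act L f x) = act L (const r) (act L f x)"
    by (rule eigenvector_exists[OF assms(2) x'(1,2) group_relations(3)[OF x'(1)]])
  have comm: "act L (gen G1) (act L (gen G2 ^ i) y) = act L (gen G2 ^ i) (act L (gen G1) y)"
    if "y \<in> carrier L" for y i
    using that by (induction i) (simp_all add: act_mult group_relations)
  have "act L (gen G1 * f) x = act L (\<Sum>i<2 * M. gen G1 * (const (b i) * gen G2 ^ i)) x"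
    by (simp add: f(1) sum_distrib_left)
  also have "\<dots> = act L (\<Sum>i<2 * M. const (b i) * gen G2 ^ i * gen G1) x"
    by (intro act_sum_cong x') (simp add: act_mult act_const_commute comm x'(1))
  also have "\<dots> = act L (f * gen G1) x"
    by (simp add: f(1) sum_distrib_right)
  also have "\<dots> = act L (f * const a) x" using x' by (simp add: act_mult)
  also have "\<dots> = act L (const a) (act L f x)" using x' by (simp add: const_commute[symmetric] act_mult)
  finally have "weight (a, r) (act L f x)"
    using f x' by (simp add: weight_def act_mult)
  with f(2) show ?thesis by (rule that[rotated])
qed

end

section \<open>The list of simple modules\<close>

locale H_closed = H_field N M l1 l2 l3
  for N M :: nat and l1 l2 l3 :: "'k::{alg_closed_field, field_char_0}" +
  fixes \<zeta> \<xi> :: 'k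
  assumes prim_\<zeta>: "primitive_root_of_unity (2 * N) \<zeta>" and prim_\<xi>: "primitive_root_of_unity (2 * M) \<xi>"
begin

text \<open>For a genuine quadratic a root exists by algebraic closure. If the leading coefficient
  vanishes, then \<alpha>1 or \<alpha>2 is 0, so outside \<open>OO1\<close> and \<open>OO2\<close>
  the linear coefficient \<alpha>3 is nonzero.\<close>

lemma L4_eq_solvable:
  assumes "\<chi> \<in> OO4"
  shows "\<exists>d. L4_eq l1 l2 l3 \<chi> d"
proof (cases "(alpha1 l1 \<chi>)\<^sup>2 * alpha2 l2 \<chi> = 0")
  case True
  then have "alpha3 l1 l2 l3 \<chi> \<noteq> 0" using assms by (auto simp: O4_def O1_def O2_def)
  with True show ?thesis
    by (intro exI[of _ "alpha2 l2 \<chi> / alpha3 l1 l2 l3 \<chi>"]) (simp add: L4_eq_def)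
next
  case False
  let ?p = "[:alpha2 l2 \<chi>, - alpha3 l1 l2 l3 \<chi>, (alpha1 l1 \<chi>)\<^sup>2 * alpha2 l2 \<chi>:]"
  have "degree ?p > 0" using False by simp
  then obtain d where "poly ?p d = 0" using alg_closed_imp_poly_has_root by blast
  then show ?thesis
    by (intro exI[of _ d]) (simp add: L4_eq_def algebra_simps power2_eq_square)
qed

text \<open>The choice is made as a function of the coefficients (\<alpha>1, \<alpha>2, \<alpha>3)
  rather than of \<chi>, which makes it consistent.\<close>

lemma solution_choice_exists: "\<exists>\<delta>. sol_choice \<delta>"
proof -
  define sol where "sol a b c = (SOME d :: 'k. a\<^sup>2 * b * d\<^sup>2 - c * d + b = 0)" for a b c
  have "L4_eq l1 l2 l3 \<chi> (sol (alpha1 l1 \<chi>) (alpha2 l2 \<chi>) (alpha3 l1 l2 l3 \<chi>))"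
    if "\<chi> \<in> OO4" for \<chi>
    unfolding L4_eq_def sol_def
    by (rule someI_ex) (rule L4_eq_solvable[OF that, unfolded L4_eq_def])
  then have "sol_choice (\<lambda>\<chi>. sol (alpha1 l1 \<chi>) (alpha2 l2 \<chi>) (alpha3 l1 l2 l3 \<chi>))"
    by (simp add: solution_choice_def)
  then show ?thesis by blast
qed

lemma O_cases:
  assumes "\<chi> \<in> O_all N M"
  obtains "\<chi> \<in> OO1" | "\<chi> \<in> OO2" "alpha1 l1 \<chi> \<noteq> 0"
    | "\<chi> \<in> OO2" "alpha2 l2 \<chi> \<noteq> 0" | "\<chi> \<in> OO4"
  using assms by (auto simp: O4_def O2_def)

lemma simple_weight:
  assumes "simple_module HH L"
  obtains \<chi> x where "H_fmod N M l1 l2 l3 L" "H_fmod.weight N M l1 l2 l3 L \<chi> x" "x \<noteq> \<zero>\<^bsub>L\<^esub>" "\<chi> \<in> O_all N M"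
proof -
  have L: "H_fmod N M l1 l2 l3 L"
    using simple_H_mod[OF assms] H_field_axioms by (simp add: H_fmod_def)
  interpret H_fmod N M l1 l2 l3 L by (rule L)
  obtain \<chi> x where x: "weight \<chi> x" "x \<noteq> \<zero>\<^bsub>L\<^esub>"
    by (rule weight_vector_exists[OF prim_\<zeta> prim_\<xi> assms])
  then show ?thesis using that L weight_O_all by blast
qed

text \<open>Collects every isomorphism with a model among which a system of representatives may
  select: both types of a pair, or a full class of \<open>sim'\<close>. In the last clause the
  single value \<open>\<delta> \<chi>\<close> serves the whole class.\<close>

definition describes :: "'k \<times> 'k \<Rightarrow> ('k free_alg set, 'b) module \<Rightarrow> bool" where
  "describes \<chi> L \<longleftrightarrow>
    (\<chi> \<in> OO1 \<and> iso_modules HH L (L1 \<chi>)) \<or>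
    (\<chi> \<in> OO2 \<and> alpha1 l1 \<chi> \<noteq> 0 \<and>
       iso_modules HH L (L2h l1 \<chi>) \<and> iso_modules HH L (L2h l1 (bar_type \<chi>))) \<or>
    (\<chi> \<in> OO2 \<and> alpha2 l2 \<chi> \<noteq> 0 \<and>
       iso_modules HH L (L2v l2 \<chi>) \<and> iso_modules HH L (L2v l2 (neg_type \<chi>))) \<or>
    (\<chi> \<in> OO4 \<and> (\<forall>\<delta>. sol_choice \<delta> \<longrightarrow>
       (\<exists>\<chi>'\<in>orbit \<chi>. \<forall>\<chi>''. (\<chi>', \<chi>'') \<in> sim' \<longrightarrow> iso_modules HH L (L4 l1 l2 l3 \<chi>'' (\<delta> \<chi>)))))"

lemma classification:
  assumes "simple_module HH L"
  shows "\<exists>\<chi>\<in>O_all N M. describes \<chi> L"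
proof -
  obtain \<chi> x where x: "H_fmod N M l1 l2 l3 L" "H_fmod.weight N M l1 l2 l3 L \<chi> x" "x \<noteq> \<zero>\<^bsub>L\<^esub>"
    "\<chi> \<in> O_all N M"
    by (rule simple_weight[OF assms])
  interpret H_fmod N M l1 l2 l3 L by (rule x(1))
  from x(4) show ?thesis
  proof (cases rule: O_cases)
    case 1
    from classify_O1[OF assms x(2,3) 1] obtain \<chi>' where "\<chi>' \<in> orbit \<chi>" "iso_modules HH L (L1 \<chi>')" ..
    then show ?thesis unfolding describes_def using x(4) 1 orbit_O(1) orbit_O_all by blast
  next
    case 2
    from classify_O2h[OF assms x(2,3) 2] obtain \<chi>' where *: "\<chi>' \<in> orbit \<chi>"
      "iso_modules HH L (L2h l1 \<chi>') \<and> iso_modules HH L (L2h l1 (bar_type \<chi>'))" ..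
    show ?thesis
      unfolding describes_def using 2 x(4) *(2) orbit_O(2)[OF *(1)] orbit_O_all[OF *(1)] orbit_alpha(1)[OF *(1)]
      by (intro bexI[of _ \<chi>']) simp_all
  next
    case 3
    from classify_O2v[OF assms x(2,3) 3] obtain \<chi>' where *: "\<chi>' \<in> orbit \<chi>"
      "iso_modules HH L (L2v l2 \<chi>') \<and> iso_modules HH L (L2v l2 (neg_type \<chi>'))" ..
    show ?thesis
      unfolding describes_def using 3 x(4) *(2) orbit_O(2)[OF *(1)] orbit_O_all[OF *(1)] orbit_alpha(2)[OF *(1)]
      by (intro bexI[of _ \<chi>']) simp_all
  next
    case 4
    have "L4_eq l1 l2 l3 \<chi> (\<delta> \<chi>)" if "sol_choice \<delta>" for \<delta>
      using bspec[OF conjunct1[OF that[unfolded solution_choice_def]] 4] .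
    then have *: "\<forall>\<delta>. sol_choice \<delta> \<longrightarrow>
       (\<exists>\<chi>'\<in>orbit \<chi>. \<forall>\<chi>''. (\<chi>', \<chi>'') \<in> sim' \<longrightarrow> iso_modules HH L (L4 l1 l2 l3 \<chi>'' (\<delta> \<chi>)))"
      by (intro allI impI classify_O4[OF assms x(2,3) 4])
    show ?thesis unfolding describes_def by (rule bexI[OF _ x(4)]) (rule disjI2 conjI 4 *)+
  qed
qed

section \<open>Telling the models apart, and completeness for given representatives\<close>

lemma typed_L4_orbit:
  assumes "\<chi> \<in> OO4" "L4_eq l1 l2 l3 \<chi> d" "typed (L4 l1 l2 l3 \<chi> d) \<chi>' v"
  shows "\<chi>' \<in> orbit \<chi>"
proof -
  interpret rep_H N M l1 l2 l3 4 "L4_op l1 l2 l3 \<chi> d" using assms(1,2) by (rule rep_L4_H)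
  note [simp] = Act_gen L4_op_simps(1,2) Act_const vec_of_list_numerals act_rep_module
  from assms(3) obtain p q s t where
    pqst: "p \<noteq> 0 \<or> q \<noteq> 0 \<or> s \<noteq> 0 \<or> t \<noteq> 0"
    and G1: "fst \<chi> * p = fst \<chi>' * p" "- fst \<chi> * q = fst \<chi>' * q" "fst \<chi> * s = fst \<chi>' * s" "- fst \<chi> * t = fst \<chi>' * t"
    and G2: "snd \<chi> * p = snd \<chi>' * p" "snd \<chi> * q = snd \<chi>' * q" "- snd \<chi> * s = snd \<chi>' * s" "- snd \<chi> * t = snd \<chi>' * t"
    by (auto simp: typed_def L4_def simp del: mult_minus_left mult_cancel_left mult_cancel_right elim!: carrier_vec_4E)
  have "p \<noteq> 0 \<Longrightarrow> \<chi>' = \<chi>" "q \<noteq> 0 \<Longrightarrow> \<chi>' = bar_type \<chi>" "s \<noteq> 0 \<Longrightarrow> \<chi>' = bar_type (neg_type \<chi>)"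
    "t \<noteq> 0 \<Longrightarrow> \<chi>' = neg_type \<chi>"
    using G1 G2 by (simp_all add: prod_eq_iff bar_type_def neg_type_def del: mult_minus_left)
  with pqst show ?thesis by (auto simp: orbit_def)
qed

text \<open>\<open>Th\<close> and \<open>Tv\<close> stand for sets with one type from each relevant
  pair, \<open>T\<close> for a transversal. All the lists of the theorem are specialisations of this
  one; a family that does not occur has an empty set.\<close>

definition model where
  "model Th Tv T \<delta> \<chi> L \<longleftrightarrow>
     \<chi> \<in> OO1 \<and> L = L1 \<chi> \<or> \<chi> \<in> Th \<and> L = L2h l1 \<chi> \<or> \<chi> \<in> Tv \<and> L = L2v l2 \<chi> \<or>
     \<chi> \<in> T \<and> L = L4 l1 l2 l3 \<chi> (\<delta> \<chi>)"

context
  fixes Th Tv T \<delta>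
  assumes sol: "sol_choice \<delta>"
    and Th_sub: "\<And>\<chi>. \<chi> \<in> Th \<Longrightarrow> \<chi> \<in> OO2 \<and> alpha1 l1 \<chi> \<noteq> 0"
    and Th_half: "\<And>\<chi>. \<chi> \<in> OO2 \<Longrightarrow> alpha1 l1 \<chi> \<noteq> 0 \<Longrightarrow> (\<chi> \<in> Th) \<noteq> (bar_type \<chi> \<in> Th)"
    and Tv_sub: "\<And>\<chi>. \<chi> \<in> Tv \<Longrightarrow> \<chi> \<in> OO2 \<and> alpha2 l2 \<chi> \<noteq> 0"
    and Tv_half: "\<And>\<chi>. \<chi> \<in> OO2 \<Longrightarrow> alpha2 l2 \<chi> \<noteq> 0 \<Longrightarrow> (\<chi> \<in> Tv) \<noteq> (neg_type \<chi> \<in> Tv)"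
    and trans: "transversal OO4 sim' T"
begin

lemma T_sub: "\<chi> \<in> T \<Longrightarrow> \<chi> \<in> OO4"
  using trans by (auto simp: transversal_def)

lemma sol_eq: "\<chi> \<in> OO4 \<Longrightarrow> L4_eq l1 l2 l3 \<chi> (\<delta> \<chi>)"
  by (rule bspec[OF conjunct1[OF sol[unfolded solution_choice_def]]])

text \<open>All types of an orbit have the same quadratic equation. A common d is what makes the
  eigenvalues c at \<chi> and \<chi>' comparable.\<close>

lemma sol_orbit:
  assumes "\<chi> \<in> OO4" "\<chi>' \<in> orbit \<chi>"
  shows "\<delta> \<chi>' = \<delta> \<chi>"
proof -
  have "\<chi>' \<in> OO4" using assms by (simp add: orbit_O)
  from bspec[OF bspec[OF conjunct2[OF sol[unfolded solution_choice_def]] this] assms(1)]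
  show ?thesis by (simp add: orbit_alpha[OF assms(2)])
qed

lemma transversal_class:
  assumes "\<chi> \<in> OO4"
  shows "\<exists>!\<chi>'. (\<chi>, \<chi>') \<in> sim' \<and> \<chi>' \<in> T"
  using trans[unfolded transversal_def, THEN conjunct2, rule_format, OF quotientI[OF assms]] by simp

lemma transversal_unique:
  assumes "\<chi> \<in> T" "\<chi>' \<in> T" "(\<chi>, \<chi>') \<in> sim'"
  shows "\<chi>' = \<chi>"
proof -
  have "(\<chi>, \<chi>) \<in> sim'" by (simp add: type_sim'_def type_sim_def)
  with transversal_class[OF T_sub[OF assms(1)]] assms show ?thesis by (elim ex1E) metis
qed

lemma transversal_ex:
  assumes "\<chi> \<in> OO4"
  obtains \<chi>' where "\<chi>' \<in> T" "(\<chi>, \<chi>') \<in> sim'"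
  using transversal_class[OF assms] that by (elim ex1E conjE)

lemma model_simple: "model Th Tv T \<delta> \<chi> L \<Longrightarrow> simple_module HH L"
  unfolding model_def
  by (elim disjE conjE; hypsubst)
    (simp_all add: simple_L1 simple_L2h simple_L2v simple_L4 Th_sub Tv_sub T_sub sol_eq)

lemma model_typed:
  assumes "model Th Tv T \<delta> \<chi> L"
  shows "\<exists>x. typed L \<chi> x" and "typed L \<chi>' y \<Longrightarrow> \<chi>' \<in> orbit \<chi>"
proof -
  show "\<exists>x. typed L \<chi> x"
    using assms unfolding model_def
    by (elim disjE conjE; hypsubst)
      (rule exI typed_L1(2) typed_L2h(2) typed_L2v(2) typed_L4(2) | simp add: Th_sub Tv_sub T_sub sol_eq)+
  consider "\<chi> \<in> OO1" "L = L1 \<chi>" | "\<chi> \<in> Th" "L = L2h l1 \<chi>" | "\<chi> \<in> Tv" "L = L2v l2 \<chi>"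
    | "\<chi> \<in> T" "L = L4 l1 l2 l3 \<chi> (\<delta> \<chi>)"
    using assms unfolding model_def by (elim disjE conjE)
  then show "\<chi>' \<in> orbit \<chi>" if "typed L \<chi>' y"
  proof cases
    case 1
    then show ?thesis using typed_L1(1)[OF 1(1), of \<chi>' y] that by simp
  next
    case 2
    then show ?thesis using typed_L2h(1)[of \<chi> \<chi>' y] Th_sub[OF 2(1)] that by auto
  next
    case 3
    then show ?thesis using typed_L2v(1)[of \<chi> \<chi>' y] Tv_sub[OF 3(1)] that by auto
  next
    case 4
    then show ?thesis
      using typed_L4_orbit[OF T_sub[OF 4(1)] sol_eq[OF T_sub[OF 4(1)]]] that by simp
  qed
qed

text \<open>The first basis vector carries the type \<chi> and the eigenvalue c into the second
  model. Either \<chi> is one of the two types with eigenvalue c there, or the two roots coincide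
  and \<chi>' lies in \<open>DD\<close>; both times \<chi> and \<chi>' are related.\<close>

lemma L4_iso_unique:
  assumes "\<chi> \<in> T" "\<chi>' \<in> T" "iso_modules HH (L4 l1 l2 l3 \<chi> (\<delta> \<chi>)) (L4 l1 l2 l3 \<chi>' (\<delta> \<chi>'))"
  shows "\<chi> = \<chi>'"
proof -
  have O4: "\<chi> \<in> OO4" "\<chi>' \<in> OO4" using assms T_sub by auto
  note eq = sol_eq[OF O4(1)] sol_eq[OF O4(2)]
  obtain y where y: "typed (L4 l1 l2 l3 \<chi>' (\<delta> \<chi>')) \<chi> y"
    "\<And>p e. eigen (L4 l1 l2 l3 \<chi> (\<delta> \<chi>)) p e (unit_vec 4 0) \<Longrightarrow> eigen (L4 l1 l2 l3 \<chi>' (\<delta> \<chi>')) p e y"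
    by (rule iso_modules_typed[OF H_mod_models(4)[OF O4(1) eq(1)] H_mod_models(4)[OF O4(2) eq(2)] assms(3)
        typed_L4(2)[OF O4(1) eq(1)]], rule that)
  have orb: "\<chi> \<in> orbit \<chi>'" by (rule typed_L4_orbit[OF O4(2) eq(2) y(1)])
  have d: "\<delta> \<chi> = \<delta> \<chi>'" by (rule sol_orbit[OF O4(2) orb])
  have c: "L4c \<chi> (\<delta> \<chi>') = L4c \<chi>' (\<delta> \<chi>')" by (simp add: orbit_alpha[OF orb])
  define c where "c = L4c \<chi>' (\<delta> \<chi>')"
  have c_nz: "c \<noteq> 0" and cd: "c * \<delta> \<chi>' = alpha2 l2 \<chi>'"
    using L4c_nz[OF eq(2) O4(2)] L4c_mult[OF eq(2)] by (auto simp: c_def)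
  from typed_L4(1)[OF O4(2) eq(2) y(1) y(2)[OF typed_L4(3)[OF O4(1) eq(1)]]]
  have "(\<chi>', \<chi>) \<in> sim'"
  proof
    assume "\<chi> \<in> {bar_type \<chi>', neg_type \<chi>'} \<and> L4c \<chi> (\<delta> \<chi>) = (alpha1 l1 \<chi>')\<^sup>2 * alpha2 l2 \<chi>' * \<delta> \<chi>'"
    then have \<chi>: "\<chi> \<in> {bar_type \<chi>', neg_type \<chi>'}" and q: "c = (alpha1 l1 \<chi>')\<^sup>2 * alpha2 l2 \<chi>' * \<delta> \<chi>'"
      using c d by (auto simp: c_def)
    define a b t z where "a = (alpha1 l1 \<chi>')\<^sup>2" and "b = alpha2 l2 \<chi>'" and "t = alpha3 l1 l2 l3 \<chi>'" and "z = \<delta> \<chi>'"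
    have "c = t - a * b * z" "c = a * b * z" "c * z = b"
      using q cd by (simp_all add: c_def a_def b_def t_def z_def)
    \<comment> \<open>Equal roots mean a vanishing discriminant, and the leading coefficient ab is
      nonzero since abz = c \<noteq> 0.\<close>
    then have "t\<^sup>2 - 4 * (a * b) * b = 0" "a * b \<noteq> 0" using c_nz by (Groebner_Basis.algebra, auto)
    then have "\<chi>' \<in> DD" using O4 by (simp add: O4_double_def a_def b_def t_def)
    with \<chi> show ?thesis by (auto simp: type_sim'_def)
  qed (auto simp: type_sim'_def type_sim_def)
  then show ?thesis using transversal_unique assms by blast
qed

text \<open>An isomorphism puts both types into one orbit, which decides between \<open>OO1\<close>,
  \<open>OO2\<close> and \<open>OO4\<close> and, in \<open>OO2\<close>, which of \<alpha>1,
  \<alpha>2 is nonzero; this fixes the family. Within a two-dimensional family only the two types of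
  a pair occur, and just one of them is a representative.\<close>

lemma model_iso_unique:
  assumes L: "model Th Tv T \<delta> \<chi> L" and L': "model Th Tv T \<delta> \<chi>' L'" and iso: "iso_modules HH L L'"
  shows "\<chi> = \<chi>' \<and> L = L'"
proof -
  note H = simple_H_mod[OF model_simple[OF L]] simple_H_mod[OF model_simple[OF L']]
  obtain x where "typed L \<chi> x" using model_typed(1)[OF L] ..
  then obtain y where y: "typed L' \<chi> y" by (rule iso_modules_typed[OF H iso])
  then have orb: "\<chi> \<in> orbit \<chi>'" by (rule model_typed(2)[OF L'])
  note O = orbit_O[OF orb] orbit_alpha[OF orb]
  have disj: "\<chi> \<notin> OO2" "\<chi> \<notin> OO4" if "\<chi> \<in> OO1"
    using that by (auto simp: O1_def O2_def O4_def)
  have disj': "\<chi> \<notin> OO4" "(alpha1 l1 \<chi> \<noteq> 0) \<noteq> (alpha2 l2 \<chi> \<noteq> 0)" if "\<chi> \<in> OO2"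
    using that by (auto simp: O2_def O4_def)
  consider "\<chi> \<in> OO1" "L = L1 \<chi>" | "\<chi> \<in> Th" "L = L2h l1 \<chi>" | "\<chi> \<in> Tv" "L = L2v l2 \<chi>"
    | "\<chi> \<in> T" "L = L4 l1 l2 l3 \<chi> (\<delta> \<chi>)"
    using L unfolding model_def by (elim disjE conjE)
  then show ?thesis
  proof cases
    case 1
    then have "L' = L1 \<chi>'" using L'[unfolded model_def]
      by (elim disjE conjE) (use Th_sub[of \<chi>'] Tv_sub[of \<chi>'] T_sub[of \<chi>'] disj O 1(1) in simp_all)
    then show ?thesis using 1 y typed_L1(1)[of \<chi>' \<chi> y] O(1) by simp
  next
    case 2
    then have "L' = L2h l1 \<chi>' \<and> \<chi>' \<in> Th" using L'[unfolded model_def]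
      by (elim disjE conjE) (use Th_sub[of \<chi>'] Tv_sub[of \<chi>'] T_sub[of \<chi>'] Th_sub[OF 2(1)] disj disj' O in auto)
    then show ?thesis using 2 y typed_L2h(1)[of \<chi>' \<chi> y] Th_sub[of \<chi>'] Th_half[of \<chi>'] by auto
  next
    case 3
    then have "L' = L2v l2 \<chi>' \<and> \<chi>' \<in> Tv" using L'[unfolded model_def]
      by (elim disjE conjE) (use Th_sub[of \<chi>'] Tv_sub[of \<chi>'] T_sub[of \<chi>'] Tv_sub[OF 3(1)] disj disj' O in auto)
    then show ?thesis using 3 y typed_L2v(1)[of \<chi>' \<chi> y] Tv_sub[of \<chi>'] Tv_half[of \<chi>'] by auto
  next
    case 4
    then have "L' = L4 l1 l2 l3 \<chi>' (\<delta> \<chi>') \<and> \<chi>' \<in> T" using L'[unfolded model_def]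
      by (elim disjE conjE) (use Th_sub[of \<chi>'] Tv_sub[of \<chi>'] T_sub[of \<chi>'] T_sub[OF 4(1)] disj disj' O in auto)
    then show ?thesis using 4 L4_iso_unique[of \<chi> \<chi>'] iso by auto
  qed
qed

lemma model_complete:
  assumes "simple_module HH L"
  shows "\<exists>\<chi> L'. model Th Tv T \<delta> \<chi> L' \<and> iso_modules HH L L'"
proof -
  obtain \<chi> where "describes \<chi> L" using classification[OF assms] ..
  then show ?thesis unfolding describes_def
  proof (elim disjE conjE)
    assume "\<chi> \<in> OO1" "iso_modules HH L (L1 \<chi>)"
    then show ?thesis unfolding model_def by blast
  next
    assume "\<chi> \<in> OO2" "alpha1 l1 \<chi> \<noteq> 0" "iso_modules HH L (L2h l1 \<chi>)" "iso_modules HH L (L2h l1 (bar_type \<chi>))"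
    then show ?thesis using Th_half[of \<chi>] unfolding model_def by metis
  next
    assume "\<chi> \<in> OO2" "alpha2 l2 \<chi> \<noteq> 0" "iso_modules HH L (L2v l2 \<chi>)" "iso_modules HH L (L2v l2 (neg_type \<chi>))"
    then show ?thesis using Tv_half[of \<chi>] unfolding model_def by metis
  next
    assume O4: "\<chi> \<in> OO4" and "\<forall>\<delta>. sol_choice \<delta> \<longrightarrow>
       (\<exists>\<chi>'\<in>orbit \<chi>. \<forall>\<chi>''. (\<chi>', \<chi>'') \<in> sim' \<longrightarrow> iso_modules HH L (L4 l1 l2 l3 \<chi>'' (\<delta> \<chi>)))"
    then obtain \<chi>' where \<chi>': "\<chi>' \<in> orbit \<chi>"
      "\<And>\<chi>''. (\<chi>', \<chi>'') \<in> sim' \<Longrightarrow> iso_modules HH L (L4 l1 l2 l3 \<chi>'' (\<delta> \<chi>))"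
      using sol by blast
    have "\<chi>' \<in> OO4" using O4 orbit_O(3)[OF \<chi>'(1)] by simp
    then obtain t where t: "t \<in> T" "(\<chi>', t) \<in> sim'" by (rule transversal_ex)
    then have "t \<in> orbit \<chi>'" by (auto simp: type_sim'_def type_sim_def)
    then have "\<delta> t = \<delta> \<chi>" using sol_orbit[OF O4] orbit_trans[OF \<chi>'(1)] by blast
    then show ?thesis using t \<chi>'(2)[OF t(2)] unfolding model_def by metis
  qed
qed

lemma simples_models:
  "simples_up_to_iso HH (L1 ` OO1 \<union> L2h l1 ` Th \<union> L2v l2 ` Tv \<union> (\<lambda>\<chi>. L4 l1 l2 l3 \<chi> (\<delta> \<chi>)) ` T) TYPE('b)"
proof -
  have X: "L1 ` OO1 \<union> L2h l1 ` Th \<union> L2v l2 ` Tv \<union> (\<lambda>\<chi>. L4 l1 l2 l3 \<chi> (\<delta> \<chi>)) ` T =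
      {L. \<exists>\<chi>. model Th Tv T \<delta> \<chi> L}"
    by (auto simp: model_def)
  show ?thesis
    unfolding simples_up_to_iso_def X using model_simple model_iso_unique model_complete by blast
qed

lemma models_inj:
  "inj_on L1 OO1" "inj_on (L2h l1) Th" "inj_on (L2v l2) Tv" "inj_on (\<lambda>\<chi>. L4 l1 l2 l3 \<chi> (\<delta> \<chi>)) T"
proof -
  have *: "\<chi> = \<chi>'" if "model Th Tv T \<delta> \<chi> L" "model Th Tv T \<delta> \<chi>' L" for \<chi> \<chi>' L
    using model_iso_unique[OF that iso_modules_refl] by simp
  show "inj_on L1 OO1" by (rule inj_onI, rule *) (auto simp: model_def)
  show "inj_on (L2h l1) Th" by (rule inj_onI, rule *) (auto simp: model_def)
  show "inj_on (L2v l2) Tv" by (rule inj_onI, rule *) (auto simp: model_def)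
  show "inj_on (\<lambda>\<chi>. L4 l1 l2 l3 \<chi> (\<delta> \<chi>)) T" by (rule inj_onI, rule *) (auto simp: model_def)
qed

end

end

section \<open>Counting types\<close>

lemma finite_roots_1:
  assumes "n > 0"
  shows "finite (roots_1 n :: 'k::field_char_0 set)" and "card (roots_1 n :: 'k set) \<le> n"
proof -
  let ?p = "monom 1 n - 1 :: 'k poly"
  have deg: "degree ?p \<le> n" by (rule degree_diff_le) (simp_all add: degree_monom_le)
  have "coeff ?p n = 1" using assms by simp
  then have "?p \<noteq> 0" by (metis coeff_0 zero_neq_one)
  moreover have "roots_1 n = {x. poly ?p x = 0}" by (auto simp: roots_1_def poly_monom)
  ultimately show "finite (roots_1 n :: 'k set)" "card (roots_1 n :: 'k set) \<le> n"
    using poly_roots_finite[of ?p] card_poly_roots_bound[of ?p] deg by simp_all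
qed

text \<open>The n distinct powers of z already exhaust the at most n roots of x^n - 1.\<close>

lemma roots_1_primitive:
  fixes z :: "'k::field_char_0"
  assumes "primitive_root_of_unity n z"
  shows "inj_on (\<lambda>i. z ^ i) {..<n}" "roots_1 n = (\<lambda>i. z ^ i) ` {..<n}" "card (roots_1 n :: 'k set) = n"
proof -
  have n: "n > 0" "z ^ n = 1" "\<And>k. 0 < k \<Longrightarrow> k < n \<Longrightarrow> z ^ k \<noteq> 1"
    using assms by (auto simp: primitive_root_of_unity_def)
  then have z0: "z \<noteq> 0" by (auto simp: power_0_left)
  have ne: "z ^ i \<noteq> z ^ j" if "i < j" "j < n" for i j
  proof
    assume "z ^ i = z ^ j"
    also have "z ^ j = z ^ i * z ^ (j - i)" using that by (simp flip: power_add)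
    finally have "z ^ (j - i) = 1" using z0 by simp
    then show False using n(3)[of "j - i"] that by simp
  qed
  show inj: "inj_on (\<lambda>i. z ^ i) {..<n}"
    by (rule linorder_inj_onI') (auto simp: ne)
  have sub: "(\<lambda>i. z ^ i) ` {..<n} \<subseteq> roots_1 n"
  proof clarify
    fix i
    have "(z ^ i) ^ n = (z ^ n) ^ i" by (simp flip: power_mult add: mult.commute)
    then show "z ^ i \<in> roots_1 n" using n(2) by (simp add: roots_1_def)
  qed
  show eq: "roots_1 n = (\<lambda>i. z ^ i) ` {..<n}"
    using card_seteq[OF finite_roots_1(1)[OF n(1)] sub, symmetric] finite_roots_1(2)[OF n(1)] inj
    by (simp add: card_image)
  show "card (roots_1 n :: 'k set) = n" unfolding eq by (simp add: card_image inj)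
qed

lemma primitive_root_power:
  fixes z :: "'k::field_char_0"
  assumes "primitive_root_of_unity (m * n) z" "n > 0"
  shows "primitive_root_of_unity n (z ^ m)"
  using assms unfolding primitive_root_of_unity_def
  by (auto simp flip: power_mult)

text \<open>Since z^n = -1, negation shifts exponents by n. It pairs 1..n-1 with n+1..2n-1, while
  the exponents 0 and n belong to 1 and -1.\<close>

lemma half_roots_props:
  fixes z :: "'k::field_char_0"
  assumes "n \<ge> 1" "primitive_root_of_unity (2 * n) z"
  shows "half_roots n z \<subseteq> roots_1 (2 * n) - {1, -1}"
    and "\<And>x. x \<in> roots_1 (2 * n) \<Longrightarrow> x\<^sup>2 \<noteq> 1 \<Longrightarrow> (x \<in> half_roots n z) \<noteq> (- x \<in> half_roots n z)"
    and "card (half_roots n z) = n - 1"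
proof -
  note inj = roots_1_primitive(1)[OF assms(2)] and eq = roots_1_primitive(2)[OF assms(2)]
  have "(z ^ n)\<^sup>2 = 1" "z ^ n \<noteq> 1"
    using assms by (auto simp: primitive_root_of_unity_def mult.commute simp flip: power_mult)
  then have zn: "z ^ n = - 1" by (simp add: power2_eq_1_iff)
  have eqD: "i = j" if "z ^ i = z ^ j" "i < 2 * n" "j < 2 * n" for i j
    using inj_onD[OF inj that(1)] that by simp
  have half: "z ^ i \<in> half_roots n z \<longleftrightarrow> 1 \<le> i \<and> i \<le> n - 1" if "i < 2 * n" for i
    using eqD[OF _ that] assms(1) by (fastforce simp: half_roots_def)
  show "half_roots n z \<subseteq> roots_1 (2 * n) - {1, -1}"
  proof
    fix x assume "x \<in> half_roots n z"
    then obtain i where i: "x = z ^ i" "1 \<le> i" "i \<le> n - 1" by (auto simp: half_roots_def)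
    then have "i < 2 * n" "i \<noteq> 0" "i \<noteq> n" using assms(1) by auto
    with eqD[of i 0] eqD[of i n] i(1) have "x \<noteq> z ^ 0" "x \<noteq> z ^ n" by (auto simp del: power_0)
    then show "x \<in> roots_1 (2 * n) - {1, -1}"
      using i assms(1) zn by (auto simp: eq)
  qed
  show "(x \<in> half_roots n z) \<noteq> (- x \<in> half_roots n z)" if x: "x \<in> roots_1 (2 * n)" "x\<^sup>2 \<noteq> 1" for x
  proof -
    obtain i where i: "x = z ^ i" "i < 2 * n" using x(1) by (auto simp: eq)
    have "i \<noteq> 0" "i \<noteq> n" using x(2) i(1) zn by (intro notI; simp)+
    note ne = this
    show ?thesis
    proof (cases "i < n")
      case True
      have "- x = z ^ (n + i)" by (simp add: power_add zn i)
      then show ?thesis using half[of i] half[of "n + i"] i True ne by (simp, arith)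
    next
      case False
      have "z ^ i = z ^ n * z ^ (i - n)" using False by (simp flip: power_add)
      then have "- x = z ^ (i - n)" by (simp add: zn i)
      then show ?thesis using half[of i] half[of "i - n"] i False ne by auto
    qed
  qed
  have "inj_on (\<lambda>i. z ^ i) {1..n - 1}" by (rule inj_on_subset[OF inj]) auto
  then show "card (half_roots n z) = n - 1" by (simp add: half_roots_def card_image)
qed

lemma card_half:
  assumes "finite X" "T \<subseteq> X" "f ` X \<subseteq> X" "inj_on f X" "\<And>x. x \<in> X \<Longrightarrow> f (f x) = x"
    and half: "\<And>x. x \<in> X \<Longrightarrow> (x \<in> T) \<noteq> (f x \<in> T)"
  shows "card X = 2 * card T"
proof -
  have X: "X = T \<union> f ` T"
  proof
    show "X \<subseteq> T \<union> f ` T" using half assms(5) by (metis UnI1 UnI2 image_eqI subsetI)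
    show "T \<union> f ` T \<subseteq> X" using assms(2,3) by blast
  qed
  have "T \<inter> f ` T = {}" using half assms(2) by blast
  moreover have "card (f ` T) = card T" using assms(2,4) by (meson card_image inj_on_subset)
  moreover have "finite T" using assms(1,2) by (rule rev_finite_subset)
  ultimately show ?thesis by (subst X) (simp add: card_Un_disjoint)
qed

text \<open>The classes of the elements of T partition X into \<open>card T\<close> blocks of size
  k.\<close>

lemma card_transversal:
  assumes "finite X" "transversal X E T"
    and cls: "\<And>x. x \<in> X \<Longrightarrow> x \<in> E `` {x} \<and> E `` {x} \<subseteq> X \<and> card (E `` {x}) = k"
    and eq: "\<And>x y. x \<in> X \<Longrightarrow> y \<in> E `` {x} \<Longrightarrow> E `` {y} = E `` {x}"
  shows "card X = k * card T"
proof -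
  have T: "T \<subseteq> X" using assms(2) by (simp add: transversal_def)
  have ex1: "\<exists>!t. t \<in> E `` {x} \<and> t \<in> T" if "x \<in> X" for x
    using bspec[OF conjunct2[OF assms(2)[unfolded transversal_def]] quotientI[OF that]] .
  have fin: "finite T" using assms(1) T by (rule rev_finite_subset)
  have "X = (\<Union>t\<in>T. E `` {t})"
  proof
    show "X \<subseteq> (\<Union>t\<in>T. E `` {t})"
    proof
      fix x assume x: "x \<in> X"
      then obtain t where t: "t \<in> E `` {x}" "t \<in> T" using ex1 by blast
      then show "x \<in> (\<Union>t\<in>T. E `` {t})" using eq[OF x t(1)] cls[OF x] by (intro UN_I[OF t(2)]) simp
    qed
    show "(\<Union>t\<in>T. E `` {t}) \<subseteq> X" using cls T by blast
  qed
  moreover have "card (\<Union>t\<in>T. E `` {t}) = (\<Sum>t\<in>T. card (E `` {t}))"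
  proof (rule card_UN_disjoint[OF fin])
    show "\<forall>t\<in>T. finite (E `` {t})" using cls T assms(1) by (meson finite_subset subsetD)
    show "\<forall>s\<in>T. \<forall>t\<in>T. s \<noteq> t \<longrightarrow> E `` {s} \<inter> E `` {t} = {}"
    proof (intro ballI impI equals0I)
      fix s t y assume st: "s \<in> T" "t \<in> T" "s \<noteq> t" and "y \<in> E `` {s} \<inter> E `` {t}"
      then have y: "y \<in> E `` {s}" "y \<in> E `` {t}" by simp_all
      have sX: "s \<in> X" and tX: "t \<in> X" using T st by auto
      have "E `` {t} = E `` {s}" using eq[OF sX y(1)] eq[OF tX y(2)] by simp
      then have "t \<in> E `` {s}" using cls[OF tX] by blast
      then show False using ex1[OF sX] cls[OF sX] st by (elim ex1E) metis
    qed
  qed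
  moreover have "(\<Sum>t\<in>T. card (E `` {t})) = k * card T" using cls T by (simp add: subset_iff)
  ultimately show ?thesis by simp
qed

lemma transversal_restrict:
  assumes "transversal X E T" "X' \<subseteq> X" "\<And>x. x \<in> X' \<Longrightarrow> E `` {x} \<subseteq> X'"
  shows "transversal X' E (T \<inter> X')"
  unfolding transversal_def
proof (intro conjI ballI)
  fix C assume "C \<in> X' // E"
  then obtain x where x: "x \<in> X'" "C = E `` {x}" by (elim quotientE)
  then have "C \<in> X // E" using assms(2) by (auto intro: quotientI)
  then have "\<exists>!t. t \<in> C \<and> t \<in> T" using assms(1) by (simp add: transversal_def)
  moreover have "C \<subseteq> X'" using x assms(3) by simp
  ultimately show "\<exists>!t. t \<in> C \<and> t \<in> T \<inter> X'" by blast
qed simp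

section \<open>Cardinalities of the sets of types\<close>

context H_closed
begin

lemma card_O_all: "card (O_all N M :: ('k \<times> 'k) set) = 4 * N * M"
  using roots_1_primitive(3)[OF prim_\<zeta>] roots_1_primitive(3)[OF prim_\<xi>]
  by (simp add: O_all_def card_cartesian_product)

lemma finite_O_all: "finite (O_all N M :: ('k \<times> 'k) set)"
  unfolding O_all_def using N_pos M_pos by (intro finite_cartesian_product finite_roots_1(1)) auto

text \<open>Replacing y by s = xy turns x^2 y^2 = 1 into s = 1 or s = -1. Moreover x^(2M) is the
  inverse of y^(2M) = 1, so x is a root of unity of order dividing 2 gcd(N, M), and every such x
  occurs.\<close>

lemma card_S_set: "card (S_set N M :: ('k \<times> 'k) set) = 4 * gcd N M"
proof -
  let ?g = "gcd N M"
  have g: "?g > 0" using N_pos by simp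
  \<comment> \<open>\<open>\<zeta> ^ q\<close> is a primitive root of order 2 gcd(N, M), so the
    number of these roots of unity is exact.\<close>
  obtain q where q: "N = q * ?g" by (metis dvdE gcd_dvd1 mult.commute)
  have "primitive_root_of_unity (q * (2 * ?g)) \<zeta>" using prim_\<zeta> q by (metis mult.left_commute)
  then have "primitive_root_of_unity (2 * ?g) (\<zeta> ^ q)" using g by (intro primitive_root_power) auto
  then have card: "card (roots_1 (2 * ?g) :: 'k set) = 2 * ?g" by (rule roots_1_primitive(3))
  have gcd_root: "x ^ gcd a b = 1" if *: "x ^ a = 1" "x ^ b = 1" "a > 0" for x :: 'k and a b :: nat
  proof -
    obtain u v where "a * u = b * v + gcd a b" using bezout_nat[of a b] *(3) by auto
    then have "x ^ (a * u) = x ^ (b * v) * x ^ gcd a b" by (simp flip: power_add)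
    then show ?thesis using * by (simp add: power_mult)
  qed
  have dvd_root: "x ^ b = 1" if "x ^ a = 1" "a dvd b" for x :: 'k and a b :: nat
    using that by (elim dvdE) (simp add: power_mult)
  define f :: "'k \<times> 'k \<Rightarrow> 'k \<times> 'k" where "f = (\<lambda>(x, s). (x, s / x))"
  have "S_set N M = f ` (roots_1 (2 * ?g) \<times> {1, -1})"
  proof (intro equalityI subsetI)
    fix \<chi> :: "'k \<times> 'k" assume "\<chi> \<in> S_set N M"
    then obtain x y where \<chi>: "\<chi> = (x, y)" and x: "x ^ (2 * N) = 1" and y: "y ^ (2 * M) = 1"
      and xy: "x\<^sup>2 * y\<^sup>2 = 1"
      by (cases \<chi>) (auto simp: S_set_def O_all_def roots_1_def)
    from xy have "(x\<^sup>2 * y\<^sup>2) ^ M = 1" by simp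
    then have "x ^ (2 * M) * y ^ (2 * M) = 1" by (simp add: power_mult_distrib flip: power_mult)
    then have "x ^ (2 * M) = 1" using y by simp
    then have "x ^ gcd (2 * N) (2 * M) = 1" using x N_pos by (intro gcd_root) auto
    then have "x \<in> roots_1 (2 * ?g)" by (simp add: roots_1_def gcd_mult_distrib_nat)
    moreover have "x * y = 1 \<or> x * y = -1"
      using xy by (simp add: power2_eq_1_iff flip: power_mult_distrib)
    moreover have "x \<noteq> 0" using xy by auto
    ultimately show "\<chi> \<in> f ` (roots_1 (2 * ?g) \<times> {1, -1})"
      by (intro image_eqI[of _ _ "(x, x * y)"]) (auto simp: f_def \<chi>)
  next
    fix \<chi> assume "\<chi> \<in> f ` (roots_1 (2 * ?g) \<times> {1, -1})"
    then obtain x s where \<chi>: "\<chi> = (x, s / x)" and x: "x ^ (2 * ?g) = 1" and s: "s = 1 \<or> s = -1"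
      by (auto simp: f_def roots_1_def)
    have "x \<noteq> 0" using x g by (auto simp: power_0_left)
    moreover have "x ^ (2 * N) = 1" "x ^ (2 * M) = 1" using dvd_root[OF x] by simp_all
    ultimately show "\<chi> \<in> S_set N M"
      using s by (auto simp: S_set_def O_all_def roots_1_def \<chi> power_divide)
  qed
  moreover have "inj_on f (roots_1 (2 * ?g) \<times> {1, -1})"
  proof (rule inj_onI)
    fix p q assume pq: "p \<in> roots_1 (2 * ?g) \<times> {1, -1}" "q \<in> roots_1 (2 * ?g) \<times> {1, -1}" "f p = f q"
    then have "fst p ^ (2 * ?g) = 1" by (auto simp: roots_1_def)
    then have "fst p \<noteq> 0" using g by (auto simp: power_0_left)
    with pq(3) show "p = q" by (auto simp: f_def split: prod.splits)
  qed
  ultimately show ?thesis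
    using card by (simp add: card_image card_cartesian_product)
qed

lemma O4_Diff: "OO4 = O_all N M - (OO1 \<union> OO2)"
  by (simp add: O4_def)

lemma finite_O4: "finite OO4"
  using finite_O_all by (simp add: O4_def)

lemma card_orbits:
  fixes \<chi> :: "'k \<times> 'k"
  assumes "\<chi> \<in> O_all N M"
  shows "card {\<chi>, neg_type (bar_type \<chi>)} = 2" "card (orbit \<chi>) = 4"
proof -
  have "fst \<chi> \<noteq> - fst \<chi>" "snd \<chi> \<noteq> - snd \<chi>" using O_all_nz[OF assms] by simp_all
  moreover from this have "- fst \<chi> \<noteq> fst \<chi>" "- snd \<chi> \<noteq> snd \<chi>" by metis+
  ultimately show "card {\<chi>, neg_type (bar_type \<chi>)} = 2" "card (orbit \<chi>) = 4"
    by (auto simp: orbit_def bar_type_def neg_type_def prod_eq_iff card_insert_if)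
qed

lemma orbit_double: "\<chi>' \<in> orbit \<chi> \<Longrightarrow> \<chi>' \<in> DD \<longleftrightarrow> \<chi> \<in> DD"
  by (simp add: O4_double_def orbit_O orbit_alpha)

lemma type_sim'_class:
  "sim' `` {\<chi>} =
     (if \<chi> \<in> DD then orbit \<chi> else {\<chi>, neg_type (bar_type \<chi>)})"
  by (auto simp: type_sim'_def type_sim_def orbit_def)

lemma orbit_eq: "\<chi>' \<in> orbit \<chi> \<Longrightarrow> orbit \<chi>' = orbit \<chi>"
  by (auto simp: orbit_def bar_type_def neg_type_def)

text \<open>\<open>DD\<close> is a union of full orbits, which are classes of size 4, and the rest
  of \<open>OO4\<close> consists of classes of size 2. With k representatives in \<open>DD\<close>,
  the count is 4k + 2 (card T - k).\<close>

lemma card_transversal_sim':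
  assumes T: "transversal OO4 sim' T"
  shows "\<exists>k. card DD = 4 * k \<and> card OO4 = 2 * card T + 2 * k"
proof -
  let ?X = "OO4" and ?D = "DD" and ?E = "sim'"
  have D: "?D \<subseteq> ?X" by (auto simp: O4_double_def)
  have X: "?X \<subseteq> O_all N M" by (auto simp: O4_def)
  have fin: "finite ?D" by (rule finite_subset[OF D finite_O4])
  have nb: "neg_type (bar_type \<chi>) \<in> orbit \<chi>" for \<chi> :: "'k \<times> 'k" by simp
  have nbnb: "neg_type (bar_type (neg_type (bar_type \<chi>))) = \<chi>" for \<chi> :: "'k \<times> 'k"
    by (simp add: neg_type_def bar_type_def)
  have cD: "?E `` {\<chi>} = orbit \<chi>" if "\<chi> \<in> ?D" for \<chi> using that by (simp add: type_sim'_class)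
  have cX: "?E `` {\<chi>} = {\<chi>, neg_type (bar_type \<chi>)}" if "\<chi> \<in> ?X - ?D" for \<chi>
    using that by (simp add: type_sim'_class)
  have nX: "neg_type (bar_type \<chi>) \<in> ?X - ?D" if "\<chi> \<in> ?X - ?D" for \<chi>
    using that orbit_O(3)[OF nb] orbit_double[OF nb] by blast
  have "card ?D = 4 * card (T \<inter> ?D)"
  proof (rule card_transversal[OF fin])
    show "transversal ?D ?E (T \<inter> ?D)"
      by (rule transversal_restrict[OF T D]) (use cD orbit_double in blast)
    show "\<chi> \<in> ?E `` {\<chi>} \<and> ?E `` {\<chi>} \<subseteq> ?D \<and> card (?E `` {\<chi>}) = 4" if "\<chi> \<in> ?D" for \<chi>
      using that cD[OF that] card_orbits(2) orbit_double X D by (metis orbit_simps(1) subsetD subsetI)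
    show "?E `` {\<chi>'} = ?E `` {\<chi>}" if "\<chi> \<in> ?D" "\<chi>' \<in> ?E `` {\<chi>}" for \<chi> \<chi>'
      using that cD orbit_double orbit_eq by metis
  qed
  moreover have "card (?X - ?D) = 2 * card (T \<inter> (?X - ?D))"
  proof (rule card_transversal)
    show "finite (?X - ?D)" using finite_O4 by simp
    show "transversal (?X - ?D) ?E (T \<inter> (?X - ?D))"
      by (rule transversal_restrict[OF T]) (use cX nX in auto)
    show "\<chi> \<in> ?E `` {\<chi>} \<and> ?E `` {\<chi>} \<subseteq> ?X - ?D \<and> card (?E `` {\<chi>}) = 2" if "\<chi> \<in> ?X - ?D" for \<chi>
      using that cX[OF that] card_orbits(1)[of \<chi>] nX[OF that] X by auto
    show "?E `` {\<chi>'} = ?E `` {\<chi>}" if "\<chi> \<in> ?X - ?D" "\<chi>' \<in> ?E `` {\<chi>}" for \<chi> \<chi>'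
    proof -
      have "\<chi>' = \<chi> \<or> \<chi>' = neg_type (bar_type \<chi>)" using that(2) cX[OF that(1)] by simp
      then show ?thesis
      proof
        assume "\<chi>' = neg_type (bar_type \<chi>)"
        then show ?thesis
          by (simp only: cX[OF nX[OF that(1)]] cX[OF that(1)] nbnb) (rule insert_commute)
      qed simp
    qed
  qed
  moreover have "card ?X = card ?D + card (?X - ?D)"
    using card_Un_disjoint[OF fin, of "?X - ?D"] finite_O4 D by (simp add: Un_absorb1)
  moreover have "card T = card (T \<inter> ?D) + card (T \<inter> (?X - ?D))"
  proof -
    have sub: "T \<subseteq> ?X" using T by (simp add: transversal_def)
    then have fT: "finite T" by (rule finite_subset[OF _ finite_O4])
    from sub have "T = (T \<inter> ?D) \<union> (T \<inter> (?X - ?D))" by blast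
    then have "card T = card ((T \<inter> ?D) \<union> (T \<inter> (?X - ?D)))" by (rule arg_cong)
    also have "\<dots> = card (T \<inter> ?D) + card (T \<inter> (?X - ?D))"
      by (rule card_Un_disjoint) (use fT in auto)
    finally show ?thesis .
  qed
  ultimately show ?thesis by (intro exI[of _ "card (T \<inter> ?D)"]) linarith
qed

end

lemma transversal_empty: "transversal {} E {}"
  by (simp add: transversal_def)

lemma sq_eq_1_iff: "(x :: 'k::idom)\<^sup>2 = 1 \<longleftrightarrow> x \<in> {1, -1}"
  by (simp add: power2_eq_1_iff)

lemma half_fst:
  fixes \<zeta> :: "'k::field_char_0"
  assumes "N \<ge> 1" "primitive_root_of_unity (2 * N) \<zeta>" "X \<subseteq> O_all N M" "\<And>\<chi>. \<chi> \<in> X \<Longrightarrow> bar_type \<chi> \<in> X"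
  defines "Y \<equiv> {\<chi> \<in> X. (fst \<chi>)\<^sup>2 \<noteq> 1}" and "T \<equiv> {\<chi> \<in> X. fst \<chi> \<in> half_roots N \<zeta>}"
  shows "T \<subseteq> Y" and "\<And>\<chi>. \<chi> \<in> Y \<Longrightarrow> (\<chi> \<in> T) \<noteq> (bar_type \<chi> \<in> T)"
    and "finite X \<Longrightarrow> card Y = 2 * card T"
proof -
  note half = half_roots_props[OF assms(1,2)]
  show TY: "T \<subseteq> Y" using half(1) by (auto simp: Y_def T_def sq_eq_1_iff)
  show ne: "(\<chi> \<in> T) \<noteq> (bar_type \<chi> \<in> T)" if "\<chi> \<in> Y" for \<chi>
  proof -
    have "\<chi> \<in> X" "(fst \<chi>)\<^sup>2 \<noteq> 1" using that by (simp_all add: Y_def)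
    moreover have "fst \<chi> \<in> roots_1 (2 * N)" using \<open>\<chi> \<in> X\<close> assms(3) by (auto simp: O_all_def)
    ultimately show ?thesis using half(2)[of "fst \<chi>"] assms(4)[of \<chi>] by (simp add: T_def bar_type_def)
  qed
  assume "finite X"
  then have "finite Y" by (simp add: Y_def)
  then show "card Y = 2 * card T"
  proof (rule card_half[where f = bar_type, OF _ TY _ _ bar_bar(1) ne])
    have "bar_type \<chi> \<in> Y" if "\<chi> \<in> Y" for \<chi>
      using that assms(4)[of \<chi>] by (simp add: Y_def bar_type_def)
    then show "bar_type ` Y \<subseteq> Y" by blast
    show "inj_on bar_type Y" by (metis bar_bar(1) inj_onI)
  qed
qed

text \<open>The involution \<open>neg_type\<close> also changes the first coordinate, but membership
  in T depends, within the stable set X, only on the second.\<close>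

lemma half_snd:
  fixes \<xi> :: "'k::field_char_0"
  assumes "M \<ge> 1" "primitive_root_of_unity (2 * M) \<xi>" "X \<subseteq> O_all N M" "\<And>\<chi>. \<chi> \<in> X \<Longrightarrow> neg_type \<chi> \<in> X"
  defines "Y \<equiv> {\<chi> \<in> X. (snd \<chi>)\<^sup>2 \<noteq> 1}" and "T \<equiv> {\<chi> \<in> X. snd \<chi> \<in> half_roots M \<xi>}"
  shows "T \<subseteq> Y" and "\<And>\<chi>. \<chi> \<in> Y \<Longrightarrow> (\<chi> \<in> T) \<noteq> (neg_type \<chi> \<in> T)"
    and "finite X \<Longrightarrow> card Y = 2 * card T"
proof -
  note half = half_roots_props[OF assms(1,2)]
  show TY: "T \<subseteq> Y" using half(1) by (auto simp: Y_def T_def sq_eq_1_iff)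
  show ne: "(\<chi> \<in> T) \<noteq> (neg_type \<chi> \<in> T)" if "\<chi> \<in> Y" for \<chi>
  proof -
    have "\<chi> \<in> X" "(snd \<chi>)\<^sup>2 \<noteq> 1" using that by (simp_all add: Y_def)
    moreover have "snd \<chi> \<in> roots_1 (2 * M)" using \<open>\<chi> \<in> X\<close> assms(3) by (auto simp: O_all_def)
    ultimately show ?thesis using half(2)[of "snd \<chi>"] assms(4)[of \<chi>] by (simp add: T_def neg_type_def)
  qed
  assume "finite X"
  then have "finite Y" by (simp add: Y_def)
  then show "card Y = 2 * card T"
  proof (rule card_half[where f = neg_type, OF _ TY _ _ bar_bar(2) ne])
    have "neg_type \<chi> \<in> Y" if "\<chi> \<in> Y" for \<chi>
      using that assms(4)[of \<chi>] by (simp add: Y_def neg_type_def)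
    then show "neg_type ` Y \<subseteq> Y" by blast
    show "inj_on neg_type Y" by (metis bar_bar(2) inj_onI)
  qed
qed

section \<open>Templates for the lists of simple modules\<close>

context H_closed
begin

abbreviation L4s :: "('k \<times> 'k \<Rightarrow> 'k) \<Rightarrow> ('k \<times> 'k) set \<Rightarrow> ('k free_alg set, 'k vec) module set" where
  "L4s \<delta> T \<equiv> (\<lambda>\<chi>. L4 l1 l2 l3 \<chi> (\<delta> \<chi>)) ` T"

lemma type_sim'_eq: "DD = {} \<Longrightarrow> sim' = type_sim"
  by (simp add: type_sim'_def)

lemma card_L4s_no_double:
  assumes "DD = {}" "transversal OO4 type_sim T"
  shows "card OO4 = 2 * card T"
  using card_transversal_sim'[of T] assms by (auto simp: type_sim'_eq)

text \<open>The 4NM types split into \<open>OO1\<close> and \<open>OO4\<close>; a quarter of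
  \<open>card DD\<close> counts the orbits in which two \<open>type_sim\<close> classes merge. The
  count is stated additively to avoid truncated subtraction.\<close>

lemma list_without_L2:
  assumes sol: "sol_choice \<delta>" and O2: "OO2 = {}"
    and T: "transversal OO4 sim' T"
  shows "simples_up_to_iso HH (L1 ` OO1 \<union> L4s \<delta> T) TYPE('b)"
    and "card (L1 ` OO1) = card OO1" "card (L4s \<delta> T) = card T"
    and "card OO1 + (2 * card T + 2 * (card DD div 4)) = 4 * N * M"
    and "4 dvd card DD"
    and "card DD \<le> 4 * card T"
proof -
  note * = sol _ _ _ _ T
  show "simples_up_to_iso HH (L1 ` OO1 \<union> L4s \<delta> T) TYPE('b)"
    using simples_models[of \<delta> "{}" "{}" T, OF *, where 'b = 'b] O2 by simp
  show "card (L1 ` OO1) = card OO1"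
    using models_inj(1)[of \<delta> "{}" "{}" T, OF *] O2 by (simp add: card_image)
  show "card (L4s \<delta> T) = card T"
    using models_inj(4)[of \<delta> "{}" "{}" T, OF *] O2 by (simp add: card_image)
  obtain k where k: "card DD = 4 * k" "card OO4 = 2 * card T + 2 * k"
    using card_transversal_sim'[OF T] by blast
  have "card OO4 = card (O_all N M :: ('k \<times> 'k) set) - card OO1"
    unfolding O4_Diff O2 using finite_O_all by (simp add: card_Diff_subset O1_def)
  moreover have "card OO1 \<le> card (O_all N M :: ('k \<times> 'k) set)"
    using finite_O_all by (intro card_mono) (auto simp: O1_def)
  ultimately show "card OO1 + (2 * card T + 2 * (card DD div 4)) = 4 * N * M"
    using k card_O_all by simp
  show "4 dvd card DD" using k by simp
  have "DD \<subseteq> OO4" by (auto simp: O4_double_def)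
  then have "4 * k \<le> 2 * card T + 2 * k" using card_mono[OF finite_O4] k by metis
  then show "card DD \<le> 4 * card T" using k by simp
qed

text \<open>X is the set of types with \<alpha>2 = \<alpha>3 = 0. As \<open>noL2v\<close> excludes
  the vertical models, X is the union of \<open>OO1\<close> and \<open>OO2\<close>, and \<chi>1^2 =
  1 separates the two because l1 \<noteq> 0.\<close>

lemma list_with_L2h:
  assumes sol: "sol_choice \<delta>" and l1: "l1 \<noteq> 0"
    and X_sub: "X \<subseteq> O_all N M"
    and X_iff: "\<forall>\<chi>\<in>O_all N M. \<chi> \<in> X \<longleftrightarrow> alpha2 l2 \<chi> = 0 \<and> alpha3 l1 l2 l3 \<chi> = 0"
    and noL2v: "\<forall>\<chi>\<in>O_all N M. alpha1 l1 \<chi> = 0 \<longrightarrow> alpha3 l1 l2 l3 \<chi> = 0 \<longrightarrow> alpha2 l2 \<chi> = 0"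
    and D: "DD = {}"
  defines "A \<equiv> {\<chi> \<in> X. (fst \<chi>)\<^sup>2 = 1}" and "Th \<equiv> {\<chi> \<in> X. fst \<chi> \<in> half_roots N \<zeta>}"
  shows "OO4 = O_all N M - X"
    and "card X = card A + 2 * card Th"
    and "\<And>T. transversal OO4 type_sim T \<Longrightarrow>
      simples_up_to_iso HH (L1 ` A \<union> L2h l1 ` Th \<union> L4s \<delta> T) TYPE('b) \<and>
      card (L1 ` A) = card A \<and> card (L2h l1 ` Th) = card Th \<and> card (L4s \<delta> T) = card T \<and>
      2 * card T + card X = 4 * N * M" (is "\<And>T. _ \<Longrightarrow> ?P T")
proof -
  note X = X_sub X_iff[rule_format]
  have a1: "alpha1 l1 \<chi> = 0 \<longleftrightarrow> (fst \<chi>)\<^sup>2 = 1" for \<chi> using l1 by (auto simp: alpha1_def)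
  have O1: "OO1 = A" using X by (auto simp: A_def O1_def a1)
  have O2: "OO2 = {\<chi> \<in> X. (fst \<chi>)\<^sup>2 \<noteq> 1}" using X noL2v by (auto simp: O2_def a1)
  show O4: "OO4 = O_all N M - X" unfolding O4_Diff O1 O2 by (auto simp: A_def)
  have bar: "bar_type \<chi> \<in> X" if "\<chi> \<in> X" for \<chi>
    using that X(2)[of \<chi>] X(2)[of "bar_type \<chi>"] X(1) orbit_O_all[of "bar_type \<chi>" \<chi> N M] by auto
  have fin: "finite X" using X(1) finite_O_all by (rule finite_subset)
  have half: "Th \<subseteq> OO2" "card OO2 = 2 * card Th"
    "\<And>\<chi>. \<chi> \<in> OO2 \<Longrightarrow> (\<chi> \<in> Th) \<noteq> (bar_type \<chi> \<in> Th)"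
    unfolding O2 Th_def using fin bar by (intro half_fst[OF N_pos prim_\<zeta> X(1)]; simp)+
  have "X = A \<union> OO2" unfolding O2 by (auto simp: A_def)
  moreover have "A \<inter> OO2 = {}" unfolding O2 by (auto simp: A_def)
  moreover have "finite A" "finite OO2" using fin unfolding O2 by (auto simp: A_def)
  ultimately have "card X = card A + card OO2" by (metis card_Un_disjoint)
  then show cX: "card X = card A + 2 * card Th" using half(2) by simp
  have a2: "alpha2 l2 \<chi> = 0" "alpha1 l1 \<chi> \<noteq> 0" if "\<chi> \<in> OO2" for \<chi>
    using that X(1) X(2)[of \<chi>] unfolding O2 by (auto simp: a1)
  fix T assume "transversal OO4 type_sim T"
  then have T: "transversal OO4 sim' T" using type_sim'_eq[OF D] by simp
  have h: "\<chi> \<in> OO2 \<and> alpha1 l1 \<chi> \<noteq> 0" if "\<chi> \<in> Th" for \<chi>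
    using that half(1) a2 by blast
  have v: "\<And>\<chi>. \<chi> \<in> {} \<Longrightarrow> \<chi> \<in> OO2 \<and> alpha2 l2 \<chi> \<noteq> 0"
    "\<And>\<chi>. \<chi> \<in> OO2 \<Longrightarrow> alpha2 l2 \<chi> \<noteq> 0 \<Longrightarrow> (\<chi> \<in> {}) \<noteq> (neg_type \<chi> \<in> {})"
    using a2(1) by simp_all
  note models = sol h half(3) v T
  have "2 * card T + card X = 4 * N * M"
  proof -
    have "card (O_all N M - X) = card (O_all N M :: ('k \<times> 'k) set) - card X"
      using X(1) fin by (rule card_Diff_subset[rotated])
    moreover have "card X \<le> card (O_all N M :: ('k \<times> 'k) set)" by (rule card_mono[OF finite_O_all X(1)])
    ultimately show ?thesis
      using card_L4s_no_double[OF D \<open>transversal _ type_sim T\<close>] card_O_all by (simp add: O4)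
  qed
  then show "?P T"
    using simples_models[OF models, where 'b = 'b] models_inj[OF models]
    by (simp add: O1 card_image)
qed

lemma list_with_L2v:
  assumes sol: "sol_choice \<delta>" and l2: "l2 \<noteq> 0"
    and X_sub: "X \<subseteq> O_all N M"
    and X_iff: "\<forall>\<chi>\<in>O_all N M. \<chi> \<in> X \<longleftrightarrow> alpha1 l1 \<chi> = 0 \<and> alpha3 l1 l2 l3 \<chi> = 0"
    and noL2h: "\<forall>\<chi>\<in>O_all N M. alpha2 l2 \<chi> = 0 \<longrightarrow> alpha3 l1 l2 l3 \<chi> = 0 \<longrightarrow> alpha1 l1 \<chi> = 0"
    and D: "DD = {}"
  defines "A \<equiv> {\<chi> \<in> X. (snd \<chi>)\<^sup>2 = 1}" and "Tv \<equiv> {\<chi> \<in> X. snd \<chi> \<in> half_roots M \<xi>}"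
  shows "OO4 = O_all N M - X"
    and "card X = card A + 2 * card Tv"
    and "\<And>T. transversal OO4 type_sim T \<Longrightarrow>
      simples_up_to_iso HH (L1 ` A \<union> L2v l2 ` Tv \<union> L4s \<delta> T) TYPE('b) \<and>
      card (L1 ` A) = card A \<and> card (L2v l2 ` Tv) = card Tv \<and> card (L4s \<delta> T) = card T \<and>
      2 * card T + card X = 4 * N * M" (is "\<And>T. _ \<Longrightarrow> ?P T")
proof -
  note X = X_sub X_iff[rule_format]
  have a2: "alpha2 l2 \<chi> = 0 \<longleftrightarrow> (snd \<chi>)\<^sup>2 = 1" for \<chi> using l2 by (auto simp: alpha2_def)
  have O1: "OO1 = A" using X by (auto simp: A_def O1_def a2)
  have O2: "OO2 = {\<chi> \<in> X. (snd \<chi>)\<^sup>2 \<noteq> 1}" using X noL2h by (auto simp: O2_def a2)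
  show O4: "OO4 = O_all N M - X" unfolding O4_Diff O1 O2 by (auto simp: A_def)
  have neg: "neg_type \<chi> \<in> X" if "\<chi> \<in> X" for \<chi>
    using that X(2)[of \<chi>] X(2)[of "neg_type \<chi>"] X(1) orbit_O_all[of "neg_type \<chi>" \<chi> N M] by auto
  have fin: "finite X" using X(1) finite_O_all by (rule finite_subset)
  have half: "Tv \<subseteq> OO2" "card OO2 = 2 * card Tv"
    "\<And>\<chi>. \<chi> \<in> OO2 \<Longrightarrow> (\<chi> \<in> Tv) \<noteq> (neg_type \<chi> \<in> Tv)"
    unfolding O2 Tv_def using fin neg by (intro half_snd[OF M_pos prim_\<xi> X(1)]; simp)+
  have "X = A \<union> OO2" unfolding O2 by (auto simp: A_def)
  moreover have "A \<inter> OO2 = {}" unfolding O2 by (auto simp: A_def)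
  moreover have "finite A" "finite OO2" using fin unfolding O2 by (auto simp: A_def)
  ultimately have "card X = card A + card OO2" by (metis card_Un_disjoint)
  then show cX: "card X = card A + 2 * card Tv" using half(2) by simp
  have a1: "alpha1 l1 \<chi> = 0" "alpha2 l2 \<chi> \<noteq> 0" if "\<chi> \<in> OO2" for \<chi>
    using that X(1) X(2)[of \<chi>] unfolding O2 by (auto simp: a2)
  fix T assume "transversal OO4 type_sim T"
  then have T: "transversal OO4 sim' T" using type_sim'_eq[OF D] by simp
  have v: "\<chi> \<in> OO2 \<and> alpha2 l2 \<chi> \<noteq> 0" if "\<chi> \<in> Tv" for \<chi>
    using that half(1) a1 by blast
  have h: "\<And>\<chi>. \<chi> \<in> {} \<Longrightarrow> \<chi> \<in> OO2 \<and> alpha1 l1 \<chi> \<noteq> 0"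
    "\<And>\<chi>. \<chi> \<in> OO2 \<Longrightarrow> alpha1 l1 \<chi> \<noteq> 0 \<Longrightarrow> (\<chi> \<in> {}) \<noteq> (bar_type \<chi> \<in> {})"
    using a1(1) by simp_all
  note models = sol h v half(3) T
  have "2 * card T + card X = 4 * N * M"
  proof -
    have "card (O_all N M - X) = card (O_all N M :: ('k \<times> 'k) set) - card X"
      using X(1) fin by (rule card_Diff_subset[rotated])
    moreover have "card X \<le> card (O_all N M :: ('k \<times> 'k) set)" by (rule card_mono[OF finite_O_all X(1)])
    ultimately show ?thesis
      using card_L4s_no_double[OF D \<open>transversal _ type_sim T\<close>] card_O_all by (simp add: O4)
  qed
  then show "?P T"
    using simples_models[OF models, where 'b = 'b] models_inj[OF models]
    by (simp add: O1 card_image)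
qed

end

section \<open>The cases of the theorem\<close>

lemma pm1_roots: "{1, -1} \<subseteq> roots_1 (2 * n)"
  by (simp add: roots_1_def)

lemma pm1_card: "card {1, -1 :: 'k::field_char_0} = 2"
  by (simp add: card_insert_if)

context H_closed
begin

lemma half_in_roots:
  "x \<in> half_roots N \<zeta> \<Longrightarrow> x \<in> roots_1 (2 * N)" "x \<in> half_roots M \<xi> \<Longrightarrow> x \<in> roots_1 (2 * M)"
  using half_roots_props(1)[OF N_pos prim_\<zeta>] half_roots_props(1)[OF M_pos prim_\<xi>] by auto

lemma S_set_pm1:
  "{\<chi> \<in> S_set N M. (fst \<chi>)\<^sup>2 = (1 :: 'k)} = {1, -1} \<times> {1, -1}"
  "{\<chi> \<in> S_set N M. (snd \<chi>)\<^sup>2 = (1 :: 'k)} = {1, -1} \<times> {1, -1}"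
proof -
  have O: "\<chi> \<in> O_all N M" if "(fst \<chi>)\<^sup>2 = 1" "(snd \<chi>)\<^sup>2 = 1" for \<chi> :: "'k \<times> 'k"
    using that pm1_roots[of N] pm1_roots[of M] unfolding O_all_def sq_eq_1_iff mem_Times_iff by blast
  have P: "{\<chi> :: 'k \<times> 'k. (fst \<chi>)\<^sup>2 = 1 \<and> (snd \<chi>)\<^sup>2 = 1} = {1, -1} \<times> {1, -1}"
    unfolding sq_eq_1_iff by (auto simp: set_eq_iff)
  show "{\<chi> \<in> S_set N M. (fst \<chi>)\<^sup>2 = (1 :: 'k)} = {1, -1} \<times> {1, -1}"
    unfolding P[symmetric] S_set_def using O by (intro Collect_cong) auto
  show "{\<chi> \<in> S_set N M. (snd \<chi>)\<^sup>2 = (1 :: 'k)} = {1, -1} \<times> {1, -1}"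
    unfolding P[symmetric] S_set_def using O by (intro Collect_cong) auto
qed

text \<open>A double root requires \<alpha>1 and \<alpha>2 to be nonzero, hence l1 and l2.\<close>

lemma O4_double_empty: "l1 * l2 = 0 \<Longrightarrow> DD = {}"
  by (auto simp: O4_double_def alpha1_def alpha2_def)

lemma card_pm1_pm1: "card ({1, -1 :: 'k} \<times> {1, -1 :: 'k}) = 4"
  by (simp only: card_cartesian_product pm1_card)

context
  fixes \<delta> assumes sol: "sol_choice \<delta>"
begin

lemma case_all_zero:
  assumes "l1 = 0" "l2 = 0" "l3 = 0"
  shows "simples_up_to_iso HH (L1 ` O_all N M) TYPE('b) \<and> card (L1 ` (O_all N M :: ('k \<times> 'k) set)) = 4 * M * N"
proof -
  have O1: "OO1 = O_all N M" and O2: "OO2 = {}"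
    using assms by (auto simp: O1_def O2_def alpha1_def alpha2_def alpha3_def)
  have T: "transversal OO4 sim' {}"
    unfolding O4_Diff O1 O2 by (simp add: transversal_empty)
  note L = list_without_L2[OF sol O2 T, unfolded O1]
  show ?thesis using L(1)[where 'b = 'b] L(2) card_O_all by (simp add: mult_ac)
qed

lemma case_l1:
  assumes "l1 \<noteq> 0" "l2 = 0" "l3 = 0"
  shows "simples_up_to_iso HH (L1 ` ({1, -1} \<times> roots_1 (2 * M)) \<union> L2h l1 ` (half_roots N \<zeta> \<times> roots_1 (2 * M)))
      TYPE('b) \<and>
    card (L1 ` ({1, -1 :: 'k} \<times> roots_1 (2 * M))) = 4 * M \<and>
    card (L2h l1 ` (half_roots N \<zeta> \<times> roots_1 (2 * M))) = 2 * M * (N - 1)"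
proof -
  have X: "\<forall>\<chi>\<in>O_all N M. \<chi> \<in> O_all N M \<longleftrightarrow> alpha2 l2 \<chi> = 0 \<and> alpha3 l1 l2 l3 \<chi> = 0"
    using assms by (simp add: alpha2_def alpha3_def)
  have v: "\<forall>\<chi>\<in>O_all N M. alpha1 l1 \<chi> = 0 \<longrightarrow> alpha3 l1 l2 l3 \<chi> = 0 \<longrightarrow> alpha2 l2 \<chi> = 0"
    using assms by (simp add: alpha2_def)
  have A: "{\<chi> \<in> O_all N M. (fst \<chi>)\<^sup>2 = (1 :: 'k)} = {1, -1} \<times> roots_1 (2 * M)"
    using pm1_roots[of N] by (auto simp: O_all_def sq_eq_1_iff)
  have Th: "{\<chi> \<in> O_all N M. fst \<chi> \<in> half_roots N \<zeta>} = half_roots N \<zeta> \<times> roots_1 (2 * M)"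
    using half_in_roots by (auto simp: O_all_def)
  have D: "DD = {}" by (rule O4_double_empty) (simp add: assms)
  note L = list_with_L2h[OF sol assms(1) order_refl X v D, unfolded A Th]
  have T: "transversal OO4 type_sim {}"
    using L(1) assms by (simp add: transversal_empty)
  have "card ({1, -1 :: 'k} \<times> (roots_1 (2 * M) :: 'k set)) = 4 * M"
    by (simp only: card_cartesian_product pm1_card roots_1_primitive(3)[OF prim_\<xi>])
  moreover have "card (half_roots N \<zeta> \<times> (roots_1 (2 * M) :: 'k set)) = 2 * M * (N - 1)"
    using roots_1_primitive(3)[OF prim_\<xi>] half_roots_props(3)[OF N_pos prim_\<zeta>]
    by (simp add: card_cartesian_product)
  ultimately show ?thesis
    using L(3)[OF T, where 'b = 'b] by simp
qed

lemma case_l2: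
  assumes "l2 \<noteq> 0" "l1 = 0" "l3 = 0"
  shows "simples_up_to_iso HH (L1 ` (roots_1 (2 * N) \<times> {1, -1}) \<union> L2v l2 ` (roots_1 (2 * N) \<times> half_roots M \<xi>))
      TYPE('b) \<and>
    card (L1 ` (roots_1 (2 * N) \<times> {1, -1 :: 'k})) = 4 * N \<and>
    card (L2v l2 ` (roots_1 (2 * N) \<times> half_roots M \<xi>)) = 2 * N * (M - 1)"
proof -
  have X: "\<forall>\<chi>\<in>O_all N M. \<chi> \<in> O_all N M \<longleftrightarrow> alpha1 l1 \<chi> = 0 \<and> alpha3 l1 l2 l3 \<chi> = 0"
    using assms by (simp add: alpha1_def alpha3_def)
  have v: "\<forall>\<chi>\<in>O_all N M. alpha2 l2 \<chi> = 0 \<longrightarrow> alpha3 l1 l2 l3 \<chi> = 0 \<longrightarrow> alpha1 l1 \<chi> = 0"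
    using assms by (simp add: alpha1_def)
  have A: "{\<chi> \<in> O_all N M. (snd \<chi>)\<^sup>2 = (1 :: 'k)} = roots_1 (2 * N) \<times> {1, -1}"
    using pm1_roots[of M] by (auto simp: O_all_def sq_eq_1_iff)
  have Tv: "{\<chi> \<in> O_all N M. snd \<chi> \<in> half_roots M \<xi>} = roots_1 (2 * N) \<times> half_roots M \<xi>"
    using half_in_roots by (auto simp: O_all_def)
  have D: "DD = {}" by (rule O4_double_empty) (simp add: assms)
  note L = list_with_L2v[OF sol assms(1) order_refl X v D, unfolded A Tv]
  have T: "transversal OO4 type_sim {}"
    using L(1) assms by (simp add: transversal_empty)
  have "card ((roots_1 (2 * N) :: 'k set) \<times> {1, -1 :: 'k}) = 4 * N"
    by (simp only: card_cartesian_product pm1_card roots_1_primitive(3)[OF prim_\<zeta>])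
  moreover have "card ((roots_1 (2 * N) :: 'k set) \<times> half_roots M \<xi>) = 2 * N * (M - 1)"
    using roots_1_primitive(3)[OF prim_\<zeta>] half_roots_props(3)[OF M_pos prim_\<xi>]
    by (simp add: card_cartesian_product)
  ultimately show ?thesis
    using L(3)[OF T, where 'b = 'b] by simp
qed

text \<open>Here \<alpha>1 and \<alpha>2 vanish identically, so \<open>OO1\<close> is the zero set
  of \<alpha>3, which is \<open>S_set\<close>, and all other types are in
  \<open>OO4\<close>.\<close>

lemma case_l3:
  assumes "l3 \<noteq> 0" "l1 = 0" "l2 = 0" and T: "transversal (O_all N M - S_set N M) type_sim T"
  shows "simples_up_to_iso HH (L1 ` S_set N M \<union> L4s \<delta> T) TYPE('b) \<and>
    card (L1 ` (S_set N M :: ('k \<times> 'k) set)) = 4 * gcd N M \<and>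
    card (L4s \<delta> T) = 2 * N * M - 2 * gcd N M"
proof -
  have O1: "OO1 = S_set N M" and O2: "OO2 = {}"
    using assms by (auto simp: O1_def O2_def S_set_def alpha1_def alpha2_def alpha3_def)
  have D: "DD = {}" by (rule O4_double_empty) (simp add: assms)
  have "transversal OO4 sim' T"
    unfolding O4_Diff O1 O2 type_sim'_eq[OF D] using T by simp
  note L = list_without_L2[OF sol O2 this, unfolded O1 D]
  show ?thesis using L(1)[where 'b = 'b] L(2,3,4) card_S_set by simp
qed

lemma case_l2_l3:
  assumes "l2 * l3 \<noteq> 0" "l1 = 0" and T: "transversal OO4 type_sim T"
  shows "simples_up_to_iso HH (L1 ` ({1, -1} \<times> {1, -1}) \<union>
      L2v l2 ` {\<chi> \<in> S_set N M. snd \<chi> \<in> half_roots M \<xi>} \<union> L4s \<delta> T) TYPE('b) \<and>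
    card (L1 ` ({1, -1 :: 'k} \<times> {1, -1})) = 4 \<and>
    card (L2v l2 ` {\<chi> \<in> S_set N M. snd \<chi> \<in> half_roots M \<xi>}) = 2 * gcd N M - 2 \<and>
    card (L4s \<delta> T) = 2 * N * M - 2 * gcd N M"
proof -
  have sub: "S_set N M \<subseteq> (O_all N M :: ('k \<times> 'k) set)" by (auto simp: S_set_def)
  have X: "\<forall>\<chi>\<in>O_all N M. \<chi> \<in> S_set N M \<longleftrightarrow> alpha1 l1 \<chi> = 0 \<and> alpha3 l1 l2 l3 \<chi> = 0"
    using assms by (auto simp: S_set_def alpha1_def alpha3_def)
  have v: "\<forall>\<chi>\<in>O_all N M. alpha2 l2 \<chi> = 0 \<longrightarrow> alpha3 l1 l2 l3 \<chi> = 0 \<longrightarrow> alpha1 l1 \<chi> = 0"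
    using assms by (simp add: alpha1_def)
  have l2: "l2 \<noteq> 0" using assms by auto
  have D: "DD = {}" by (rule O4_double_empty) (simp add: assms)
  note L = list_with_L2v[OF sol l2 sub X v D, unfolded S_set_pm1]
  from L(3)[OF T, where 'b = 'b] show ?thesis
    by (elim conjE, intro conjI) (assumption | insert L(2) card_S_set card_pm1_pm1, linarith)+
qed

lemma case_l1_l3:
  assumes "l1 * l3 \<noteq> 0" "l2 = 0" and T: "transversal OO4 type_sim T"
  shows "simples_up_to_iso HH (L1 ` ({1, -1} \<times> {1, -1}) \<union>
      L2h l1 ` {\<chi> \<in> S_set N M. fst \<chi> \<in> half_roots N \<zeta>} \<union> L4s \<delta> T) TYPE('b) \<and>
    card (L1 ` ({1, -1 :: 'k} \<times> {1, -1})) = 4 \<and>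
    card (L2h l1 ` {\<chi> \<in> S_set N M. fst \<chi> \<in> half_roots N \<zeta>}) = 2 * gcd N M - 2 \<and>
    card (L4s \<delta> T) = 2 * N * M - 2 * gcd N M"
proof -
  have sub: "S_set N M \<subseteq> (O_all N M :: ('k \<times> 'k) set)" by (auto simp: S_set_def)
  have X: "\<forall>\<chi>\<in>O_all N M. \<chi> \<in> S_set N M \<longleftrightarrow> alpha2 l2 \<chi> = 0 \<and> alpha3 l1 l2 l3 \<chi> = 0"
    using assms by (auto simp: S_set_def alpha2_def alpha3_def)
  have v: "\<forall>\<chi>\<in>O_all N M. alpha1 l1 \<chi> = 0 \<longrightarrow> alpha3 l1 l2 l3 \<chi> = 0 \<longrightarrow> alpha2 l2 \<chi> = 0"
    using assms by (simp add: alpha2_def)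
  have l1: "l1 \<noteq> 0" using assms by auto
  have D: "DD = {}" by (rule O4_double_empty) (simp add: assms)
  note L = list_with_L2h[OF sol l1 sub X v D, unfolded S_set_pm1]
  from L(3)[OF T, where 'b = 'b] show ?thesis
    by (elim conjE, intro conjI) (assumption | insert L(2) card_S_set card_pm1_pm1, linarith)+
qed

lemma case_l1_l2:
  assumes "l1 * l2 \<noteq> 0" "l3 = 0" and T: "transversal OO4 type_sim T"
  shows "simples_up_to_iso HH (L1 ` ({1, -1} \<times> {1, -1}) \<union> L2v l2 ` ({1, -1} \<times> half_roots M \<xi>) \<union> L4s \<delta> T) TYPE('b) \<and>
    card (L1 ` ({1, -1 :: 'k} \<times> {1, -1})) = 4 \<and>
    card (L2v l2 ` ({1, -1} \<times> half_roots M \<xi>)) = 2 * (M - 1) \<and>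
    card (L4s \<delta> T) = 2 * M * (N - 1)"
proof -
  let ?X = "{1, -1 :: 'k} \<times> roots_1 (2 * M) :: ('k \<times> 'k) set"
  have sub: "?X \<subseteq> O_all N M" using pm1_roots[of N] by (auto simp: O_all_def)
  have l2: "l2 \<noteq> 0" and l1: "l1 \<noteq> 0" using assms by auto
  have a1: "alpha1 l1 \<chi> = 0 \<longleftrightarrow> (fst \<chi>)\<^sup>2 = 1" for \<chi> using l1 by (auto simp: alpha1_def)
  have a2: "alpha2 l2 \<chi> = 0 \<longleftrightarrow> (snd \<chi>)\<^sup>2 = 1" for \<chi> using l2 by (auto simp: alpha2_def)
  have X: "\<forall>\<chi>\<in>O_all N M. \<chi> \<in> ?X \<longleftrightarrow> alpha1 l1 \<chi> = 0 \<and> alpha3 l1 l2 l3 \<chi> = 0"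
    using assms(2) unfolding a1 by (auto simp: O_all_def mem_Times_iff sq_eq_1_iff alpha3_def)
  have v: "\<forall>\<chi>\<in>O_all N M. alpha2 l2 \<chi> = 0 \<longrightarrow> alpha3 l1 l2 l3 \<chi> = 0 \<longrightarrow> alpha1 l1 \<chi> = 0"
    \<comment> \<open>At \<chi>2^2 = 1 and l3 = 0 one has \<alpha>3 = -4 l1 l2 (1 - \<chi>1^2),
      which vanishes only for \<chi>1^2 = 1.\<close>
    using alpha3_snd_pm1[of _ l1 l2 l3] l1 l2 assms(2) unfolding a1 a2 by simp
  have D: "DD = {}"
  proof (rule equals0I)
    fix \<chi> assume \<chi>: "\<chi> \<in> DD"
    define x y where "x = (fst \<chi>)\<^sup>2" and "y = (snd \<chi>)\<^sup>2"
    have disc: "(alpha3 l1 l2 l3 \<chi>)\<^sup>2 - 4 * ((alpha1 l1 \<chi>)\<^sup>2 * alpha2 l2 \<chi>) * alpha2 l2 \<chi> = 0"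
      and nz: "alpha1 l1 \<chi> \<noteq> 0" "alpha2 l2 \<chi> \<noteq> 0"
      using \<chi> by (auto simp: O4_double_def)
    \<comment> \<open>For l3 = 0 the discriminant is 4 l1^2 l2^2 (1 - x)^2 times (1 + y)^2 - (1 -
      y)^2 = 4y.\<close>
    from disc have "l1\<^sup>2 * l2\<^sup>2 * (1 - x)\<^sup>2 * (16 * y) = 0"
      unfolding alpha1_def alpha2_def alpha3_def assms(2) x_def[symmetric] y_def[symmetric]
      by Groebner_Basis.algebra
    moreover have "x \<noteq> 1" using nz a1[of \<chi>] by (simp add: x_def)
    moreover have "y \<noteq> 0" using O_all_nz[of \<chi>] \<chi> by (auto simp: O4_double_def O4_def y_def)
    ultimately show False using l1 l2 by simp
  qed
  have A: "{\<chi> \<in> ?X. (snd \<chi>)\<^sup>2 = (1 :: 'k)} = {1, -1} \<times> {1, -1}"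
    using pm1_roots[of M] by (auto simp: sq_eq_1_iff)
  have Tv: "{\<chi> \<in> ?X. snd \<chi> \<in> half_roots M \<xi>} = {1, -1} \<times> half_roots M \<xi>"
    using half_in_roots by auto
  note L = list_with_L2v[OF sol l2 sub X v D, unfolded A Tv]
  have cX: "card ?X = 4 * M"
    by (simp only: card_cartesian_product pm1_card roots_1_primitive(3)[OF prim_\<xi>])
  have num: "2 * M * (N - 1) = 2 * N * M - 2 * M" by (simp only: diff_mult_distrib2) (simp add: mult_ac)
  from L(3)[OF T, where 'b = 'b] show ?thesis
    by (elim conjE, intro conjI) (assumption | insert L(2) cX num card_pm1_pm1, linarith)+
qed

text \<open>There are no two-dimensional models: \<alpha>2 = 0 gives \<alpha>3 = (l3 - 4 l1 l2) (1 -
  \<chi>1^2), and \<alpha>1 = 0 gives \<alpha>3 = l3 (1 - \<chi>2^2), so the vanishing of \<alpha>3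
  forces the other \<alpha> to vanish as well.\<close>

lemma case_generic:
  assumes "l1 * l2 * l3 \<noteq> 0" "l3 \<noteq> 4 * l1 * l2"
    and T: "transversal OO4 sim' T"
  shows "simples_up_to_iso HH (L1 ` ({1, -1} \<times> {1, -1}) \<union> L4s \<delta> T) TYPE('b) \<and>
    card (L1 ` ({1, -1 :: 'k} \<times> {1, -1})) = 4 \<and>
    card (L4s \<delta> T) = 2 * (N * M - 1) - card DD div 4"
proof -
  have nz: "l1 \<noteq> 0" "l2 \<noteq> 0" "l3 \<noteq> 0" using assms by auto
  have a1: "alpha1 l1 \<chi> = 0 \<longleftrightarrow> (fst \<chi>)\<^sup>2 = 1" for \<chi> using nz by (auto simp: alpha1_def)
  have a2: "alpha2 l2 \<chi> = 0 \<longleftrightarrow> (snd \<chi>)\<^sup>2 = 1" for \<chi> using nz by (auto simp: alpha2_def)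
  have O1: "OO1 = {1, -1} \<times> {1, -1}"
    using pm1_roots[of N] pm1_roots[of M] unfolding O1_def a1 a2
    by (auto simp: O_all_def sq_eq_1_iff alpha3_def)
  have O2: "OO2 = {}"
    unfolding O2_def a1 a2 using nz assms(2) alpha3_snd_pm1[of _ l1 l2 l3] by (auto simp: alpha3_def)
  note L = list_without_L2[OF sol O2 T, unfolded O1]
  show ?thesis
    using L(1)[where 'b = 'b] L(2-6) card_pm1_pm1 by (auto simp: diff_mult_distrib2)
qed

text \<open>For l3 = 4 l1 l2 the scalar \<alpha>3 contains the factor 1 - \<chi>2^2, so every type
  with \<alpha>2 = 0 has \<alpha>3 = 0: horizontal models appear at \<chi>2 = 1 and \<chi>2 = -1,
  and vertical ones cannot.\<close>

lemma case_special:
  assumes "l1 * l2 * l3 \<noteq> 0" "l3 = 4 * l1 * l2" and T: "transversal OO4 type_sim T"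
  shows "simples_up_to_iso HH (L1 ` ({1, -1} \<times> {1, -1}) \<union> L2h l1 ` (half_roots N \<zeta> \<times> {1, -1}) \<union> L4s \<delta> T) TYPE('b) \<and>
    card (L1 ` ({1, -1 :: 'k} \<times> {1, -1})) = 4 \<and>
    card (L2h l1 ` (half_roots N \<zeta> \<times> {1, -1})) = 2 * (N - 1) \<and>
    card (L4s \<delta> T) = 2 * N * (M - 1)"
proof -
  let ?X = "roots_1 (2 * N) \<times> {1, -1 :: 'k} :: ('k \<times> 'k) set"
  have sub: "?X \<subseteq> O_all N M" using pm1_roots[of M] by (auto simp: O_all_def)
  have nz: "l1 \<noteq> 0" "l2 \<noteq> 0" using assms by auto
  have a1: "alpha1 l1 \<chi> = 0 \<longleftrightarrow> (fst \<chi>)\<^sup>2 = 1" for \<chi> using nz by (auto simp: alpha1_def)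
  have a2: "alpha2 l2 \<chi> = 0 \<longleftrightarrow> (snd \<chi>)\<^sup>2 = 1" for \<chi> using nz by (auto simp: alpha2_def)
  have a3: "alpha3 l1 l2 l3 \<chi> = 2 * l1 * l2 * (1 + (fst \<chi>)\<^sup>2) * (1 - (snd \<chi>)\<^sup>2)" for \<chi>
    by (simp add: alpha3_def assms(2) algebra_simps)
  have X: "\<forall>\<chi>\<in>O_all N M. \<chi> \<in> ?X \<longleftrightarrow> alpha2 l2 \<chi> = 0 \<and> alpha3 l1 l2 l3 \<chi> = 0"
    unfolding a2 a3 by (auto simp: O_all_def mem_Times_iff sq_eq_1_iff)
  have v: "\<forall>\<chi>\<in>O_all N M. alpha1 l1 \<chi> = 0 \<longrightarrow> alpha3 l1 l2 l3 \<chi> = 0 \<longrightarrow> alpha2 l2 \<chi> = 0"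
    using nz unfolding a1 a2 a3 by simp
  have D: "DD = {}"
  proof (rule equals0I)
    fix \<chi> assume \<chi>: "\<chi> \<in> DD"
    define x y where "x = (fst \<chi>)\<^sup>2" and "y = (snd \<chi>)\<^sup>2"
    have disc: "(alpha3 l1 l2 l3 \<chi>)\<^sup>2 - 4 * ((alpha1 l1 \<chi>)\<^sup>2 * alpha2 l2 \<chi>) * alpha2 l2 \<chi> = 0"
      and nz4: "alpha1 l1 \<chi> \<noteq> 0" "alpha2 l2 \<chi> \<noteq> 0"
      using \<chi> by (auto simp: O4_double_def)
    \<comment> \<open>The discriminant is 4 l1^2 l2^2 (1 - y)^2 times (1 + x)^2 - (1 - x)^2 =
      4x.\<close>
    from disc have "l1\<^sup>2 * l2\<^sup>2 * (1 - y)\<^sup>2 * (16 * x) = 0"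
      unfolding alpha1_def alpha2_def a3 x_def[symmetric] y_def[symmetric]
      by Groebner_Basis.algebra
    moreover have "y \<noteq> 1" using nz4 a2[of \<chi>] by (simp add: y_def)
    moreover have "x \<noteq> 0" using O_all_nz[of \<chi>] \<chi> by (auto simp: O4_double_def O4_def x_def)
    ultimately show False using nz by simp
  qed
  have A: "{\<chi> \<in> ?X. (fst \<chi>)\<^sup>2 = (1 :: 'k)} = {1, -1} \<times> {1, -1}"
    using pm1_roots[of N] by (auto simp: sq_eq_1_iff)
  have Th: "{\<chi> \<in> ?X. fst \<chi> \<in> half_roots N \<zeta>} = half_roots N \<zeta> \<times> {1, -1}"
    using half_in_roots by auto
  note L = list_with_L2h[OF sol nz(1) sub X v D, unfolded A Th]
  have cX: "card ?X = 4 * N"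
    by (simp only: card_cartesian_product pm1_card roots_1_primitive(3)[OF prim_\<zeta>])
  have num: "2 * N * (M - 1) = 2 * N * M - 2 * N" by (simp add: diff_mult_distrib2)
  from L(3)[OF T, where 'b = 'b] show ?thesis
    by (elim conjE, intro conjI) (assumption | insert L(2) cX num card_pm1_pm1, linarith)+
qed

end

section \<open>The existence statement and the theorem\<close>

lemma classification':
  assumes "simple_module HH L"
  shows "\<exists>\<chi> \<in> roots_1 (2 * N) \<times> roots_1 (2 * M).
     (\<chi> \<in> OO1 \<and> iso_modules HH L (L1 \<chi>)) \<or>
     (\<chi> \<in> OO2 \<and> alpha1 l1 \<chi> \<noteq> 0 \<and> iso_modules HH L (L2h l1 \<chi>)) \<or>
     (\<chi> \<in> OO2 \<and> alpha2 l2 \<chi> \<noteq> 0 \<and> iso_modules HH L (L2v l2 \<chi>)) \<or>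
     (\<chi> \<in> OO4 \<and> (\<exists>d. L4_eq l1 l2 l3 \<chi> d \<and> iso_modules HH L (L4 l1 l2 l3 \<chi> d)))"
proof -
  obtain \<delta> where \<delta>: "sol_choice \<delta>" using solution_choice_exists ..
  obtain \<chi> where \<chi>: "\<chi> \<in> O_all N M" and "describes \<chi> L" using classification[OF assms] ..
  note cases = this(2)[unfolded describes_def]
  show ?thesis
  proof (cases "\<chi> \<in> OO4")
    case False
    with cases show ?thesis
      by (intro bexI[OF _ \<chi>[unfolded O_all_def]]) argo
  next
    case d: True
    from cases d have "\<forall>\<delta>. sol_choice \<delta> \<longrightarrow> (\<exists>\<chi>'\<in>orbit \<chi>. \<forall>\<chi>''.
        (\<chi>', \<chi>'') \<in> sim' \<longrightarrow> iso_modules HH L (L4 l1 l2 l3 \<chi>'' (\<delta> \<chi>)))"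
      by (simp add: O4_def)
    then obtain \<chi>' where \<chi>': "\<chi>' \<in> orbit \<chi>"
      "\<forall>\<chi>''. (\<chi>', \<chi>'') \<in> sim' \<longrightarrow> iso_modules HH L (L4 l1 l2 l3 \<chi>'' (\<delta> \<chi>))"
      using \<delta> by (elim allE[of _ \<delta>] impE) auto
    have "iso_modules HH L (L4 l1 l2 l3 \<chi>' (\<delta> \<chi>))"
      by (rule mp[OF spec[OF \<chi>'(2)]]) (simp add: type_sim'_def type_sim_def)
    moreover have "L4_eq l1 l2 l3 \<chi> (\<delta> \<chi>)"
      by (rule bspec[OF conjunct1[OF \<delta>[unfolded solution_choice_def]] d])
    then have "L4_eq l1 l2 l3 \<chi>' (\<delta> \<chi>)" by (simp add: orbit_L4_eq[OF \<chi>'(1)])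
    moreover have "\<chi>' \<in> OO4" using d orbit_O(3)[OF \<chi>'(1)] by simp
    moreover have "\<chi>' \<in> roots_1 (2 * N) \<times> roots_1 (2 * M)"
      using \<chi> orbit_O_all[OF \<chi>'(1)] unfolding O_all_def by blast
    ultimately show ?thesis by (intro bexI[of _ \<chi>']) auto
  qed
qed

end

theorem theorem4p5:
  fixes N M :: nat
    and l1 l2 l3 \<zeta> \<xi> :: "'k::{alg_closed_field, field_char_0}"
  assumes "N \<ge> 1" and "M \<ge> 1"
    and "primitive_root_of_unity (2 * N) \<zeta>" and "primitive_root_of_unity (2 * M) \<xi>"
  shows
    "(\<forall>L :: ('k free_alg set, 'b) module. simple_module (H N M l1 l2 l3) L \<longrightarrow>
        (\<exists>\<chi> \<in> roots_1 (2 * N) \<times> roots_1 (2 * M).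
           (\<chi> \<in> O1 N M l1 l2 l3 \<and> iso_modules (H N M l1 l2 l3) L (L1 \<chi>)) \<or>
           (\<chi> \<in> O2 N M l1 l2 l3 \<and> alpha1 l1 \<chi> \<noteq> 0 \<and>
              iso_modules (H N M l1 l2 l3) L (L2h l1 \<chi>)) \<or>
           (\<chi> \<in> O2 N M l1 l2 l3 \<and> alpha2 l2 \<chi> \<noteq> 0 \<and>
              iso_modules (H N M l1 l2 l3) L (L2v l2 \<chi>)) \<or>
           (\<chi> \<in> O4 N M l1 l2 l3 \<and>
              (\<exists>d. L4_eq l1 l2 l3 \<chi> d \<and> iso_modules (H N M l1 l2 l3) L (L4 l1 l2 l3 \<chi> d))))) \<and>
     (\<forall>\<chi> \<in> O4 N M l1 l2 l3. \<forall>d. L4_eq l1 l2 l3 \<chi> d \<longrightarrow>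
        simple_module (H N M l1 l2 l3) (L4 l1 l2 l3 \<chi> d)) \<and>
     (\<exists>\<delta>. solution_choice N M l1 l2 l3 \<delta>) \<and>
     (\<forall>\<delta>. solution_choice N M l1 l2 l3 \<delta> \<longrightarrow>
       (l1 = 0 \<and> l2 = 0 \<and> l3 = 0 \<longrightarrow>
          simples_up_to_iso (H N M l1 l2 l3) (L1 ` O_all N M) TYPE('b) \<and>
          card (L1 ` (O_all N M :: ('k \<times> 'k) set)) = 4 * M * N) \<and>
       (l1 \<noteq> 0 \<and> l2 = 0 \<and> l3 = 0 \<longrightarrow>
          simples_up_to_iso (H N M l1 l2 l3)
            (L1 ` ({1, -1} \<times> roots_1 (2 * M)) \<union>
             L2h l1 ` (half_roots N \<zeta> \<times> roots_1 (2 * M))) TYPE('b) \<and>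
          card (L1 ` ({1, -1 :: 'k} \<times> roots_1 (2 * M))) = 4 * M \<and>
          card (L2h l1 ` (half_roots N \<zeta> \<times> roots_1 (2 * M))) = 2 * M * (N - 1)) \<and>
       (l2 \<noteq> 0 \<and> l1 = 0 \<and> l3 = 0 \<longrightarrow>
          simples_up_to_iso (H N M l1 l2 l3)
            (L1 ` (roots_1 (2 * N) \<times> {1, -1}) \<union>
             L2v l2 ` (roots_1 (2 * N) \<times> half_roots M \<xi>)) TYPE('b) \<and>
          card (L1 ` (roots_1 (2 * N) \<times> {1, -1 :: 'k})) = 4 * N \<and>
          card (L2v l2 ` (roots_1 (2 * N) \<times> half_roots M \<xi>)) = 2 * N * (M - 1)) \<and>
       (l3 \<noteq> 0 \<and> l1 = 0 \<and> l2 = 0 \<longrightarrow>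
          (\<forall>T. transversal (O_all N M - S_set N M) type_sim T \<longrightarrow>
             simples_up_to_iso (H N M l1 l2 l3)
               (L1 ` S_set N M \<union> (\<lambda>\<chi>. L4 l1 l2 l3 \<chi> (\<delta> \<chi>)) ` T) TYPE('b) \<and>
             card (L1 ` (S_set N M :: ('k \<times> 'k) set)) = 4 * gcd N M \<and>
             card ((\<lambda>\<chi>. L4 l1 l2 l3 \<chi> (\<delta> \<chi>)) ` T) = 2 * N * M - 2 * gcd N M)) \<and>
       (l2 * l3 \<noteq> 0 \<and> l1 = 0 \<longrightarrow>
          (\<forall>T. transversal (O4 N M l1 l2 l3) type_sim T \<longrightarrow>
             simples_up_to_iso (H N M l1 l2 l3)
               (L1 ` ({1, -1} \<times> {1, -1}) \<union>
                L2v l2 ` {\<chi> \<in> S_set N M. snd \<chi> \<in> half_roots M \<xi>} \<union>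
                (\<lambda>\<chi>. L4 l1 l2 l3 \<chi> (\<delta> \<chi>)) ` T) TYPE('b) \<and>
             card (L1 ` ({1, -1 :: 'k} \<times> {1, -1})) = 4 \<and>
             card (L2v l2 ` {\<chi> \<in> S_set N M. snd \<chi> \<in> half_roots M \<xi>}) = 2 * gcd N M - 2 \<and>
             card ((\<lambda>\<chi>. L4 l1 l2 l3 \<chi> (\<delta> \<chi>)) ` T) = 2 * N * M - 2 * gcd N M)) \<and>
       (l1 * l3 \<noteq> 0 \<and> l2 = 0 \<longrightarrow>
          (\<forall>T. transversal (O4 N M l1 l2 l3) type_sim T \<longrightarrow>
             simples_up_to_iso (H N M l1 l2 l3)
               (L1 ` ({1, -1} \<times> {1, -1}) \<union>
                L2h l1 ` {\<chi> \<in> S_set N M. fst \<chi> \<in> half_roots N \<zeta>} \<union>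
                (\<lambda>\<chi>. L4 l1 l2 l3 \<chi> (\<delta> \<chi>)) ` T) TYPE('b) \<and>
             card (L1 ` ({1, -1 :: 'k} \<times> {1, -1})) = 4 \<and>
             card (L2h l1 ` {\<chi> \<in> S_set N M. fst \<chi> \<in> half_roots N \<zeta>}) = 2 * gcd N M - 2 \<and>
             card ((\<lambda>\<chi>. L4 l1 l2 l3 \<chi> (\<delta> \<chi>)) ` T) = 2 * N * M - 2 * gcd N M)) \<and>
       (l1 * l2 \<noteq> 0 \<and> l3 = 0 \<longrightarrow>
          (\<forall>T. transversal (O4 N M l1 l2 l3) type_sim T \<longrightarrow>
             simples_up_to_iso (H N M l1 l2 l3)
               (L1 ` ({1, -1} \<times> {1, -1}) \<union>
                L2v l2 ` ({1, -1} \<times> half_roots M \<xi>) \<union>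
                (\<lambda>\<chi>. L4 l1 l2 l3 \<chi> (\<delta> \<chi>)) ` T) TYPE('b) \<and>
             card (L1 ` ({1, -1 :: 'k} \<times> {1, -1})) = 4 \<and>
             card (L2v l2 ` ({1, -1} \<times> half_roots M \<xi>)) = 2 * (M - 1) \<and>
             card ((\<lambda>\<chi>. L4 l1 l2 l3 \<chi> (\<delta> \<chi>)) ` T) = 2 * M * (N - 1))) \<and>
       (l1 * l2 * l3 \<noteq> 0 \<longrightarrow>
          (l3 \<noteq> 4 * l1 * l2 \<longrightarrow>
             (O4_double N M l1 l2 l3 = {} \<longrightarrow>
                (\<forall>T. transversal (O4 N M l1 l2 l3) type_sim T \<longrightarrow>
                   simples_up_to_iso (H N M l1 l2 l3)
                     (L1 ` ({1, -1} \<times> {1, -1}) \<union>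
                      (\<lambda>\<chi>. L4 l1 l2 l3 \<chi> (\<delta> \<chi>)) ` T) TYPE('b) \<and>
                   card (L1 ` ({1, -1 :: 'k} \<times> {1, -1})) = 4 \<and>
                   card ((\<lambda>\<chi>. L4 l1 l2 l3 \<chi> (\<delta> \<chi>)) ` T) = 2 * (N * M - 1))) \<and>
             (\<forall>T. transversal (O4 N M l1 l2 l3) (type_sim' N M l1 l2 l3) T \<longrightarrow>
                simples_up_to_iso (H N M l1 l2 l3)
                  (L1 ` ({1, -1} \<times> {1, -1}) \<union>
                   (\<lambda>\<chi>. L4 l1 l2 l3 \<chi> (\<delta> \<chi>)) ` T) TYPE('b) \<and>
                card (L1 ` ({1, -1 :: 'k} \<times> {1, -1})) = 4 \<and>
                card ((\<lambda>\<chi>. L4 l1 l2 l3 \<chi> (\<delta> \<chi>)) ` T) =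
                  2 * (N * M - 1) - card (O4_double N M l1 l2 l3) div 4)) \<and>
          (l3 = 4 * l1 * l2 \<longrightarrow>
             (\<forall>T. transversal (O4 N M l1 l2 l3) type_sim T \<longrightarrow>
                simples_up_to_iso (H N M l1 l2 l3)
                  (L1 ` ({1, -1} \<times> {1, -1}) \<union>
                   L2h l1 ` (half_roots N \<zeta> \<times> {1, -1}) \<union>
                   (\<lambda>\<chi>. L4 l1 l2 l3 \<chi> (\<delta> \<chi>)) ` T) TYPE('b) \<and>
                card (L1 ` ({1, -1 :: 'k} \<times> {1, -1})) = 4 \<and>
                card (L2h l1 ` (half_roots N \<zeta> \<times> {1, -1})) = 2 * (N - 1) \<and>
                card ((\<lambda>\<chi>. L4 l1 l2 l3 \<chi> (\<delta> \<chi>)) ` T) = 2 * N * (M - 1)))))"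
proof -
  interpret H_closed N M l1 l2 l3 \<zeta> \<xi>
    using assms by unfold_locales
  show ?thesis
    apply (rule conjI, intro allI impI, erule classification')
    apply (rule conjI, intro ballI allI impI, erule (1) simple_L4)
    apply (rule conjI, rule solution_choice_exists)
    apply (intro allI impI)
    apply (rule conjI, rule impI, elim conjE, erule (3) case_all_zero)
    apply (rule conjI, rule impI, elim conjE, erule (3) case_l1)
    apply (rule conjI, rule impI, elim conjE, erule (3) case_l2)
    apply (rule conjI, intro impI allI, elim conjE, erule (4) case_l3)
    apply (rule conjI, intro impI allI, elim conjE, erule (3) case_l2_l3)
    apply (rule conjI, intro impI allI, elim conjE, erule (3) case_l1_l3)
    apply (rule conjI, intro impI allI, elim conjE, erule (3) case_l1_l2)
    apply (rule impI)
    apply (rule conjI, rule impI, rule conjI)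
      apply (intro impI allI)
      \<comment> \<open>Without double roots \<open>sim'\<close> is \<open>type_sim\<close> and the
        correction term of the generic count is 0.\<close>
      subgoal premises prems for \<delta> T
        using case_generic[OF prems(1-3), of T, where 'b = 'b] prems(4,5) by (simp add: type_sim'_eq)
     apply (intro allI impI, erule (3) case_generic)
    apply (intro impI allI, erule (3) case_special)
    done
qed

end
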